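(* Let $Z$ be a JB*-triple with open unit ball $B$ and let $X$ be any (complex) Banach space. Let $f:B\to X$ be holomorphic on $B$ with a continuous extension to $\partial B$ (the extended function on $\overline{B}$ is also denoted $f$). For any $v\in\partial B$, with $G_v^0=\{g(v):g\in\mathrm{Aut}(B)^0\}$, we have $$f(\overline{B})\subseteq\overline{\operatorname{co}}\, f(G_v^0)$$ and $$\sup\{\|f(z)\|:z\in\overline{B}\}=\sup\{\|f(z)\|:z\in G_v^0\}.$$ In particular, if $f$ is unbounded then both suprema are infinite.
   Context: A JB*-triple is a complex Banach space $Z$ with a real trilinear map $\{\cdot,\cdot,\cdot\}:Z\times Z\times Z\to Z$ such that: (i) $\{x,y,z\}$ is complex linear and symmetric in the outer variables $x,z$ and complex anti-linear in $y$; (ii) for every $x\in Z$ the map $x\square x: z\mapsto\{x,x,z\}$ is a Hermitian operator with spectrum contained in $[0,\infty)$ and $\|x\square x\|=\|x\|^2$; (iii) $\{a,b,\{x,y,z\}\}=\{\{a,b,x\},y,z\}-\{x,\{b,a,y\},z\}+\{x,y,\{a,b,z\}\}$ for all $a,b,x,y,z\in Z$. $\mathrm{Aut}(B)$ is the group of biholomorphic maps of $B$ onto itself; every $g\in\mathrm{Aut}(B)$ extends continuously to $\overline B$ (indeed holomorphically to a neighbourhood of $\overline B$), and the extension is also denoted $g$. $\mathrm{Aut}(B)^0$ is the connected component of the identity in $\mathrm{Aut}(B)$, where $\mathrm{Aut}(B)$ carries its usual topology of locally uniform convergence on $B$. $\overline{\operatorname{co}}\,S$ denotes the norm-closed convex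 hull of $S$. Suprema are taken in $[0,\infty]$. *)

theory Defs
  imports "HOL-Analysis.Analysis"
begin

text \<open>The underlying real Banach space is the one of class \<^class>\<open>banach\<close>; the axioms make the
  complex scalar multiplication extend the real one and the norm complex homogeneous.\<close>

class complex_banach = banach +
  fixes scaleC :: "complex \<Rightarrow> 'a \<Rightarrow> 'a"  (infixr "*\<^sub>C" 75)
  assumes scaleC_add_right: "c *\<^sub>C (x + y) = c *\<^sub>C x + c *\<^sub>C y"
    and scaleC_add_left: "(c + d) *\<^sub>C x = c *\<^sub>C x + d *\<^sub>C x"
    and scaleC_scaleC: "c *\<^sub>C (d *\<^sub>C x) = (c * d) *\<^sub>C x"
    and scaleC_of_real: "complex_of_real r *\<^sub>C x = r *\<^sub>R x"
    and norm_scaleC: "norm (c *\<^sub>C x) = cmod c * norm x"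

definition clinear_map :: "('a::complex_banach \<Rightarrow> 'b::complex_banach) \<Rightarrow> bool" where
  "clinear_map T \<longleftrightarrow> (\<forall>x y. T (x + y) = T x + T y) \<and> (\<forall>c x. T (c *\<^sub>C x) = c *\<^sub>C T x)"

definition antilinear_map :: "('a::complex_banach \<Rightarrow> 'b::complex_banach) \<Rightarrow> bool" where
  "antilinear_map T \<longleftrightarrow> (\<forall>x y. T (x + y) = T x + T y) \<and> (\<forall>c x. T (c *\<^sub>C x) = cnj c *\<^sub>C T x)"

definition bounded_clinear_map :: "('a::complex_banach \<Rightarrow> 'b::complex_banach) \<Rightarrow> bool" where
  "bounded_clinear_map T \<longleftrightarrow> bounded_linear T \<and> clinear_map T"

definition exp_operator :: "complex \<Rightarrow> ('a::complex_banach \<Rightarrow> 'a) \<Rightarrow> 'a \<Rightarrow> 'a" where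
  "exp_operator c T x = (\<Sum>n. (c ^ n / fact n) *\<^sub>C (T ^^ n) x)"

definition hermitian_operator :: "('a::complex_banach \<Rightarrow> 'a) \<Rightarrow> bool" where
  "hermitian_operator T \<longleftrightarrow> bounded_clinear_map T \<and>
     (\<forall>t::real. \<forall>x. norm (exp_operator (\<i> * complex_of_real t) T x) = norm x)"

definition operator_spectrum :: "('a::complex_banach \<Rightarrow> 'a) \<Rightarrow> complex set" where
  "operator_spectrum T = {c. \<not> (\<exists>S. bounded_clinear_map S \<and>
     (\<forall>x. S (T x - c *\<^sub>C x) = x) \<and> (\<forall>x. T (S x) - c *\<^sub>C S x = x))}"

definition jb_star_triple :: "('z::complex_banach \<Rightarrow> 'z \<Rightarrow> 'z \<Rightarrow> 'z) \<Rightarrow> bool" where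
  "jb_star_triple tp \<longleftrightarrow>
     (\<forall>y z. clinear_map (\<lambda>x. tp x y z)) \<and>
     (\<forall>x z. antilinear_map (\<lambda>y. tp x y z)) \<and>
     (\<forall>x y. clinear_map (\<lambda>z. tp x y z)) \<and>
     (\<forall>x y z. tp x y z = tp z y x) \<and>
     (\<forall>x. hermitian_operator (tp x x) \<and>
          operator_spectrum (tp x x) \<subseteq> complex_of_real ` {0..} \<and>
          onorm (tp x x) = (norm x)\<^sup>2) \<and>
     (\<forall>a b x y z. tp a b (tp x y z) = tp (tp a b x) y z - tp x (tp b a y) z + tp x y (tp a b z))"

text \<open>Only meaningful for open \<open>S\<close>, since the derivative is taken at \<open>x\<close> in the whole space.\<close>

definition holomorphic_map_on :: "('a::complex_banach \<Rightarrow> 'b::complex_banach) \<Rightarrow> 'a set \<Rightarrow> bool" where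
  "holomorphic_map_on f S \<longleftrightarrow> (\<forall>x\<in>S. \<exists>D. (f has_derivative D) (at x) \<and> bounded_clinear_map D)"

text \<open>Automorphisms are kept extensional, so that each one is a single function on the whole type.\<close>

definition unit_ball_aut :: "('z::complex_banach \<Rightarrow> 'z) set" where
  "unit_ball_aut = {g \<in> extensional (ball 0 1). bij_betw g (ball 0 1) (ball 0 1) \<and>
     holomorphic_map_on g (ball 0 1) \<and> holomorphic_map_on (inv_into (ball 0 1) g) (ball 0 1)}"

definition locally_uniform_limit ::
  "'a::metric_space set \<Rightarrow> ('i \<Rightarrow> 'a \<Rightarrow> 'b::metric_space) \<Rightarrow> ('a \<Rightarrow> 'b) \<Rightarrow> 'i filter \<Rightarrow> bool" where
  "locally_uniform_limit S f l F \<longleftrightarrow> (\<forall>x\<in>S. \<exists>r>0. uniform_limit (S \<inter> ball x r) f l F)"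

text \<open>The topology of locally uniform convergence: a set \<open>U\<close> of automorphisms is open iff every
  filter of automorphisms that converges locally uniformly on the ball to some \<open>g \<in> U\<close> is
  eventually in \<open>U\<close>.\<close>

definition unit_ball_aut_open :: "('z::complex_banach \<Rightarrow> 'z) set \<Rightarrow> bool" where
  "unit_ball_aut_open U \<longleftrightarrow> U \<subseteq> unit_ball_aut \<and>
     (\<forall>g\<in>U. \<forall>F. F \<le> principal unit_ball_aut \<longrightarrow> locally_uniform_limit (ball 0 1) (\<lambda>h. h) g F
        \<longrightarrow> eventually (\<lambda>h. h \<in> U) F)"

lemma istopology_unit_ball_aut_open: "istopology unit_ball_aut_open"
  unfolding istopology_def
proof (intro conjI allI impI)
  fix U V :: "('a \<Rightarrow> 'a) set"
  assume "unit_ball_aut_open U" "unit_ball_aut_open V"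
  then show "unit_ball_aut_open (U \<inter> V)"
    unfolding unit_ball_aut_open_def by (auto intro: eventually_conj)
next
  fix K :: "('a \<Rightarrow> 'a) set set"
  assume K: "\<forall>U\<in>K. unit_ball_aut_open U"
  show "unit_ball_aut_open (\<Union>K)"
    unfolding unit_ball_aut_open_def
  proof (intro conjI ballI allI impI)
    show "\<Union>K \<subseteq> unit_ball_aut"
      using K unfolding unit_ball_aut_open_def by blast
  next
    fix g and F :: "('a \<Rightarrow> 'a) filter"
    assume "g \<in> \<Union>K" and F: "F \<le> principal unit_ball_aut"
      "locally_uniform_limit (ball 0 1) (\<lambda>h. h) g F"
    then obtain U where U: "U \<in> K" "g \<in> U" by blast
    with K F have "eventually (\<lambda>h. h \<in> U) F"
      unfolding unit_ball_aut_open_def by blast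
    then show "eventually (\<lambda>h. h \<in> \<Union>K) F"
      by (rule eventually_mono) (use U in blast)
  qed
qed

definition unit_ball_aut_topology :: "('z::complex_banach \<Rightarrow> 'z) topology" where
  "unit_ball_aut_topology = topology unit_ball_aut_open"

lemma openin_unit_ball_aut_topology: "openin unit_ball_aut_topology U \<longleftrightarrow> unit_ball_aut_open U"
  unfolding unit_ball_aut_topology_def
  by (simp add: topology_inverse' istopology_unit_ball_aut_open)

definition unit_ball_aut0 :: "('z::complex_banach \<Rightarrow> 'z) set" where
  "unit_ball_aut0 =
     connected_component_of_set unit_ball_aut_topology (restrict (\<lambda>x. x) (ball 0 1))"

text \<open>The value at a point \<open>v\<close> of the closed ball of the continuous extension of \<open>g\<close>, as the limit
  of \<open>g\<close> at \<open>v\<close> along the open ball.\<close>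

definition boundary_value :: "('z::complex_banach \<Rightarrow> 'z) \<Rightarrow> 'z \<Rightarrow> 'z" where
  "boundary_value g v = Lim (at v within ball 0 1) g"

definition orbit0 :: "'z::complex_banach \<Rightarrow> 'z set" where
  "orbit0 v = (\<lambda>g. boundary_value g v) ` unit_ball_aut0"

end

theory Submission
  imports Defs "HOL-Complex_Analysis.Complex_Analysis"
begin

text \<open>For \<open>b\<close> in the open ball \<open>B\<close> and a biholomorphic \<open>g\<close> in the identity component with \<open>g 0 = b\<close>, consider
  the disc \<open>w \<mapsto> f (g (w v))\<close>. Rotations belong to the identity component, so the boundary circle of
  the disc is mapped into \<open>f (G)\<close>, where \<open>G\<close> is the orbit of \<open>v\<close>, and its centre goes to \<open>f b\<close>. If \<open>f b\<close> were
  not in the closed convex hull of \<open>f (G)\<close>, a complex functional separating it from the hull would violate the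
  maximum principle on the disc. Continuity then gives the inclusion on the closed ball, and the two suprema agree
  because the orbit lies in the closed ball. What has to be proved is that the identity component acts
  transitively on \<open>B\<close>, and that all its members have boundary values.

  For transitivity (Kaup's theorem), write \<open>x \<box> y\<close> for the operator \<open>z \<mapsto> {x, y, z}\<close>. The
  vector fields \<open>a - {z, a, z}\<close> are shown to be tangent to the unit sphere; their flows, with time-dependent \<open>a\<close>, then
  preserve \<open>B\<close>, depend holomorphically on the initial value, and reach every point (\<open>flow_reaches\<close>). The
  tangency is the estimate \<open>\<parallel>z + t (a - {z, a, z})\<parallel> \<le> 1 + O(t\<^sup>2)\<close> of \<open>field_step_le\<close>.
  After subtracting the infinitesimal isometry \<open>2 (a \<box> z - z \<box> a)\<close> the step has a direction \<open>u\<close> with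
  \<open>u \<box> z + z \<box> u = y \<box> a + a \<box> y\<close>, where \<open>y = z - {z, z, z}\<close>. Since \<open>\<parallel>x\<parallel>\<^sup>2\<close> is the top of the
  numerical range of \<open>x \<box> x\<close>, only the positive forms \<open>(x, y) \<mapsto> \<Psi> {x, y, w}\<close> matter, for \<open>\<Psi>\<close> a functional
  supporting the ball at \<open>w\<close>, and by the Cauchy--Schwarz inequality it is enough to control \<open>\<Psi> {y, y, w}\<close> by the
  defect \<open>\<parallel>w\<parallel> - \<Psi> {z, z, w}\<close>. That control comes from a scalar fact about the odd functional calculus of \<open>z\<close>: the
  Newton--Schulz step \<open>(3 z - {z, z, z})/2\<close> does not leave the unit ball (\<open>newton_step_norm_le\<close>).

  The operator theory behind this concerns Hermitian operators \<open>H\<close>: spectrum in \<open>[0, \<infinity>)\<close> makes the numerical range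
  nonnegative, bounded powers bound the numerical range by one, and the norm is at most the numerical radius
  (Sinclair). These follow from a Phragmen--Lindelof principle, Cauchy's estimate and Bernstein's
  inequality for the entire functions \<open>z \<mapsto> \<Psi> (exp (z H) x)\<close>. The functionals come from the Hahn--Banach theorem.

  For boundary values, an arbitrary automorphism composed with one of the flows fixes the origin and is therefore
  linear by Cartan's uniqueness theorem, while the flows themselves are Lipschitz up to the boundary.\<close>

section \<open>Complex scalars and norming functionals\<close>

interpretation scaleC: bounded_bilinear "scaleC :: complex \<Rightarrow> 'a::complex_banach \<Rightarrow> 'a"
proof
  show "(a + a') *\<^sub>C b = a *\<^sub>C b + a' *\<^sub>C (b::'a)" for a a' b by (rule scaleC_add_left)
  show "a *\<^sub>C (b + b') = a *\<^sub>C b + a *\<^sub>C (b'::'a)" for a b b' by (rule scaleC_add_right)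
  show "(r *\<^sub>R a) *\<^sub>C b = r *\<^sub>R (a *\<^sub>C (b::'a))" for r a b
    by (simp add: scaleC_of_real[symmetric] scaleC_scaleC scaleR_conv_of_real)
  show "a *\<^sub>C (r *\<^sub>R b) = r *\<^sub>R (a *\<^sub>C (b::'a))" for r a b
    by (simp add: scaleC_of_real[symmetric] scaleC_scaleC mult.commute)
  show "\<exists>K. \<forall>a b. norm (a *\<^sub>C (b::'a)) \<le> norm a * norm b * K"
    by (rule exI[of _ 1]) (simp add: norm_scaleC)
qed

lemma scaleC_one [simp]: "1 *\<^sub>C (x::'a::complex_banach) = x"
  using scaleC_of_real[of 1 x] by simp

lemma scaleC_minus_one [simp]: "(- 1) *\<^sub>C (x::'a::complex_banach) = - x"
  by (simp add: scaleC.minus_left)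

lemma scaleC_i_i [simp]: "\<i> *\<^sub>C (\<i> *\<^sub>C (x::'a::complex_banach)) = - x"
  by (simp add: scaleC_scaleC)

lemma clinear_map_linear: "clinear_map T \<Longrightarrow> linear T"
  by (intro linearI) (auto simp: clinear_map_def scaleC_of_real[symmetric])

lemma antilinear_map_linear: "antilinear_map T \<Longrightarrow> linear T"
  by (intro linearI) (auto simp: antilinear_map_def scaleC_of_real[symmetric])

definition sublinear :: "('a::real_vector \<Rightarrow> real) \<Rightarrow> bool" where
  "sublinear q \<longleftrightarrow> (\<forall>x y. q (x + y) \<le> q x + q y) \<and> (\<forall>r x. 0 \<le> r \<longrightarrow> q (r *\<^sub>R x) = r * q x)"

lemma sublinear_add: "sublinear q \<Longrightarrow> q (x + y) \<le> q x + q y"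
  and sublinear_scaleR: "sublinear q \<Longrightarrow> 0 \<le> r \<Longrightarrow> q (r *\<^sub>R x) = r * q x"
  by (auto simp: sublinear_def)

lemma sublinear_zero: "sublinear q \<Longrightarrow> q 0 = 0"
  using sublinear_scaleR[of q 0 0] by simp

lemma sublinear_minus: "sublinear q \<Longrightarrow> - q (- x) \<le> q x"
  using sublinear_add[of q x "- x"] sublinear_zero[of q] by simp

text \<open>Positive homogeneity only has to be checked as an inequality, since the opposite inequality is the one for \<open>1/r\<close>.\<close>

lemma sublinearI:
  assumes "\<And>x y. q (x + y) \<le> q x + q y" and "q 0 = 0"
    and le: "\<And>r x. 0 < r \<Longrightarrow> q (r *\<^sub>R x) \<le> r * q x"
  shows "sublinear q"
  unfolding sublinear_def
proof (intro conjI allI impI)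
  fix r :: real and x assume "0 \<le> r"
  show "q (r *\<^sub>R x) = r * q x"
  proof (cases "r = 0")
    case False
    with \<open>0 \<le> r\<close> have r: "0 < r" by simp
    have "q ((1/r) *\<^sub>R (r *\<^sub>R x)) \<le> (1/r) * q (r *\<^sub>R x)" using r by (intro le) simp
    with r have "q x \<le> q (r *\<^sub>R x) / r" by simp
    with r have "r * q x \<le> q (r *\<^sub>R x)" by (simp add: field_simps)
    with le[OF r, of x] show ?thesis by simp
  qed (simp add: assms)
qed (rule assms)

text \<open>Hahn--Banach in its order form. A minimal sublinear functional \<open>m\<close> is linear, because for
  each \<open>y\<close> the infimum over \<open>t \<ge> 0\<close> of \<open>m (x + t y) - t m y\<close> is sublinear and below \<open>m\<close>, hence equal to
  \<open>m\<close>, and \<open>t = 1\<close> then gives superadditivity.\<close>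

lemma linear_minorant:
  fixes p :: "'a::real_vector \<Rightarrow> real"
  assumes p: "sublinear p"
  obtains \<phi> where "linear \<phi>" "\<And>x. \<phi> x \<le> p x"
proof -
  define A where "A = {q. sublinear q \<and> (\<forall>x. q x \<le> p x)}"
  define P :: "('a \<Rightarrow> real) \<Rightarrow> ('a \<Rightarrow> real) \<Rightarrow> bool" where "P = (\<lambda>q q'. \<forall>x. q' x \<le> q x)"
  have po: "partial_order_on A (relation_of P A)"
    by (rule partial_order_on_relation_ofI) (auto simp: P_def fun_eq_iff intro: order_trans antisym)
  have "\<exists>m\<in>A. \<forall>a\<in>A. P m a \<longrightarrow> a = m"
  proof (rule predicate_Zorn[OF po])
    fix C assume C: "C \<in> Chains (relation_of P A)"
    then have CA: "C \<subseteq> A" and ch: "\<And>q q'. q \<in> C \<Longrightarrow> q' \<in> C \<Longrightarrow> P q q' \<or> P q' q"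
      by (auto simp: Chains_def relation_of_def)
    show "\<exists>u\<in>A. \<forall>a\<in>C. P a u"
    proof (cases "C = {}")
      case True
      then show ?thesis using p by (auto simp: A_def)
    next
      case False
      define u where "u x = (INF q\<in>C. q x)" for x
      have bdd: "bdd_below ((\<lambda>q. q x) ` C)" for x
      proof (rule bdd_belowI)
        fix y assume "y \<in> (\<lambda>q. q x) ` C"
        then obtain q where q: "q \<in> C" "y = q x" by blast
        with CA have "sublinear q" "q (- x) \<le> p (- x)" by (auto simp: A_def)
        with sublinear_minus[of q x] q show "- p (- x) \<le> y" by simp
      qed
      have lower: "u x \<le> q x" if "q \<in> C" for q x
        unfolding u_def using that bdd by (rule cINF_lower[rotated])
      have great: "b \<le> u x" if "\<And>q. q \<in> C \<Longrightarrow> b \<le> q x" for b x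
        unfolding u_def using False that by (rule cINF_greatest)
      have near: "\<exists>q\<in>C. q x < u x + e" if "0 < e" for e x
      proof (rule ccontr)
        assume "\<not> ?thesis"
        then have "u x + e \<le> u x" by (intro great) force
        with that show False by simp
      qed
      have "sublinear u"
      proof (rule sublinearI)
        show "u (x + y) \<le> u x + u y" for x y
        proof (rule field_le_epsilon)
          fix e :: real assume "0 < e"
          then obtain q1 q2 where q: "q1 \<in> C" "q1 x < u x + e/2" "q2 \<in> C" "q2 y < u y + e/2"
            using near[of "e/2"] by (metis half_gt_zero)
          have "\<exists>q\<in>C. q x \<le> q1 x \<and> q y \<le> q2 y"
            using ch[OF q(1,3)] q by (auto simp: P_def)
          then obtain q3 where q3: "q3 \<in> C" "q3 x \<le> q1 x" "q3 y \<le> q2 y" by blast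
          have "u (x + y) \<le> q3 (x + y)" using q3 by (intro lower)
          also have "\<dots> \<le> q3 x + q3 y" using q3 CA by (intro sublinear_add) (auto simp: A_def)
          finally show "u (x + y) \<le> u x + u y + e" using q q3 by simp
        qed
        have "q 0 = 0" if "q \<in> C" for q using that CA sublinear_zero by (auto simp: A_def)
        then show "u 0 = 0" using False lower[of _ 0] great[of 0 0]
          by (metis antisym ex_in_conv order_refl)
        show "u (r *\<^sub>R x) \<le> r * u x" if "0 < r" for r x
        proof -
          have "u (r *\<^sub>R x) / r \<le> u x"
          proof (rule great)
            fix q assume q: "q \<in> C"
            with CA have "sublinear q" by (auto simp: A_def)
            with that have "q (r *\<^sub>R x) = r * q x" by (intro sublinear_scaleR) auto
            with lower[OF q, of "r *\<^sub>R x"] that show "u (r *\<^sub>R x) / r \<le> q x"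
              by (simp add: field_simps)
          qed
          with that show ?thesis by (simp add: field_simps)
        qed
      qed
      moreover have "u x \<le> p x" for x
      proof -
        obtain q where q: "q \<in> C" using False by blast
        with CA have "q x \<le> p x" by (auto simp: A_def)
        with lower[OF q, of x] show ?thesis by simp
      qed
      ultimately show ?thesis using lower by (auto simp: A_def P_def)
    qed
  qed
  then obtain m where "m \<in> A" and min: "\<And>a. a \<in> A \<Longrightarrow> P m a \<Longrightarrow> a = m" by blast
  then have m: "sublinear m" and mp: "\<And>x. m x \<le> p x" by (auto simp: A_def)
  have super: "m x + m y \<le> m (x + y)" for x y
  proof -
    define k where "k x = (INF t\<in>{0..}. m (x + t *\<^sub>R y) - t * m y)" for x
    have bdd: "bdd_below ((\<lambda>t. m (x + t *\<^sub>R y) - t * m y) ` {0..})" for x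
    proof (rule bdd_belowI2)
      fix t :: real assume "t \<in> {0..}"
      then have "t * m y = m (t *\<^sub>R y)" using m by (simp add: sublinear_scaleR)
      also have "\<dots> \<le> m (x + t *\<^sub>R y) + m (- x)" using sublinear_add[OF m, of "x + t *\<^sub>R y" "- x"] by simp
      finally show "- m (- x) \<le> m (x + t *\<^sub>R y) - t * m y" by simp
    qed
    have lower: "k x \<le> m (x + t *\<^sub>R y) - t * m y" if "0 \<le> t" for x t
      unfolding k_def using that by (intro cINF_lower bdd) simp
    have great: "b \<le> k x" if "\<And>t. 0 \<le> t \<Longrightarrow> b \<le> m (x + t *\<^sub>R y) - t * m y" for b x
      unfolding k_def using that by (intro cINF_greatest) auto
    have "sublinear k"
    proof (rule sublinearI)
      show "k (x1 + x2) \<le> k x1 + k x2" for x1 x2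
      proof -
        have "k (x1 + x2) - (m (x2 + t2 *\<^sub>R y) - t2 * m y) \<le> k x1" if "0 \<le> t2" for t2
        proof (rule great)
          fix t1 :: real assume "0 \<le> t1"
          with that have "k (x1 + x2) \<le> m ((x1 + x2) + (t1 + t2) *\<^sub>R y) - (t1 + t2) * m y"
            by (intro lower) simp
          moreover have "m ((x1 + x2) + (t1 + t2) *\<^sub>R y) \<le> m (x1 + t1 *\<^sub>R y) + m (x2 + t2 *\<^sub>R y)"
            using sublinear_add[OF m, of "x1 + t1 *\<^sub>R y" "x2 + t2 *\<^sub>R y"] by (simp add: algebra_simps)
          ultimately show "k (x1 + x2) - (m (x2 + t2 *\<^sub>R y) - t2 * m y) \<le> m (x1 + t1 *\<^sub>R y) - t1 * m y"
            by (simp add: algebra_simps)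
        qed
        then have "k (x1 + x2) - k x1 \<le> k x2" by (intro great) (simp add: algebra_simps)
        then show ?thesis by simp
      qed
      show "k 0 = 0"
      proof (rule antisym)
        show "k 0 \<le> 0" using lower[of 0 0] sublinear_zero[OF m] by simp
        show "0 \<le> k 0" by (rule great) (simp add: sublinear_scaleR[OF m])
      qed
      show "k (r *\<^sub>R x) \<le> r * k x" if "0 < r" for r x
      proof -
        have "k (r *\<^sub>R x) / r \<le> k x"
        proof (rule great)
          fix t :: real assume "0 \<le> t"
          with that have "k (r *\<^sub>R x) \<le> m (r *\<^sub>R x + (r * t) *\<^sub>R y) - r * t * m y" by (intro lower) simp
          also have "m (r *\<^sub>R x + (r * t) *\<^sub>R y) = r * m (x + t *\<^sub>R y)"
            using that sublinear_scaleR[OF m, of r "x + t *\<^sub>R y"] by (simp add: algebra_simps)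
          finally show "k (r *\<^sub>R x) / r \<le> m (x + t *\<^sub>R y) - t * m y" using that by (simp add: field_simps)
        qed
        with that show ?thesis by (simp add: field_simps)
      qed
    qed
    moreover have km: "k x \<le> m x" for x using lower[of 0 x] by simp
    moreover from km mp have "k x \<le> p x" for x using order_trans by blast
    ultimately have "k = m" by (intro min) (auto simp: A_def P_def)
    with lower[of 1 x] show ?thesis by simp
  qed
  have add: "m (x + y) = m x + m y" for x y using super[of x y] sublinear_add[OF m, of x y] by simp
  have neg: "m (- x) = - m x" for x using add[of x "- x"] sublinear_zero[OF m] by simp
  have "linear m"
  proof (rule linearI)
    show "m (r *\<^sub>R x) = r *\<^sub>R m x" for r x
    proof (cases "0 \<le> r")
      case False
      then have "m (r *\<^sub>R x) = - m ((- r) *\<^sub>R x)" using neg[of "r *\<^sub>R x"] by simp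
      also have "m ((- r) *\<^sub>R x) = - r * m x" using False by (intro sublinear_scaleR[OF m]) simp
      finally show ?thesis by simp
    qed (simp add: sublinear_scaleR[OF m])
  qed (rule add)
  with mp that show thesis by blast
qed

text \<open>Geometric form: a functional of norm at most one whose gap between \<open>x0\<close> and \<open>C\<close> is the whole
  distance. The sublinear functional used is the largest one below the norm taking at most the value
  \<open>- d\<close> at \<open>c - x0\<close> for every \<open>c \<in> C\<close>.\<close>

lemma real_separation:
  fixes C :: "'a::real_normed_vector set"
  assumes "convex C" "C \<noteq> {}" and d: "\<And>c. c \<in> C \<Longrightarrow> d \<le> norm (c - x0)"
  obtains \<psi> where "linear \<psi>" "\<And>x. \<psi> x \<le> norm x" "\<And>c. c \<in> C \<Longrightarrow> \<psi> c \<le> \<psi> x0 - d"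
proof -
  define k where "k x tc = norm (x - fst tc *\<^sub>R (snd tc - x0)) - fst tc * d" for x and tc :: "real \<times> 'a"
  define p where "p x = (INF tc\<in>{0..}\<times>C. k x tc)" for x
  have kb: "- norm x \<le> k x (t, c)" if "0 \<le> t" "c \<in> C" for x t c
  proof -
    have "t * d \<le> norm (t *\<^sub>R (c - x0))" using that d[of c] by (simp add: mult_left_mono)
    also have "\<dots> \<le> norm (x - t *\<^sub>R (c - x0)) + norm x"
      using norm_triangle_ineq4[of x "x - t *\<^sub>R (c - x0)"] by simp
    finally show ?thesis by (simp add: k_def)
  qed
  have bdd: "bdd_below (k x ` ({0..}\<times>C))" for x
    by (rule bdd_belowI2[of _ "- norm x"]) (use kb in auto)
  have lower: "p x \<le> k x (t, c)" if "0 \<le> t" "c \<in> C" for x t c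
    unfolding p_def using that by (intro cINF_lower bdd) auto
  have great: "b \<le> p x" if "\<And>t c. 0 \<le> t \<Longrightarrow> c \<in> C \<Longrightarrow> b \<le> k x (t, c)" for b x
    unfolding p_def using that \<open>C \<noteq> {}\<close> by (intro cINF_greatest) auto
  have pn: "p x \<le> norm x" for x
  proof -
    obtain c where "c \<in> C" using \<open>C \<noteq> {}\<close> by blast
    with lower[of 0 c x] show ?thesis by (simp add: k_def)
  qed
  have "sublinear p"
  proof (rule sublinearI)
    show "p (x + y) \<le> p x + p y" for x y
    proof -
      have "p (x + y) - k y (t2, c2) \<le> p x" if 2: "0 \<le> t2" "c2 \<in> C" for t2 c2
      proof (rule great)
        fix t1 :: real and c1 assume 1: "0 \<le> t1" "c1 \<in> C"
        have "p (x + y) \<le> k x (t1, c1) + k y (t2, c2)"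
        proof (cases "t1 + t2 = 0")
          case True
          with 1 2 have "t1 = 0" "t2 = 0" by auto
          with pn[of "x + y"] norm_triangle_ineq[of x y] show ?thesis by (simp add: k_def)
        next
          case False
          define c where "c = (t1 / (t1 + t2)) *\<^sub>R c1 + (t2 / (t1 + t2)) *\<^sub>R c2"
          have "t1 / (t1 + t2) + t2 / (t1 + t2) = 1" using False by (simp add: add_divide_distrib[symmetric])
          then have "c \<in> C" unfolding c_def using 1 2 by (intro convexD[OF \<open>convex C\<close>]) auto
          then have "p (x + y) \<le> k (x + y) (t1 + t2, c)" using 1 2 by (intro lower) auto
          also have "(t1 + t2) *\<^sub>R c = t1 *\<^sub>R c1 + t2 *\<^sub>R c2"
            using False by (simp add: c_def scaleR_add_right)
          then have "(x + y) - (t1 + t2) *\<^sub>R (c - x0) = (x - t1 *\<^sub>R (c1 - x0)) + (y - t2 *\<^sub>R (c2 - x0))"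
            by (simp add: algebra_simps)
          then have "k (x + y) (t1 + t2, c) \<le> k x (t1, c1) + k y (t2, c2)"
            using norm_triangle_ineq[of "x - t1 *\<^sub>R (c1 - x0)" "y - t2 *\<^sub>R (c2 - x0)"]
            by (simp add: k_def algebra_simps)
          finally show ?thesis .
        qed
        then show "p (x + y) - k y (t2, c2) \<le> k x (t1, c1)" by simp
      qed
      then have "p (x + y) - p x \<le> p y" by (intro great) (simp add: algebra_simps)
      then show ?thesis by simp
    qed
    show "p 0 = 0"
    proof (rule antisym)
      show "p 0 \<le> 0" using pn[of 0] by simp
      show "0 \<le> p 0" by (rule great) (use kb[of _ _ 0] in auto)
    qed
    show "p (r *\<^sub>R x) \<le> r * p x" if r: "0 < r" for r x
    proof -
      have "p (r *\<^sub>R x) / r \<le> p x"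
      proof (rule great)
        fix t :: real and c assume tc: "0 \<le> t" "c \<in> C"
        with r have "p (r *\<^sub>R x) \<le> k (r *\<^sub>R x) (r * t, c)" by (intro lower) auto
        also have "r *\<^sub>R x - (r * t) *\<^sub>R (c - x0) = r *\<^sub>R (x - t *\<^sub>R (c - x0))"
          by (simp add: algebra_simps)
        then have "k (r *\<^sub>R x) (r * t, c) = r * k x (t, c)"
          using r by (simp only: k_def fst_conv snd_conv norm_scaleR) (simp add: algebra_simps)
        finally show "p (r *\<^sub>R x) / r \<le> k x (t, c)" using r by (simp add: field_simps)
      qed
      with r show ?thesis by (simp add: field_simps)
    qed
  qed
  then obtain \<psi> where \<psi>: "linear \<psi>" "\<And>x. \<psi> x \<le> p x" by (rule linear_minorant) blast
  show thesis
  proof (rule that[OF \<psi>(1)])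
    show "\<psi> x \<le> norm x" for x using \<psi>(2)[of x] pn[of x] by simp
    fix c assume "c \<in> C"
    then have "\<psi> (c - x0) \<le> - d" using \<psi>(2)[of "c - x0"] lower[of 1 c "c - x0"] by (simp add: k_def)
    then show "\<psi> c \<le> \<psi> x0 - d" by (simp add: linear_diff[OF \<psi>(1)])
  qed
qed

definition dual_unit :: "('a::complex_banach \<Rightarrow> complex) \<Rightarrow> bool" where
  "dual_unit \<Psi> \<longleftrightarrow> linear \<Psi> \<and> (\<forall>c x. \<Psi> (c *\<^sub>C x) = c * \<Psi> x) \<and> (\<forall>x. cmod (\<Psi> x) \<le> norm x)"

lemma dual_unit_add: "dual_unit \<Psi> \<Longrightarrow> \<Psi> (x + y) = \<Psi> x + \<Psi> y"
  and dual_unit_diff: "dual_unit \<Psi> \<Longrightarrow> \<Psi> (x - y) = \<Psi> x - \<Psi> y"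
  and dual_unit_minus: "dual_unit \<Psi> \<Longrightarrow> \<Psi> (- x) = - \<Psi> x"
  and dual_unit_zero: "dual_unit \<Psi> \<Longrightarrow> \<Psi> 0 = 0"
  and dual_unit_scaleC: "dual_unit \<Psi> \<Longrightarrow> \<Psi> (c *\<^sub>C x) = c * \<Psi> x"
  and dual_unit_scaleR: "dual_unit \<Psi> \<Longrightarrow> \<Psi> (r *\<^sub>R x) = complex_of_real r * \<Psi> x"
  and dual_unit_norm: "dual_unit \<Psi> \<Longrightarrow> cmod (\<Psi> x) \<le> norm x"
  by (auto simp: dual_unit_def linear_add linear_diff linear_neg linear_0 scaleC_of_real[symmetric])

lemmas dual_unit_simps =
  dual_unit_add dual_unit_diff dual_unit_minus dual_unit_zero dual_unit_scaleC dual_unit_scaleR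

lemma dual_unit_Re: "dual_unit \<Psi> \<Longrightarrow> Re (\<Psi> x) \<le> norm x"
  using complex_Re_le_cmod[of "\<Psi> x"] dual_unit_norm[of \<Psi> x] by linarith

lemma dual_unit_bounded_linear: "dual_unit \<Psi> \<Longrightarrow> bounded_linear \<Psi>"
  unfolding dual_unit_def by (intro linear_conv_bounded_linear[THEN iffD1] bounded_linear_intro[of _ 1])
    (auto simp: linear_add linear_scale)

text \<open>The complexification \<open>\<psi> x - i \<psi> (i x)\<close> of a real functional has the same norm, as one sees by
  rotating \<open>x\<close> until the value is real.\<close>

lemma complex_separation:
  fixes C :: "'a::complex_banach set"
  assumes "convex C" "C \<noteq> {}" and d: "\<And>c. c \<in> C \<Longrightarrow> d \<le> norm (c - x0)"
  obtains \<Psi> where "dual_unit \<Psi>" "\<And>c. c \<in> C \<Longrightarrow> Re (\<Psi> c) \<le> Re (\<Psi> x0) - d"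
proof -
  obtain \<psi> where \<psi>: "linear \<psi>" "\<And>x. \<psi> x \<le> norm x" "\<And>c. c \<in> C \<Longrightarrow> \<psi> c \<le> \<psi> x0 - d"
    using real_separation[OF assms] by blast
  define \<Psi> where "\<Psi> x = Complex (\<psi> x) (- \<psi> (\<i> *\<^sub>C x))" for x
  have lin: "\<psi> (x + y) = \<psi> x + \<psi> y" "\<psi> (r *\<^sub>R x) = r * \<psi> x" "\<psi> (- x) = - \<psi> x" for x y r
    using \<psi>(1) by (auto simp: linear_add linear_scale linear_neg)
  have add: "\<Psi> (x + y) = \<Psi> x + \<Psi> y" for x y
    by (simp add: \<Psi>_def lin scaleC_add_right complex_eq_iff)
  have real: "\<Psi> (r *\<^sub>R x) = r *\<^sub>R \<Psi> x" for r x
    by (simp add: \<Psi>_def lin scaleC.scaleR_right complex_eq_iff)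
  have imag: "\<Psi> (\<i> *\<^sub>C x) = \<i> * \<Psi> x" for x
    by (simp add: \<Psi>_def lin complex_eq_iff)
  have cl: "\<Psi> (c *\<^sub>C x) = c * \<Psi> x" for c x
  proof -
    have "c *\<^sub>C x = (complex_of_real (Re c) + \<i> * complex_of_real (Im c)) *\<^sub>C x"
      by (simp add: complex_eq[symmetric])
    also have "\<dots> = Re c *\<^sub>R x + \<i> *\<^sub>C (Im c *\<^sub>R x)"
      by (simp add: scaleC_add_left scaleC_scaleC[symmetric] scaleC_of_real)
    finally have "\<Psi> (c *\<^sub>C x) = Re c *\<^sub>R \<Psi> x + \<i> * (Im c *\<^sub>R \<Psi> x)" by (simp add: add real imag)
    also have "\<dots> = c * \<Psi> x" by (simp add: complex_eq_iff algebra_simps)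
    finally show ?thesis .
  qed
  have "cmod (\<Psi> x) \<le> norm x" for x
  proof (cases "\<Psi> x = 0")
    case False
    define c where "c = cnj (\<Psi> x) / complex_of_real (cmod (\<Psi> x))"
    have c: "cmod c = 1" using False by (simp add: c_def norm_divide)
    have "\<Psi> (c *\<^sub>C x) = complex_of_real (cmod (\<Psi> x))"
      using False complex_norm_square[of "\<Psi> x"]
      by (simp add: cl c_def field_simps power2_eq_square)
    then have "cmod (\<Psi> x) = \<psi> (c *\<^sub>C x)" by (simp add: \<Psi>_def complex_eq_iff)
    also have "\<dots> \<le> norm (c *\<^sub>C x)" by (rule \<psi>(2))
    finally show ?thesis by (simp add: norm_scaleC c)
  qed simp
  with add real cl have "dual_unit \<Psi>" by (auto simp: dual_unit_def intro: linearI)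
  with \<psi>(3) that show thesis by (auto simp: \<Psi>_def)
qed

lemma supporting_functional:
  fixes x :: "'a::complex_banach"
  obtains \<Psi> where "dual_unit \<Psi>" "\<Psi> x = complex_of_real (norm x)"
proof -
  obtain \<Psi> :: "'a \<Rightarrow> complex" where \<Psi>: "dual_unit \<Psi>" "\<And>c. c \<in> {0} \<Longrightarrow> Re (\<Psi> c) \<le> Re (\<Psi> x) - norm x"
    by (rule complex_separation[of "{0}" "norm x" x]) auto
  then have "norm x \<le> Re (\<Psi> x)" by (simp add: dual_unit_zero)
  with dual_unit_norm[OF \<Psi>(1), of x] have "\<Psi> x = complex_of_real (norm x)"
    using complex_Re_le_cmod[of "\<Psi> x"] cmod_power2[of "\<Psi> x"]
    by (simp add: complex_eq_iff power2_eq_square) (smt (verit) mult_mono' norm_ge_zero zero_le_square mult_eq_0_iff)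
  with \<Psi>(1) that show thesis by blast
qed

lemma norm_le_dual:
  fixes x :: "'a::complex_banach"
  assumes "\<And>\<Psi>. dual_unit \<Psi> \<Longrightarrow> cmod (\<Psi> x) \<le> B"
  shows "norm x \<le> B"
proof -
  obtain \<Psi> where "dual_unit \<Psi>" "\<Psi> x = complex_of_real (norm x)" by (rule supporting_functional)
  with assms[of \<Psi>] show ?thesis by simp
qed

lemma dual_unit_eqI:
  fixes x :: "'a::complex_banach"
  assumes "\<And>\<Psi>. dual_unit \<Psi> \<Longrightarrow> \<Psi> x = \<Psi> y"
  shows "x = y"
  using norm_le_dual[of "x - y" 0] assms by (simp add: dual_unit_diff)

section \<open>Two growth theorems for entire functions\<close>

text \<open>A Phragmen--Lindelof principle: dividing by \<open>1 + \<epsilon> z\<close> does not increase the modulus on the half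
  plane and makes the function small far out, so the maximum principle on large half discs
  applies.\<close>

lemma half_plane_bound:
  fixes g :: "complex \<Rightarrow> complex"
  assumes hol: "g holomorphic_on UNIV"
    and M: "\<And>z. Re z = 0 \<Longrightarrow> cmod (g z) \<le> M"
    and C: "\<And>z. 0 \<le> Re z \<Longrightarrow> cmod (g z) \<le> C"
    and w: "0 \<le> Re w"
  shows "cmod (g w) \<le> M"
proof (cases "Re w = 0")
  case False
  with w have w: "0 < Re w" by simp
  have M0: "0 \<le> M" by (rule order_trans[OF norm_ge_zero M[of 0]]) simp
  have C0: "0 \<le> C" by (rule order_trans[OF norm_ge_zero C[of 0]]) simp
  have est: "cmod (g w) \<le> (M + e) * cmod (1 + of_real \<epsilon> * w)" if e: "0 < e" and \<epsilon>: "0 < \<epsilon>" for e \<epsilon> :: real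
  proof -
    define R where "R = cmod w + C / (\<epsilon> * (M + e)) + 1"
    have R: "0 < R" "cmod w < R" "C \<le> \<epsilon> * R * (M + e)"
    proof -
      have q: "0 \<le> C / (\<epsilon> * (M + e))" using C0 M0 e \<epsilon> by simp
      then show "0 < R" "cmod w < R" by (auto simp: R_def add_nonneg_pos)
      have pos: "0 < \<epsilon> * (M + e)" using M0 e \<epsilon> by simp
      have "C = C / q * q" if "0 < q" for q using that by simp
      then have "C = C / (\<epsilon> * (M + e)) * (\<epsilon> * (M + e))" using pos by blast
      also have "\<dots> \<le> R * (\<epsilon> * (M + e))" using pos by (intro mult_right_mono) (auto simp: R_def)
      also have "\<dots> = \<epsilon> * R * (M + e)" by simp
      finally show "C \<le> \<epsilon> * R * (M + e)" .
    qed
    define S where "S = {z. 0 < Re z} \<inter> ball 0 R"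
    have "open S" unfolding S_def by (intro open_Int open_halfspace_Re_gt open_ball)
    have clS: "closure S \<subseteq> {z. 0 \<le> Re z} \<inter> cball 0 R"
    proof (rule closure_minimal)
      show "closed ({z. 0 \<le> Re z} \<inter> cball 0 R)"
        by (intro closed_Int closed_halfspace_Re_ge closed_cball)
    qed (auto simp: S_def)
    have den1: "1 \<le> cmod (1 + of_real \<epsilon> * z)" if "0 \<le> Re z" for z
    proof -
      have "0 \<le> \<epsilon> * Re z" using \<epsilon> that by simp
      with complex_Re_le_cmod[of "1 + of_real \<epsilon> * z"] show ?thesis by simp
    qed
    have den2: "\<epsilon> * cmod z \<le> cmod (1 + of_real \<epsilon> * z)" if "0 \<le> Re z" for z
    proof (rule power2_le_imp_le)
      have "(\<epsilon> * cmod z)\<^sup>2 = (\<epsilon> * Re z)\<^sup>2 + (\<epsilon> * Im z)\<^sup>2"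
        by (simp add: power_mult_distrib cmod_power2 algebra_simps)
      also have "\<dots> \<le> (1 + \<epsilon> * Re z)\<^sup>2 + (\<epsilon> * Im z)\<^sup>2"
        using that \<epsilon> by (intro add_right_mono power_mono) auto
      finally show "(\<epsilon> * cmod z)\<^sup>2 \<le> (cmod (1 + of_real \<epsilon> * z))\<^sup>2" by (simp add: cmod_power2)
    qed simp
    have nz: "1 + of_real \<epsilon> * z \<noteq> 0" if "z \<in> closure S" for z
      using den1[of z] clS that by force
    have "cmod (g w / (1 + of_real \<epsilon> * w)) \<le> M + e"
    proof (rule maximum_modulus_frontier[where f = "\<lambda>z. g z / (1 + of_real \<epsilon> * z)" and S = S])
      show "(\<lambda>z. g z / (1 + of_real \<epsilon> * z)) holomorphic_on interior S"
        using nz interior_subset[of S] closure_subset[of S]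
        by (intro holomorphic_intros holomorphic_on_subset[OF hol]) auto
      show "continuous_on (closure S) (\<lambda>z. g z / (1 + of_real \<epsilon> * z))"
        using nz by (intro continuous_intros continuous_on_subset[OF holomorphic_on_imp_continuous_on[OF hol]]) auto
      show "bounded S" by (simp add: S_def bounded_Int)
      show "w \<in> S" using w R by (simp add: S_def)
      fix z assume "z \<in> frontier S"
      then have z: "z \<in> closure S" "z \<notin> S" using \<open>open S\<close> by (auto simp: frontier_def interior_open)
      with clS have zc: "0 \<le> Re z" "cmod z \<le> R" by auto
      with z have "Re z = 0 \<or> cmod z = R" by (auto simp: S_def)
      then have "cmod (g z) \<le> (M + e) * cmod (1 + of_real \<epsilon> * z)"
      proof
        assume "Re z = 0"
        with M[of z] have "cmod (g z) \<le> M" by simp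
        also have "\<dots> \<le> M + e" using e by simp
        also have "\<dots> \<le> (M + e) * cmod (1 + of_real \<epsilon> * z)" using den1[OF zc(1)] M0 e by simp
        finally show ?thesis .
      next
        assume "cmod z = R"
        have "cmod (g z) \<le> C" by (rule C[OF zc(1)])
        also have "\<dots> \<le> (M + e) * (\<epsilon> * cmod z)" using R \<open>cmod z = R\<close> by (simp add: algebra_simps)
        also have "\<dots> \<le> (M + e) * cmod (1 + of_real \<epsilon> * z)"
          using den2[OF zc(1)] M0 e by (intro mult_left_mono) auto
        finally show ?thesis .
      qed
      moreover have "0 < cmod (1 + of_real \<epsilon> * z)" using nz[OF z(1)] by simp
      ultimately show "cmod (g z / (1 + of_real \<epsilon> * z)) \<le> M + e"
        by (simp add: norm_divide pos_divide_le_eq)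
    qed
    moreover have "0 < cmod (1 + of_real \<epsilon> * w)"
      by (rule order_less_le_trans[OF zero_less_one den1]) (use w in simp)
    ultimately show ?thesis by (simp add: norm_divide pos_divide_le_eq)
  qed
  show ?thesis
  proof (rule field_le_epsilon)
    fix e :: real assume e: "0 < e"
    have "((\<lambda>\<epsilon>::real. (M + e) * cmod (1 + of_real \<epsilon> * w)) \<longlongrightarrow> (M + e) * cmod (1 + of_real 0 * w)) (at_right 0)"
      by (intro tendsto_intros)
    moreover have "\<forall>\<^sub>F \<epsilon>::real in at_right 0. cmod (g w) \<le> (M + e) * cmod (1 + of_real \<epsilon> * w)"
      using eventually_at_right_less[of "0::real"] by (rule eventually_mono) (rule est[OF e])
    ultimately have "cmod (g w) \<le> (M + e) * cmod (1 + of_real 0 * w)"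
      by (rule tendsto_lowerbound) simp
    then show "cmod (g w) \<le> M + e" by simp
  qed
qed (use M in auto)

lemma odd_squares_le: "(\<Sum>k<N. 1 / (2 * real k + 1)\<^sup>2) \<le> pi\<^sup>2 / 8"
proof -
  define A where "A n = (\<Sum>k<n. 1 / (real k + 1)\<^sup>2)" for n
  define S where "S n = (\<Sum>k<n. 1 / (2 * real k + 1)\<^sup>2)" for n
  have "S n = A (2 * n) - A n / 4" for n
  proof (induction n)
    case (Suc n)
    define b where "b = 1 / (real n + 1)\<^sup>2"
    have "real (2 * n + 1) + 1 = 2 * (real n + 1)" by simp
    then have "1 / (real (2 * n + 1) + 1)\<^sup>2 = 1 / (real n + 1)\<^sup>2 / 4"
      by (simp only: power_mult_distrib) simp
    then have "A (2 * Suc n) = A (2 * n) + 1 / (2 * real n + 1)\<^sup>2 + b / 4"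
      by (simp add: A_def b_def)
    moreover have "A (Suc n) = A n + b" "S (Suc n) = S n + 1 / (2 * real n + 1)\<^sup>2"
      by (simp_all add: A_def S_def b_def)
    ultimately show ?case using Suc by linarith
  qed (simp add: S_def A_def)
  moreover have lim: "A \<longlonglongrightarrow> pi\<^sup>2 / 6"
    using inverse_squares_sums by (simp add: sums_def A_def[abs_def] add.commute)
  have "(\<lambda>n. A (2 * n) - A n / 4) \<longlonglongrightarrow> pi\<^sup>2 / 6 - pi\<^sup>2 / 6 / 4"
    by (intro tendsto_intros lim filterlim_compose[OF lim]) (auto intro!: filterlim_subseq strict_monoI)
  moreover have "pi\<^sup>2 / 6 - pi\<^sup>2 / 6 / 4 = pi\<^sup>2 / (8::real)" by simp
  ultimately have "S \<longlonglongrightarrow> pi\<^sup>2 / 8" using ext[of S "\<lambda>n. A (2 * n) - A n / 4"] by metis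
  moreover have "incseq S" by (rule incseq_SucI) (simp add: S_def)
  ultimately show ?thesis using incseq_le[of S "pi\<^sup>2 / 8" N] by (simp add: S_def)
qed

text \<open>The circles of radius \<open>N \<pi>\<close> stay away from the zeros of the cosine, which therefore has the size
  of \<open>exp \<bar>Im z\<bar>\<close> there.\<close>

lemma cos_lower_bound_circle:
  fixes z :: complex
  assumes z: "cmod z = real N * pi" and N: "1 \<le> N"
  shows "exp \<bar>Im z\<bar> / 6 \<le> cmod (cos z)"
proof -
  define y where "y = \<bar>Im z\<bar>"
  have sq: "(cmod (cos z))\<^sup>2 = (cos (Re z))\<^sup>2 + (exp y - inverse (exp y))\<^sup>2 / 4"
  proof -
    have "(exp y - inverse (exp y))\<^sup>2 = (exp (Im z) - inverse (exp (Im z)))\<^sup>2"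
      by (cases "0 \<le> Im z") (auto simp: y_def exp_minus power2_commute)
    then show ?thesis by (simp add: norm_cos_squared)
  qed
  have "0 \<le> y" by (simp add: y_def)
  show ?thesis
  proof (cases "1 \<le> y")
    case True
    have e: "2 \<le> exp y" using exp_ge_add_one_self[of y] True by linarith
    then have "inverse (exp y) \<le> inverse 2" by (intro le_imp_inverse_le) auto
    with e have ineq: "exp y / 6 \<le> (exp y - inverse (exp y)) / 2" by simp
    have "(exp y / 6)\<^sup>2 \<le> ((exp y - inverse (exp y)) / 2)\<^sup>2" using ineq by (intro power_mono) auto
    also have "\<dots> \<le> (cmod (cos z))\<^sup>2" by (simp add: sq power_divide)
    finally show ?thesis unfolding y_def[symmetric] by (rule power2_le_imp_le) simp
  next
    case False
    define d where "d = real N * pi - \<bar>Re z\<bar>"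
    have Npi: "3 \<le> real N * pi"
      using mult_mono[of 1 "real N" 3 pi] N pi_gt3 by simp
    have pyth: "(real N * pi)\<^sup>2 = \<bar>Re z\<bar>\<^sup>2 + y\<^sup>2"
      using z by (simp add: cmod_power2[symmetric] y_def)
    have d0: "0 \<le> d" using abs_Re_le_cmod[of z] z by (simp add: d_def)
    have "d * (real N * pi + \<bar>Re z\<bar>) = y\<^sup>2"
      using pyth by (simp add: d_def algebra_simps power2_eq_square)
    moreover have "y\<^sup>2 \<le> 1" using False \<open>0 \<le> y\<close> by (simp add: power_le_one)
    moreover have "d * 3 \<le> d * (real N * pi + \<bar>Re z\<bar>)" using Npi d0 by (intro mult_left_mono) auto
    ultimately have d1: "d \<le> pi / 3" using pi_gt3 by linarith
    have "cos (pi / 3) \<le> cos d" using d0 d1 pi_gt_zero by (intro cos_monotone_0_pi_le) auto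
    then have cd: "1 / 2 \<le> cos d" by (simp add: cos_60)
    have "cos (Re z) = cos \<bar>Re z\<bar>" by simp
    also have "\<bar>Re z\<bar> = real N * pi - d" by (simp add: d_def)
    also have "cos (real N * pi - d) = (- 1) ^ N * cos d" by (simp add: cos_diff mult.commute)
    finally have "(cos (Re z))\<^sup>2 = (cos d)\<^sup>2" by (simp add: power_mult_distrib power_mult[symmetric])
    then have "(cos d)\<^sup>2 \<le> (cmod (cos z))\<^sup>2" by (simp add: sq)
    then have "cos d \<le> cmod (cos z)" by (rule power2_le_imp_le) simp
    moreover have "exp y \<le> 3" using False exp_le exp_mono[of y 1] by linarith
    ultimately show ?thesis using cd by (simp add: y_def)
  qed
qed

text \<open>Bernstein's inequality, by M. Riesz' interpolation formula: the residues of \<open>f z / (z\<^sup>2 cos z)\<close>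
  express \<open>f' 0\<close> through the values of \<open>f\<close> at the points \<open>(k + 1/2) \<pi>\<close>, with coefficients whose
  absolute values add up to one.\<close>

lemma bernstein_inequality:
  fixes f :: "complex \<Rightarrow> complex"
  assumes hol: "f holomorphic_on UNIV" and bd: "\<And>z. cmod (f z) \<le> M * exp \<bar>Im z\<bar>"
  shows "cmod (deriv f 0) \<le> M"
proof -
  have M0: "0 \<le> M" using order_trans[OF norm_ge_zero bd[of 0]] by simp
  define p :: "int \<Rightarrow> complex" where "p k = of_real (of_int k * pi + pi / 2)" for k
  define F where "F z = f z / z\<^sup>2 / cos z" for z
  have p_inj: "inj p" by (rule injI) (simp only: p_def of_real_eq_iff, simp)
  have cos_p: "cos (p k) = 0" for k unfolding p_def cos_eq_0 by (auto intro!: exI[of _ k])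
  have sin_p: "cmod (sin (p k)) = 1" for k
  proof -
    have "(sin (p k))\<^sup>2 = 1" using sin_cos_squared_add[of "p k"] by (simp add: cos_p)
    then have "(cmod (sin (p k)))\<^sup>2 = 1" by (metis norm_power norm_one)
    then show ?thesis by (simp add: power2_eq_1_iff) (smt (verit) norm_ge_zero)
  qed
  have cos0: "cos z = 0 \<longleftrightarrow> z \<in> range p" for z
    unfolding cos_eq_0 p_def by (auto simp: image_iff)
  have norm_p: "cmod (p k) = \<bar>2 * real_of_int k + 1\<bar> * pi / 2" for k
  proof -
    have "of_int k * pi + pi / 2 = (2 * real_of_int k + 1) * pi / 2" by (simp add: field_simps)
    then show ?thesis by (simp only: p_def norm_of_real abs_mult abs_divide) simp
  qed
  have p_nz: "p k \<noteq> 0" for k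
  proof -
    have "2 * k + 1 \<noteq> 0" by presburger
    then have "real_of_int (2 * k + 1) \<noteq> 0" by (simp only: of_int_eq_0_iff not_False_eq_True)
    then have "cmod (p k) \<noteq> 0" by (simp add: norm_p)
    then show ?thesis by auto
  qed
  have main: "cmod (deriv f 0) \<le> M + 6 * M / (real N * pi)" if N: "1 \<le> N" for N :: nat
  proof -
    define K where "K = {- int N..int N - 1}"
    define R where "R = real N * pi"
    \<comment> \<open>a slightly larger disc, which contains no further zero of the cosine\<close>
    define S :: "complex set" where "S = ball 0 (R + pi / 4)"
    have R: "0 < R" using N by (simp add: R_def)
    have inS: "k \<in> K" if "p k \<in> S" for k
    proof -
      have "\<bar>2 * real_of_int k + 1\<bar> * pi / 2 < (real N + 1 / 4) * pi"
        using that by (simp add: S_def norm_p R_def algebra_simps)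
      then have "(2 * \<bar>2 * real_of_int k + 1\<bar>) * pi < (4 * real N + 1) * pi" by (simp add: algebra_simps)
      then have "2 * \<bar>2 * real_of_int k + 1\<bar> < 4 * real N + 1"
        by (rule mult_right_less_imp_less) simp
      then have "\<bar>real_of_int (2 * k + 1)\<bar> < real_of_int (2 * int N + 1)" by simp
      then have "\<bar>2 * k + 1\<bar> < 2 * int N + 1" by linarith
      then show ?thesis unfolding K_def atLeastAtMost_iff by linarith
    qed
    have pR: "cmod (p k) < R" if "k \<in> K" for k
    proof -
      have "\<bar>2 * k + 1\<bar> < 2 * int N" using that unfolding K_def atLeastAtMost_iff by linarith
      then have "\<bar>real_of_int (2 * k + 1)\<bar> < real_of_int (2 * int N)" by linarith
      then show ?thesis using pi_gt_zero by (simp add: norm_p R_def)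
    qed
    define pts where "pts = insert 0 (p ` K)"
    have fin: "finite pts" by (simp add: pts_def K_def)
    have pS: "pts \<subseteq> ball 0 R" using pR R by (auto simp: pts_def)
    have nz: "z \<noteq> 0 \<and> cos z \<noteq> 0" if "z \<in> S - pts" for z
      using that inS by (auto simp: cos0 pts_def)
    have holF: "F holomorphic_on S - pts"
      unfolding F_def using nz by (intro holomorphic_intros holomorphic_on_subset[OF hol]) auto
    have wn: "winding_number (circlepath 0 R) z = 1" if "z \<in> pts" for z
      using that pS by (intro winding_number_circlepath) auto
    have pimg: "path_image (circlepath 0 R) \<subseteq> S - pts"
      using pS R by (auto simp: S_def)
    have res: "contour_integral (circlepath 0 R) F =
        2 * pi * \<i> * (\<Sum>q\<in>pts. winding_number (circlepath 0 R) q * residue F q)"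
    proof (rule Residue_theorem[OF _ _ fin holF _ _ pimg])
      show "\<forall>z. z \<notin> S \<longrightarrow> winding_number (circlepath 0 R) z = 0"
      proof (intro allI impI)
        fix z assume "z \<notin> S"
        then have "R + pi / 4 \<le> cmod z" by (simp add: S_def)
        then have "R < cmod z" using pi_gt_zero by linarith
        with R show "winding_number (circlepath 0 R) z = 0"
          by (intro winding_number_zero_outside[of _ "cball 0 R"]) auto
      qed
    qed (auto simp: S_def)
    have res0: "residue F 0 = deriv f 0"
    proof -
      have b: "cos z \<noteq> 0" if "z \<in> ball 0 1" for z :: complex
      proof
        assume "cos z = 0"
        then obtain k where k: "z = p k" by (auto simp: cos0)
        have "1 \<le> \<bar>2 * k + 1\<bar>" by presburger
        then have "1 \<le> \<bar>2 * real_of_int k + 1\<bar>" by linarith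
        then have "1 * pi \<le> \<bar>2 * real_of_int k + 1\<bar> * pi" by (intro mult_right_mono) auto
        moreover have "\<bar>2 * real_of_int k + 1\<bar> * pi < 2" using that k by (simp add: norm_p)
        ultimately show False using pi_gt3 by linarith
      qed
      have "residue (\<lambda>z. (f z / cos z) / z ^ Suc 1) 0 = (deriv ^^ 1) (\<lambda>z. f z / cos z) 0 / fact 1"
        using b by (intro residue_holomorphic_over_power'[of "ball 0 1"] holomorphic_intros
            holomorphic_on_subset[OF hol]) auto
      moreover have "(\<lambda>z. (f z / cos z) / z ^ Suc 1) = F"
        by (simp add: F_def fun_eq_iff power2_eq_square divide_simps)
      moreover have "deriv (\<lambda>z. f z / cos z) 0 = deriv f 0"
      proof (rule DERIV_imp_deriv)
        have "(f has_field_derivative deriv f 0) (at 0)"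
          using hol by (auto intro: holomorphic_derivI)
        then have "((\<lambda>z. f z / cos z) has_field_derivative
            (deriv f 0 * cos 0 - f 0 * (- sin 0)) / (cos 0 * cos 0)) (at 0)"
          by (intro DERIV_divide) (auto intro!: derivative_eq_intros)
        then show "((\<lambda>z. f z / cos z) has_field_derivative deriv f 0) (at 0)" by simp
      qed
      ultimately show ?thesis by simp
    qed
    have resp: "cmod (residue F (p k)) \<le> M / (cmod (p k))\<^sup>2" for k
    proof -
      have "residue F (p k) = (f (p k) / (p k)\<^sup>2) / (- sin (p k))"
      proof (rule residue_simple'[of "ball (p k) 1"])
        have ne: "w \<noteq> 0 \<and> cos w \<noteq> 0" if w: "w \<in> ball (p k) 1 - {p k}" for w
        proof
          show "w \<noteq> 0"
          proof
            assume "w = 0"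
            with w have "\<bar>2 * real_of_int k + 1\<bar> * pi / 2 < 1" by (simp add: norm_p)
            moreover have "1 \<le> \<bar>2 * k + 1\<bar>" by presburger
            then have "1 \<le> \<bar>2 * real_of_int k + 1\<bar>" by linarith
            then have "1 * pi \<le> \<bar>2 * real_of_int k + 1\<bar> * pi" by (intro mult_right_mono) auto
            ultimately show False using pi_gt3 by simp
          qed
          show "cos w \<noteq> 0"
          proof
            assume "cos w = 0"
            then obtain j where j: "w = p j" by (auto simp: cos0)
            have "p k - p j = of_real (of_int (k - j) * pi)" by (simp add: p_def algebra_simps)
            then have "dist (p k) (p j) = \<bar>real_of_int (k - j)\<bar> * pi"
              by (simp only: dist_norm norm_of_real abs_mult) simp
            with w j have "\<bar>real_of_int (k - j)\<bar> * pi < 1" by simp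
            moreover have "k \<noteq> j" using w j by auto
            then have "1 \<le> \<bar>real_of_int (k - j)\<bar>" by linarith
            then have "1 * pi \<le> \<bar>real_of_int (k - j)\<bar> * pi" by (intro mult_right_mono) auto
            ultimately show False using pi_gt3 by linarith
          qed
        qed
        show "F holomorphic_on ball (p k) 1 - {p k}"
          unfolding F_def using ne by (intro holomorphic_intros holomorphic_on_subset[OF hol]) auto
        have "(cos has_field_derivative - sin (p k)) (at (p k))" by (auto intro!: derivative_eq_intros)
        then have "((\<lambda>w. (cos w - cos (p k)) / (w - p k)) \<longlongrightarrow> - sin (p k)) (at (p k))"
          by (simp add: has_field_derivative_iff)
        then have cl: "((\<lambda>w. cos w / (w - p k)) \<longlongrightarrow> - sin (p k)) (at (p k))" by (simp add: cos_p)
        have fl: "(f \<longlongrightarrow> f (p k)) (at (p k))"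
          using holomorphic_on_imp_continuous_on[OF hol] by (auto simp: continuous_on_def)
        have "((\<lambda>w. f w / w\<^sup>2 / (cos w / (w - p k))) \<longlongrightarrow> f (p k) / (p k)\<^sup>2 / (- sin (p k))) (at (p k))"
          using p_nz sin_p[of k] by (intro tendsto_intros fl cl) auto
        then show "((\<lambda>w. F w * (w - p k)) \<longlongrightarrow> f (p k) / (p k)\<^sup>2 / (- sin (p k))) (at (p k))"
          by (simp add: F_def)
      qed auto
      then have "cmod (residue F (p k)) = cmod (f (p k)) / (cmod (p k))\<^sup>2"
        by (simp add: norm_divide norm_power norm_mult sin_p)
      also have "cmod (f (p k)) \<le> M" using bd[of "p k"] by (simp add: p_def)
      finally show ?thesis by (simp add: divide_right_mono)
    qed
    have sum: "(\<Sum>k\<in>K. M / (cmod (p k))\<^sup>2) \<le> M"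
    proof -
      define h where "h k = 4 * M / pi\<^sup>2 * (1 / (2 * real_of_int k + 1)\<^sup>2)" for k
      have KK: "K = (\<lambda>n. int n) ` {..<N} \<union> (\<lambda>n. - int n - 1) ` {..<N}"
      proof (rule set_eqI)
        fix k show "k \<in> K \<longleftrightarrow> k \<in> (\<lambda>n. int n) ` {..<N} \<union> (\<lambda>n. - int n - 1) ` {..<N}"
        proof (cases "0 \<le> k")
          case True
          then show ?thesis by (auto simp: K_def image_iff intro!: bexI[of _ "nat k"])
        next
          case False
          then show ?thesis by (auto simp: K_def image_iff intro!: bexI[of _ "nat (- k - 1)"])
        qed
      qed
      have "M / (cmod (p k))\<^sup>2 = h k" for k
        by (simp add: norm_p h_def power_mult_distrib power_divide mult.commute)
      then have "(\<Sum>k\<in>K. M / (cmod (p k))\<^sup>2) = (\<Sum>k\<in>K. h k)" by simp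
      also have "(\<Sum>k\<in>K. h k) = (\<Sum>k\<in>(\<lambda>n. int n) ` {..<N}. h k) + (\<Sum>k\<in>(\<lambda>n. - int n - 1) ` {..<N}. h k)"
        unfolding KK by (intro sum.union_disjoint) auto
      also have "\<dots> = (\<Sum>n<N. h (int n)) + (\<Sum>n<N. h (- int n - 1))"
        by (subst (1 2) sum.reindex) (auto simp: inj_on_def)
      also have "h (- int n - 1) = h (int n)" for n
      proof -
        have "2 * real_of_int (- int n - 1) + 1 = - (2 * real_of_int (int n) + 1)" by simp
        then show ?thesis unfolding h_def by (simp only: power2_minus)
      qed
      then have "(\<Sum>n<N. h (int n)) + (\<Sum>n<N. h (- int n - 1)) = 2 * (\<Sum>n<N. h (int n))" by simp
      also have "\<dots> = 8 * M / pi\<^sup>2 * (\<Sum>k<N. 1 / (2 * real k + 1)\<^sup>2)"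
        by (simp add: h_def sum_distrib_left)
      also have "\<dots> \<le> 8 * M / pi\<^sup>2 * (pi\<^sup>2 / 8)" using M0 by (intro mult_left_mono odd_squares_le) auto
      finally show ?thesis by simp
    qed
    have "(F has_contour_integral contour_integral (circlepath 0 R) F) (circlepath 0 R)"
      using holF pimg
      by (intro has_contour_integral_integral contour_integrable_continuous_circlepath)
        (auto intro: continuous_on_subset holomorphic_on_imp_continuous_on)
    then have ci: "cmod (contour_integral (circlepath 0 R) F) \<le> 6 * M / R\<^sup>2 * (2 * pi * R)"
    proof (rule has_contour_integral_bound_circlepath)
      fix z assume "cmod (z - 0) = R"
      then have z: "cmod z = R" by simp
      have c: "exp \<bar>Im z\<bar> / 6 \<le> cmod (cos z)" using z N by (intro cos_lower_bound_circle) (auto simp: R_def)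
      have "cmod (f z) \<le> M * exp \<bar>Im z\<bar>" by (rule bd)
      also have "\<dots> \<le> 6 * M * cmod (cos z)" using c M0 mult_left_mono[of "exp \<bar>Im z\<bar>" "6 * cmod (cos z)" M] by simp
      finally have "cmod (f z) / cmod (cos z) \<le> 6 * M"
        using M0 by (cases "cos z = 0") (simp_all add: pos_divide_le_eq)
      then have "cmod (f z) / cmod (cos z) / R\<^sup>2 \<le> 6 * M / R\<^sup>2" by (intro divide_right_mono) auto
      then show "cmod (F z) \<le> 6 * M / R\<^sup>2" by (simp add: F_def norm_divide norm_mult norm_power z mult.commute)
    qed (use M0 R in auto)
    have "contour_integral (circlepath 0 R) F = 2 * pi * \<i> * (deriv f 0 + (\<Sum>k\<in>K. residue F (p k)))"
    proof -
      have "0 \<notin> p ` K" using p_nz by (metis imageE)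
      then have "(\<Sum>q\<in>pts. residue F q) = deriv f 0 + (\<Sum>k\<in>K. residue F (p k))"
        using inj_on_subset[OF p_inj subset_UNIV, of K]
        by (simp add: pts_def res0 sum.reindex K_def)
      then show ?thesis using wn res by simp
    qed
    then have "deriv f 0 = contour_integral (circlepath 0 R) F / (2 * pi * \<i>) - (\<Sum>k\<in>K. residue F (p k))"
      by (simp add: field_simps)
    then have "cmod (deriv f 0) \<le> cmod (contour_integral (circlepath 0 R) F / (2 * pi * \<i>)) + cmod (\<Sum>k\<in>K. residue F (p k))"
      by (simp only: norm_triangle_ineq4)
    also have "cmod (contour_integral (circlepath 0 R) F / (2 * pi * \<i>)) = cmod (contour_integral (circlepath 0 R) F) / (2 * pi)"
      by (simp add: norm_divide norm_mult)
    also have "\<dots> \<le> 6 * M / R\<^sup>2 * (2 * pi * R) / (2 * pi)" by (intro divide_right_mono ci) auto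
    also have "\<dots> = 6 * M / R" using R by (simp add: power2_eq_square)
    also have "cmod (\<Sum>k\<in>K. residue F (p k)) \<le> (\<Sum>k\<in>K. M / (cmod (p k))\<^sup>2)"
      by (intro sum_norm_le resp)
    also note sum
    finally show ?thesis by (simp add: R_def)
  qed
  have "(\<lambda>N. M + (6 * M / pi) * inverse (real N)) \<longlonglongrightarrow> M + (6 * M / pi) * 0"
    by (intro tendsto_intros lim_inverse_n)
  then have "(\<lambda>N. M + 6 * M / (real N * pi)) \<longlonglongrightarrow> M" by (simp add: field_simps)
  then show ?thesis
    by (rule tendsto_lowerbound) (auto intro!: eventually_sequentiallyI[of 1] main)
qed

section \<open>Exponentials of bounded operators\<close>

lemma
  assumes "bounded_clinear_map T"
  shows bounded_clinear_map_linear: "linear T"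
    and bounded_clinear_map_bounded_linear: "bounded_linear T"
    and bounded_clinear_map_scaleC: "T (c *\<^sub>C x) = c *\<^sub>C T x"
    and bounded_clinear_map_norm: "norm (T x) \<le> onorm T * norm x"
  using assms by (auto simp: bounded_clinear_map_def clinear_map_def bounded_linear.linear onorm)

lemma bounded_clinear_mapI:
  assumes "clinear_map T" "\<And>x. norm (T x) \<le> K * norm x"
  shows "bounded_clinear_map T"
  using assms clinear_map_linear[OF assms(1)] unfolding bounded_clinear_map_def
  by (auto intro!: bounded_linear_intro[of _ K] simp: linear_add linear_scale mult.commute)

lemma bounded_clinear_map_scaled:
  assumes "bounded_clinear_map T"
  shows "bounded_clinear_map (\<lambda>x. c *\<^sub>C T x)"
proof (rule bounded_clinear_mapI[where K = "cmod c * onorm T"])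
  show "clinear_map (\<lambda>x. c *\<^sub>C T x)"
    using assms by (simp add: bounded_clinear_map_def clinear_map_def scaleC_add_right scaleC_scaleC mult.commute)
  show "norm (c *\<^sub>C T x) \<le> cmod c * onorm T * norm x" for x
    using mult_left_mono[OF bounded_clinear_map_norm[OF assms, of x] norm_ge_zero[of c]]
    by (simp add: norm_scaleC mult.assoc)
qed

lemma funpow_linear: "linear (T :: 'a::real_vector \<Rightarrow> 'a) \<Longrightarrow> linear (T ^^ n)"
proof (induction n)
  case (Suc n)
  then show ?case using linear_compose[of "T ^^ n" T] by (simp add: o_def)
qed (auto intro: linearI)

lemma funpow_scaled:
  fixes T :: "'a::complex_banach \<Rightarrow> 'a"
  assumes "bounded_clinear_map T"
  shows "((\<lambda>x. c *\<^sub>C T x) ^^ n) x = c ^ n *\<^sub>C (T ^^ n) x"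
  by (induction n) (simp_all add: bounded_clinear_map_scaleC[OF assms] scaleC_scaleC mult.commute)

lemma funpow_norm_le:
  fixes T :: "'a::real_normed_vector \<Rightarrow> 'a"
  assumes "\<And>x. norm (T x) \<le> N * norm x" "0 \<le> N"
  shows "norm ((T ^^ n) x) \<le> N ^ n * norm x"
proof (induction n)
  case (Suc n)
  have "norm (T ((T ^^ n) x)) \<le> N * norm ((T ^^ n) x)" by (rule assms)
  also have "\<dots> \<le> N * (N ^ n * norm x)" using Suc assms(2) by (intro mult_left_mono)
  finally show ?case by (simp add: mult.assoc)
qed simp

lemma real_exp_sums: "(\<lambda>n. u ^ n / fact n) sums exp (u::real)"
  using exp_converges[of u] by (simp add: divide_inverse mult.commute)

lemma exp_operator_term_le:
  fixes T :: "'a::complex_banach \<Rightarrow> 'a"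
  assumes "bounded_clinear_map T"
  shows "norm ((c ^ n / fact n) *\<^sub>C (T ^^ n) x) \<le> (cmod c * onorm T) ^ n / fact n * norm x"
proof -
  have "norm ((T ^^ n) x) \<le> onorm T ^ n * norm x"
    by (rule funpow_norm_le)
      (use assms in \<open>auto intro: bounded_clinear_map_norm onorm_pos_le bounded_clinear_map_bounded_linear\<close>)
  then have "cmod c ^ n / fact n * norm ((T ^^ n) x) \<le> cmod c ^ n / fact n * (onorm T ^ n * norm x)"
    by (intro mult_left_mono) auto
  then show ?thesis by (simp add: norm_scaleC norm_divide norm_power power_mult_distrib)
qed

lemma exp_operator_summable_norm:
  fixes T :: "'a::complex_banach \<Rightarrow> 'a"
  assumes "bounded_clinear_map T"
  shows "summable (\<lambda>n. norm ((c ^ n / fact n) *\<^sub>C (T ^^ n) x))"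
proof (rule summable_comparison_test')
  show "summable (\<lambda>n. (cmod c * onorm T) ^ n / fact n * norm x)"
    by (intro summable_mult2 sums_summable[OF real_exp_sums])
  show "norm (norm ((c ^ n / fact n) *\<^sub>C (T ^^ n) x)) \<le> (cmod c * onorm T) ^ n / fact n * norm x" for n
    using exp_operator_term_le[OF assms] by simp
qed

lemma exp_operator_sums:
  assumes "bounded_clinear_map T"
  shows "(\<lambda>n. (c ^ n / fact n) *\<^sub>C (T ^^ n) x) sums exp_operator c T x"
  unfolding exp_operator_def by (rule summable_sums[OF summable_norm_cancel[OF exp_operator_summable_norm[OF assms]]])

lemma exp_operator_dual_sums:
  assumes "bounded_clinear_map T" "dual_unit \<Psi>"
  shows "(\<lambda>n. \<Psi> ((T ^^ n) x) / fact n * c ^ n) sums \<Psi> (exp_operator c T x)"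
  using bounded_linear.sums[OF dual_unit_bounded_linear[OF assms(2)] exp_operator_sums[OF assms(1), of c x]]
  by (simp add: dual_unit_scaleC[OF assms(2)] mult.commute)

lemma exp_operator_linear:
  assumes T: "bounded_clinear_map T"
  shows "linear (exp_operator z T)"
proof (rule linearI)
  have lin: "linear (T ^^ n)" for n by (rule funpow_linear[OF bounded_clinear_map_linear[OF T]])
  show "exp_operator z T (x + y) = exp_operator z T x + exp_operator z T y" for x y
  proof (rule sums_unique2[OF exp_operator_sums[OF T]])
    show "(\<lambda>n. (z ^ n / fact n) *\<^sub>C (T ^^ n) (x + y)) sums (exp_operator z T x + exp_operator z T y)"
      using sums_add[OF exp_operator_sums[OF T, of z x] exp_operator_sums[OF T, of z y]]
      by (simp only: linear_add[OF lin] scaleC_add_right)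
  qed
  show "exp_operator z T (r *\<^sub>R x) = r *\<^sub>R exp_operator z T x" for r x
  proof (rule sums_unique2[OF exp_operator_sums[OF T]])
    show "(\<lambda>n. (z ^ n / fact n) *\<^sub>C (T ^^ n) (r *\<^sub>R x)) sums (r *\<^sub>R exp_operator z T x)"
      using sums_scaleR_right[OF exp_operator_sums[OF T, of z x], of r]
      by (simp only: linear_scale[OF lin] scaleC.scaleR_right)
  qed
qed

lemma exp_operator_0: 
  assumes "bounded_clinear_map T"
  shows "exp_operator 0 T x = x"
proof -
  have "(\<lambda>n. (0 ^ n / fact n) *\<^sub>C (T ^^ n) x) sums (\<Sum>n\<in>{0}. (0 ^ n / fact n) *\<^sub>C (T ^^ n) x)"
    by (intro sums_finite) (auto simp: scaleC.zero_left zero_power)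
  then show ?thesis using sums_unique2[OF exp_operator_sums[OF assms, of 0 x]] by simp
qed

text \<open>Paired with a functional, the exponential is an entire function of the complex parameter, and
  differentiating it inserts one more \<open>T\<close>.\<close>

lemma exp_operator_dual_deriv:
  assumes T: "bounded_clinear_map T" and \<Psi>: "dual_unit \<Psi>"
  shows "((\<lambda>c. \<Psi> (exp_operator c T x)) has_field_derivative \<Psi> (exp_operator c T (T x))) (at c)"
proof -
  define a where "a n = \<Psi> ((T ^^ n) x) / fact n" for n
  have s: "\<Psi> (exp_operator c T x) = (\<Sum>n. a n * c ^ n)" for c
    using exp_operator_dual_sums[OF T \<Psi>, of x c] by (simp add: sums_iff a_def)
  have "diffs a n = \<Psi> ((T ^^ n) (T x)) / fact n" for n
    by (simp add: diffs_def a_def funpow_swap1 divide_simps del: of_nat_Suc)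
  then have "\<Psi> (exp_operator c T (T x)) = (\<Sum>n. diffs a n * c ^ n)"
    using exp_operator_dual_sums[OF T \<Psi>, of "T x" c] by (simp add: sums_iff)
  moreover have "((\<lambda>c. \<Sum>n. a n * c ^ n) has_field_derivative (\<Sum>n. diffs a n * c ^ n)) (at c)"
    by (rule termdiffs_strong_converges_everywhere)
      (use exp_operator_dual_sums[OF T \<Psi>, of x] in \<open>auto simp: a_def sums_iff\<close>)
  ultimately show ?thesis by (simp add: s)
qed

lemma exp_operator_dual_holomorphic:
  assumes "bounded_clinear_map T" "dual_unit \<Psi>"
  shows "(\<lambda>c. \<Psi> (exp_operator c T x)) holomorphic_on S"
  using exp_operator_dual_deriv[OF assms]
  by (meson field_differentiable_at_within field_differentiable_def holomorphic_on_def)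

text \<open>The addition formula is the Taylor expansion at \<open>d\<close> of these entire functions.\<close>

lemma exp_operator_add:
  assumes T: "bounded_clinear_map T"
  shows "exp_operator (c + d) T x = exp_operator c T (exp_operator d T x)"
proof (rule dual_unit_eqI)
  fix \<Psi> :: "'a \<Rightarrow> complex" assume \<Psi>: "dual_unit \<Psi>"
  define g where "g y c = \<Psi> (exp_operator c T y)" for y c
  have dg: "deriv (g y) = g (T y)" for y
    using exp_operator_dual_deriv[OF T \<Psi>, of y] by (intro ext DERIV_imp_deriv) (simp add: g_def[abs_def])
  have dgn: "(deriv ^^ n) (g y) = g ((T ^^ n) y)" for n y
    by (induction n arbitrary: y) (simp_all add: funpow_swap1 dg del: funpow.simps, simp add: dg)
  have comm: "(T ^^ n) (exp_operator d T y) = exp_operator d T ((T ^^ n) y)" for n y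
  proof (induction n arbitrary: y)
    case (Suc n)
    have "(\<lambda>n. T ((d ^ n / fact n) *\<^sub>C (T ^^ n) y)) sums T (exp_operator d T y)" for y
      by (rule bounded_linear.sums[OF bounded_clinear_map_bounded_linear[OF T] exp_operator_sums[OF T]])
    then have "(\<lambda>n. (d ^ n / fact n) *\<^sub>C (T ^^ n) (T y)) sums T (exp_operator d T y)" for y
      by (simp add: bounded_clinear_map_scaleC[OF T] funpow_swap1)
    then have "T (exp_operator d T y) = exp_operator d T (T y)" for y
      using sums_unique2 exp_operator_sums[OF T] by blast
    with Suc show ?case by (simp add: funpow_swap1)
  qed simp
  have hol: "g x holomorphic_on ball d (cmod c + 1)"
    unfolding g_def by (rule exp_operator_dual_holomorphic[OF T \<Psi>])
  have "(\<lambda>n. (deriv ^^ n) (g x) d / fact n * ((c + d) - d) ^ n) sums g x (c + d)"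
    by (rule holomorphic_power_series[OF hol]) (simp add: dist_norm)
  then have "(\<lambda>n. g ((T ^^ n) x) d / fact n * c ^ n) sums g x (c + d)" by (simp add: dgn)
  moreover have "(\<lambda>n. g ((T ^^ n) x) d / fact n * c ^ n) sums \<Psi> (exp_operator c T (exp_operator d T x))"
    using exp_operator_dual_sums[OF T \<Psi>, of "exp_operator d T x" c] by (simp add: comm g_def)
  ultimately show "\<Psi> (exp_operator (c + d) T x) = \<Psi> (exp_operator c T (exp_operator d T x))"
    using sums_unique2 by (auto simp: g_def)
qed

lemma exp_operator_scaled:
  assumes "bounded_clinear_map T"
  shows "exp_operator c (\<lambda>x. d *\<^sub>C T x) x = exp_operator (c * d) T x"
  unfolding exp_operator_def by (simp add: funpow_scaled[OF assms] scaleC_scaleC power_mult_distrib)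

lemma exp_operator_remainder:
  assumes T: "bounded_clinear_map T" and small: "cmod c * N \<le> 1" and N: "onorm T \<le> N"
  shows "norm (exp_operator c T x - x - c *\<^sub>C T x) \<le> (cmod c * N)\<^sup>2 * norm x"
proof -
  define a where "a n = (c ^ n / fact n) *\<^sub>C (T ^^ n) x" for n
  define u where "u = cmod c * N"
  have u: "0 \<le> u" "u \<le> 1"
    using small order_trans[OF onorm_pos_le[OF bounded_clinear_map_bounded_linear[OF T]] N] by (auto simp: u_def)
  have "a sums exp_operator c T x" unfolding a_def by (rule exp_operator_sums[OF T])
  then have s: "(\<lambda>n. a (n + 2)) sums (exp_operator c T x - (\<Sum>i<2. a i))" by (rule sums_split_initial_segment)
  from real_exp_sums[of u] have "(\<lambda>n. u ^ (n + 2) / fact (n + 2)) sums (exp u - (\<Sum>i<2. u ^ i / fact i))"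
    by (rule sums_split_initial_segment)
  then have s2: "(\<lambda>n. u ^ (n + 2) / fact (n + 2) * norm x) sums ((exp u - (\<Sum>i<2. u ^ i / fact i)) * norm x)"
    by (rule sums_mult2)
  have le: "norm (a n) \<le> u ^ n / fact n * norm x" for n
  proof -
    have "(cmod c * onorm T) ^ n \<le> u ^ n"
      unfolding u_def using N onorm_pos_le[OF bounded_clinear_map_bounded_linear[OF T]]
      by (intro power_mono mult_left_mono) auto
    then have "(cmod c * onorm T) ^ n / fact n * norm x \<le> u ^ n / fact n * norm x"
      by (intro mult_right_mono divide_right_mono) auto
    with exp_operator_term_le[OF T, of c n x] show ?thesis unfolding a_def by linarith
  qed
  have "norm (exp_operator c T x - (\<Sum>i<2. a i)) \<le> (exp u - (\<Sum>i<2. u ^ i / fact i)) * norm x"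
    by (rule norm_sums_le[OF s s2 le])
  also have "\<dots> \<le> u\<^sup>2 * norm x"
    using exp_bound[OF u] by (intro mult_right_mono) (auto simp: numeral_2_eq_2)
  finally show ?thesis by (simp add: a_def u_def numeral_2_eq_2 algebra_simps)
qed

section \<open>Numerical range and Hermitian operators\<close>

definition supports :: "('a::complex_banach \<Rightarrow> complex) \<Rightarrow> 'a \<Rightarrow> bool" where
  "supports \<Psi> x \<longleftrightarrow> dual_unit \<Psi> \<and> \<Psi> x = complex_of_real (norm x)"

text \<open>An upper bound for the real part of the numerical range. All positivity statements about
  operators below are of this form, which is visibly stable under sums.\<close>

definition numbound :: "('a::complex_banach \<Rightarrow> 'a) \<Rightarrow> real \<Rightarrow> bool" where
  "numbound A c \<longleftrightarrow> (\<forall>x \<Psi>. supports \<Psi> x \<longrightarrow> Re (\<Psi> (A x)) \<le> c * norm x)"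

definition herm :: "('a::complex_banach \<Rightarrow> 'a) \<Rightarrow> bool" where
  "herm H \<longleftrightarrow> bounded_clinear_map H \<and> (\<forall>x \<Psi>. supports \<Psi> x \<longrightarrow> Im (\<Psi> (H x)) = 0)"

lemma herm_bounded: "herm H \<Longrightarrow> bounded_clinear_map H"
  by (simp add: herm_def)

lemma numbound_mono: "numbound A c \<Longrightarrow> c \<le> d \<Longrightarrow> numbound A d"
  unfolding numbound_def by (meson mult_right_mono norm_ge_zero order_trans)

lemma numbound_lower:
  assumes "numbound A c" "0 \<le> s"
  shows "(1 - s * c) * norm x \<le> norm (x - s *\<^sub>R A x)"
proof -
  obtain \<Psi> where \<Psi>: "dual_unit \<Psi>" "\<Psi> x = complex_of_real (norm x)" by (rule supporting_functional)
  with assms have "Re (\<Psi> (A x)) \<le> c * norm x" by (auto simp: numbound_def supports_def)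
  with \<open>0 \<le> s\<close> have "s * Re (\<Psi> (A x)) \<le> s * (c * norm x)" by (rule mult_left_mono[rotated])
  moreover have "Re (\<Psi> (x - s *\<^sub>R A x)) = norm x - s * Re (\<Psi> (A x))"
    using \<Psi> by (simp add: dual_unit_simps)
  ultimately show ?thesis using dual_unit_Re[OF \<Psi>(1), of "x - s *\<^sub>R A x"] by (simp add: algebra_simps)
qed

text \<open>The Lumer--Phillips argument: \<open>numbound_lower\<close>, read backwards in time, bounds the exponential over a short
  time \<open>h\<close> by \<open>exp (c h + O(h\<^sup>2))\<close>, and many short steps make up the time \<open>s\<close>.\<close>

lemma numbound_exp:
  assumes A: "bounded_clinear_map A" and nb: "numbound A c" and s: "0 \<le> s"
  shows "norm (exp_operator (of_real s) A x) \<le> exp (c * s) * norm x"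
proof -
  define N where "N = onorm A + \<bar>c\<bar> + 1"
  have N: "0 < N" "onorm A \<le> N" "\<bar>c\<bar> \<le> N"
    using onorm_pos_le[OF bounded_clinear_map_bounded_linear[OF A]] by (auto simp: N_def)
  have step: "norm (exp_operator (of_real h) A y) \<le> exp (h * c + 9 * (h * N)\<^sup>2) * norm y"
    if h: "0 \<le> h" "h * N \<le> 1 / 4" for h y
  proof -
    define x where "x = exp_operator (of_real h) A y"
    define u where "u = h * c + (h * N)\<^sup>2"
    have hN: "0 \<le> h * N" using h N by simp
    have "exp_operator (of_real (- h)) A x = exp_operator (of_real (- h) + of_real h) A y"
      unfolding x_def by (rule exp_operator_add[OF A, symmetric])
    then have y: "exp_operator (of_real (- h)) A x = y" by (simp add: exp_operator_0[OF A])
    have "norm (exp_operator (of_real (- h)) A x - x - of_real (- h) *\<^sub>C A x) \<le> (cmod (of_real (- h)) * N)\<^sup>2 * norm x"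
      using h N by (intro exp_operator_remainder[OF A]) auto
    then have "norm (y - (x - h *\<^sub>R A x)) \<le> (h * N)\<^sup>2 * norm x"
      unfolding y using h by (simp add: scaleC.minus_left scaleC_of_real algebra_simps del: of_real_minus) 
    moreover have "norm (x - h *\<^sub>R A x) \<le> norm y + norm (y - (x - h *\<^sub>R A x))"
      using norm_triangle_ineq4[of y "y - (x - h *\<^sub>R A x)"] by simp
    ultimately have low: "(1 - u) * norm x \<le> norm y"
      using numbound_lower[OF nb h(1), of x] by (simp add: u_def algebra_simps)
    have hc: "\<bar>h * c\<bar> \<le> h * N" using h N by (simp add: abs_mult mult_left_mono)
    have "(h * N)\<^sup>2 \<le> h * N * (1 / 4)" unfolding power2_eq_square using hN h by (intro mult_left_mono) auto
    with hc hN h zero_le_power2[of "h * N"] have u1: "\<bar>u\<bar> \<le> 2 * (h * N)" unfolding u_def by linarith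
    with h have u2: "\<bar>u\<bar> \<le> 1 / 2" by linarith
    note u = u1 u2
    have "\<bar>ln (1 + - u) - - u\<bar> \<le> 2 * (- u)\<^sup>2" using u by (intro abs_ln_one_plus_x_minus_x_bound) auto
    then have "- u - 2 * u\<^sup>2 \<le> ln (1 - u)" by simp
    then have "exp (- u - 2 * u\<^sup>2) \<le> 1 - u" using u by (simp add: ln_ge_iff)
    then have "exp (- u - 2 * u\<^sup>2) * norm x \<le> (1 - u) * norm x" by (rule mult_right_mono) simp
    with low have "exp (- u - 2 * u\<^sup>2) * norm x \<le> norm y" by simp
    then have le: "norm x \<le> exp (u + 2 * u\<^sup>2) * norm y"
      by (simp add: exp_diff exp_minus exp_add field_simps)
    have "u\<^sup>2 \<le> (2 * (h * N))\<^sup>2" using u hN by (intro power2_le_iff_abs_le[THEN iffD2]) auto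
    moreover have "(2 * (h * N))\<^sup>2 = 4 * (h * N)\<^sup>2" by (simp only: power_mult_distrib) simp
    moreover have "u = h * c + (h * N)\<^sup>2" by (simp only: u_def)
    ultimately have "u + 2 * u\<^sup>2 \<le> h * c + 9 * (h * N)\<^sup>2" by linarith
    then have "exp (u + 2 * u\<^sup>2) * norm y \<le> exp (h * c + 9 * (h * N)\<^sup>2) * norm y"
      by (intro mult_right_mono) auto
    with le show ?thesis by (simp add: x_def)
  qed
  have iter: "norm (exp_operator (of_real (real n * h)) A y) \<le> exp (real n * (h * c + 9 * (h * N)\<^sup>2)) * norm y"
    if h: "0 \<le> h" "h * N \<le> 1 / 4" for n h y
  proof (induction n arbitrary: y)
    case (Suc n)
    have "complex_of_real (real (Suc n) * h) = of_real (real n * h) + of_real h" by (simp add: algebra_simps)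
    then have "norm (exp_operator (of_real (real (Suc n) * h)) A y) =
        norm (exp_operator (of_real (real n * h)) A (exp_operator (of_real h) A y))"
      by (simp only: exp_operator_add[OF A])
    also have "\<dots> \<le> exp (real n * (h * c + 9 * (h * N)\<^sup>2)) * norm (exp_operator (of_real h) A y)" by (rule Suc)
    also have "\<dots> \<le> exp (real n * (h * c + 9 * (h * N)\<^sup>2)) * (exp (h * c + 9 * (h * N)\<^sup>2) * norm y)"
      by (intro mult_left_mono step h) simp
    also have "\<dots> = exp (real (Suc n) * (h * c + 9 * (h * N)\<^sup>2)) * norm y"
      by (simp add: exp_add[symmetric] algebra_simps)
    finally show ?case .
  qed (simp add: exp_operator_0[OF A])
  have ev: "\<forall>\<^sub>F n in sequentially. norm (exp_operator (of_real s) A x) \<le> exp (s * c + 9 * (s * N)\<^sup>2 * inverse (real n)) * norm x"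
  proof -
    obtain n0 :: nat where n0: "4 * (s * N) + 1 \<le> real n0" using real_arch_simple by blast
    have sN: "0 \<le> s * N" using s N by simp
    show ?thesis
    proof (rule eventually_sequentiallyI[of n0])
      fix n assume "n0 \<le> n"
      with n0 have n: "4 * (s * N) \<le> real n" "0 < real n" using sN by linarith+
      have "s / real n * N \<le> 1 / 4" using n by (simp add: field_simps)
      moreover have "0 \<le> s / real n" using s by simp
      ultimately have "norm (exp_operator (of_real (real n * (s / real n))) A x)
          \<le> exp (real n * (s / real n * c + 9 * (s / real n * N)\<^sup>2)) * norm x" by (rule iter[rotated])
      moreover have "real n * (s / real n) = s" using n by simp
      moreover have "real n * (s / real n * c + 9 * (s / real n * N)\<^sup>2) = s * c + 9 * (s * N)\<^sup>2 * inverse (real n)"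
        using n by (simp add: field_simps power2_eq_square)
      ultimately show "norm (exp_operator (of_real s) A x) \<le> exp (s * c + 9 * (s * N)\<^sup>2 * inverse (real n)) * norm x"
        by (simp only:)
    qed
  qed
  have lim: "(\<lambda>n. exp (s * c + 9 * (s * N)\<^sup>2 * inverse (real n)) * norm x) \<longlonglongrightarrow> exp (s * c + 9 * (s * N)\<^sup>2 * 0) * norm x"
    by (intro tendsto_intros lim_inverse_n)
  have "norm (exp_operator (of_real s) A x) \<le> exp (s * c + 9 * (s * N)\<^sup>2 * 0) * norm x"
    by (rule tendsto_lowerbound[OF lim ev]) simp
  then show ?thesis by (simp add: mult.commute)
qed

lemma exp_operator_dual_real_deriv:
  assumes "bounded_clinear_map T" "dual_unit \<Psi>"
  shows "((\<lambda>s. Re (\<Psi> (exp_operator (of_real s) T x))) has_real_derivative Re (\<Psi> (exp_operator (of_real s) T (T x)))) (at s)"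
proof -
  have "((\<lambda>s. \<Psi> (exp_operator (of_real s) T x)) has_vector_derivative \<Psi> (exp_operator (of_real s) T (T x))) (at s)"
    by (rule has_vector_derivative_real_field) (rule exp_operator_dual_deriv[OF assms])
  from bounded_linear.has_vector_derivative[OF bounded_linear_Re this]
  show ?thesis by (simp add: has_real_derivative_iff_has_vector_derivative)
qed

lemma exp_numbound:
  assumes A: "bounded_clinear_map A"
    and le: "\<And>s x. 0 \<le> s \<Longrightarrow> norm (exp_operator (of_real s) A x) \<le> exp (c * s) * norm x"
  shows "numbound A c"
  unfolding numbound_def
proof (intro allI impI, rule ccontr)
  fix x \<Psi> assume \<Psi>: "supports \<Psi> x" and "\<not> Re (\<Psi> (A x)) \<le> c * norm x"
  define k where "k s = exp (c * s) * norm x - Re (\<Psi> (exp_operator (of_real s) A x))" for s :: real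
  have du: "dual_unit \<Psi>" using \<Psi> by (simp add: supports_def)
  have "(k has_real_derivative (c * norm x - Re (\<Psi> (A x)))) (at 0)"
  proof -
    have "((\<lambda>s. exp (c * s) * norm x) has_real_derivative c * norm x) (at 0)"
      by (auto intro!: derivative_eq_intros)
    from DERIV_diff[OF this exp_operator_dual_real_deriv[OF A du, of x 0]]
    show ?thesis by (simp add: k_def[abs_def] exp_operator_0[OF A])
  qed
  moreover have "c * norm x - Re (\<Psi> (A x)) < 0" using \<open>\<not> Re (\<Psi> (A x)) \<le> c * norm x\<close> by simp
  ultimately obtain d where "0 < d" and d: "\<And>h. 0 < h \<Longrightarrow> h < d \<Longrightarrow> k (0 + h) < k 0"
    using DERIV_neg_dec_right by metis
  then have "k (d / 2) < k 0" using d[of "d / 2"] by simp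
  moreover have "k 0 = 0" using \<Psi> by (simp add: k_def exp_operator_0[OF A] supports_def)
  moreover have "0 \<le> k (d / 2)"
    using le[of "d / 2" x] \<open>0 < d\<close> dual_unit_Re[OF du, of "exp_operator (of_real (d / 2)) A x"]
    by (simp add: k_def)
  ultimately show False by simp
qed

lemma herm_exp:
  assumes H: "herm H"
  shows "norm (exp_operator (\<i> * of_real t) H x) = norm x"
proof -
  note bH = herm_bounded[OF H]
  have le1: "norm (exp_operator (of_real t * d) H x) \<le> norm x" if "0 \<le> t" "d = \<i> \<or> d = - \<i>" for t d x
  proof -
    have "numbound (\<lambda>x. d *\<^sub>C H x) 0"
      using H that by (auto simp: numbound_def herm_def supports_def dual_unit_scaleC)
    from numbound_exp[OF bounded_clinear_map_scaled[OF bH] this \<open>0 \<le> t\<close>, of x]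
    show ?thesis by (simp add: exp_operator_scaled[OF bH])
  qed
  have le: "norm (exp_operator (\<i> * of_real t) H x) \<le> norm x" for t x
    using le1[of t \<i> x] le1[of "- t" "- \<i>" x] by (cases "0 \<le> t") (auto simp: mult.commute)
  have "x = exp_operator (\<i> * of_real (- t) + \<i> * of_real t) H x" by (simp add: exp_operator_0[OF bH])
  also have "\<dots> = exp_operator (\<i> * of_real (- t)) H (exp_operator (\<i> * of_real t) H x)"
    by (rule exp_operator_add[OF bH])
  finally have "norm x \<le> norm (exp_operator (\<i> * of_real t) H x)" using le by metis
  with le show ?thesis by (intro antisym)
qed

lemma hermitian_operator_imp_herm:
  assumes "hermitian_operator H"
  shows "herm H"
proof -
  have bH: "bounded_clinear_map H" and iso: "\<And>t x. norm (exp_operator (\<i> * of_real t) H x) = norm x"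
    using assms by (auto simp: hermitian_operator_def)
  have "numbound (\<lambda>x. d *\<^sub>C H x) 0" if "d = \<i> \<or> d = - \<i>" for d
  proof (rule exp_numbound[OF bounded_clinear_map_scaled[OF bH]])
    fix s :: real and x assume "0 \<le> s"
    have "of_real s * d = \<i> * of_real (if d = \<i> then s else - s)" using that by auto
    then have "norm (exp_operator (of_real s * d) H x) = norm x" by (simp only: iso)
    then show "norm (exp_operator (of_real s) (\<lambda>x. d *\<^sub>C H x) x) \<le> exp (0 * s) * norm x"
      by (simp add: exp_operator_scaled[OF bH])
  qed
  from this[of \<i>] this[of "- \<i>"] bH show ?thesis
    by (force simp: numbound_def herm_def supports_def dual_unit_scaleC intro!: antisym)
qed

lemma herm_exp_Re:
  assumes H: "herm H"
  shows "norm (exp_operator z H x) = norm (exp_operator (of_real (Re z)) H x)"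
proof -
  have "z = \<i> * of_real (Im z) + of_real (Re z)" by (simp add: complex_eq_iff)
  then have "exp_operator z H x = exp_operator (\<i> * of_real (Im z)) H (exp_operator (of_real (Re z)) H x)"
    using exp_operator_add[OF herm_bounded[OF H]] by metis
  then show ?thesis by (simp add: herm_exp[OF H])
qed

text \<open>For a Hermitian operator the multiplicative constant in an exponential growth bound can be
  removed: the group is isometric on the imaginary axis, so the half-plane principle applies.\<close>

lemma herm_growth:
  fixes H :: "'a::complex_banach \<Rightarrow> 'a"
  assumes H: "herm H"
    and le: "\<And>s x. 0 \<le> s \<Longrightarrow> norm (exp_operator (of_real s) H x) \<le> C * exp (c * s) * norm x"
  shows "numbound H c"
proof (rule exp_numbound[OF herm_bounded[OF H]], rule norm_le_dual)
  fix s :: real and x and \<Psi> :: "'a \<Rightarrow> complex" assume s: "0 \<le> s" and \<Psi>: "dual_unit \<Psi>"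
  note bH = herm_bounded[OF H]
  define g where "g z = exp (- of_real c * z) * \<Psi> (exp_operator z H x)" for z
  have gle: "cmod (g z) \<le> exp (- c * Re z) * norm (exp_operator (of_real (Re z)) H x)" for z
    using dual_unit_norm[OF \<Psi>, of "exp_operator z H x"] herm_exp_Re[OF H, of z x]
    by (simp add: g_def norm_mult)
  have "cmod (g (of_real s)) \<le> norm x"
  proof (rule half_plane_bound[where g = g])
    show "g holomorphic_on UNIV"
      unfolding g_def by (intro holomorphic_intros exp_operator_dual_holomorphic[OF bH \<Psi>])
    show "cmod (g z) \<le> norm x" if "Re z = 0" for z
      using gle[of z] that by (simp add: exp_operator_0[OF bH])
    show "cmod (g z) \<le> C * norm x" if "0 \<le> Re z" for z
    proof -
      have "cmod (g z) \<le> exp (- c * Re z) * (C * exp (c * Re z) * norm x)"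
        by (rule order_trans[OF gle mult_left_mono[OF le[OF that]]]) simp
      also have "\<dots> = C * norm x" by (simp add: exp_minus)
      finally show ?thesis .
    qed
  qed (use s in simp)
  then have "exp (- c * s) * cmod (\<Psi> (exp_operator (of_real s) H x)) \<le> norm x"
    by (simp add: g_def norm_mult)
  then show "cmod (\<Psi> (exp_operator (of_real s) H x)) \<le> exp (c * s) * norm x"
    by (simp add: exp_minus field_simps)
qed

lemma power_bounded_numbound:
  fixes H :: "'a::complex_banach \<Rightarrow> 'a"
  assumes H: "herm H" and bd: "\<And>n x. norm ((H ^^ n) x) \<le> C * norm x"
  shows "numbound H 1"
proof (rule herm_growth[OF H])
  fix s :: real and x :: 'a assume s: "0 \<le> s"
  from real_exp_sums[of s] have s2: "(\<lambda>n. s ^ n / fact n * (C * norm x)) sums (exp s * (C * norm x))" by (rule sums_mult2)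
  have le: "norm ((of_real s ^ n / fact n) *\<^sub>C (H ^^ n) x) \<le> s ^ n / fact n * (C * norm x)" for n
    using mult_left_mono[OF bd[of n x], of "s ^ n / fact n"] s
    by (simp add: norm_scaleC norm_divide norm_power)
  have "norm (exp_operator (of_real s) H x) \<le> exp s * (C * norm x)"
    by (rule norm_sums_le[OF exp_operator_sums[OF herm_bounded[OF H]] s2 le])
  then show "norm (exp_operator (of_real s) H x) \<le> C * exp (1 * s) * norm x" by (simp add: algebra_simps)
qed

text \<open>Sinclair's theorem: on Hermitian operators the operator norm is controlled by the numerical
  range with constant one. It is Bernstein's inequality for the functions \<open>\<Psi> (exp (i z H) x)\<close>.\<close>

lemma sinclair:
  fixes H :: "'a::complex_banach \<Rightarrow> 'a"
  assumes H: "herm H" and up: "numbound H c" and lo: "numbound (\<lambda>x. - H x) c" and c: "0 \<le> c"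
  shows "norm (H x) \<le> c * norm x"
proof (rule norm_le_dual)
  fix \<Psi> :: "'a \<Rightarrow> complex" assume \<Psi>: "dual_unit \<Psi>"
  note bH = herm_bounded[OF H]
  have gr: "norm (exp_operator (of_real r) H x) \<le> exp (c * \<bar>r\<bar>) * norm x" for r
  proof (cases "0 \<le> r")
    case True
    with numbound_exp[OF bH up, of r x] show ?thesis by simp
  next
    case False
    have "numbound (\<lambda>x. (- 1) *\<^sub>C H x) c" using lo by simp
    from numbound_exp[OF bounded_clinear_map_scaled[OF bH] this, of "- r" x] False
    have "norm (exp_operator (of_real (- r) * (- 1)) H x) \<le> exp (c * (- r)) * norm x"
      by (simp only: exp_operator_scaled[OF bH])
    with False show ?thesis by simp
  qed
  have est: "cmod (\<Psi> (H x)) \<le> d * norm x" if d: "c < d" for d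
  proof -
    have d0: "0 < d" using c d by simp
    define f where "f z = \<Psi> (exp_operator (\<i> / of_real d * z) H x)" for z
    have deriv: "(f has_field_derivative (\<Psi> (exp_operator (\<i> / of_real d * z) H (H x)) * (\<i> / of_real d))) (at z)" for z
      unfolding f_def
      by (rule DERIV_chain2[OF exp_operator_dual_deriv[OF bH \<Psi>]])
        (use d0 in \<open>auto intro!: derivative_eq_intros\<close>)
    have "cmod (deriv f 0) \<le> norm x"
    proof (rule bernstein_inequality)
      show "f holomorphic_on UNIV" using deriv by (meson field_differentiable_at_within field_differentiable_def holomorphic_on_def)
      fix z
      have "cmod (f z) \<le> norm (exp_operator (\<i> / of_real d * z) H x)"
        unfolding f_def by (rule dual_unit_norm[OF \<Psi>])
      also have "\<dots> = norm (exp_operator (of_real (- Im z / d)) H x)"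
        by (subst herm_exp_Re[OF H]) (simp add: Re_divide_of_real)
      also have "\<dots> \<le> exp (c * \<bar>- Im z / d\<bar>) * norm x" by (rule gr)
      also have "c * \<bar>- Im z / d\<bar> \<le> \<bar>Im z\<bar>"
        using d0 d mult_right_mono[of c d "\<bar>Im z\<bar>"] by (simp add: field_simps)
      then have "exp (c * \<bar>- Im z / d\<bar>) * norm x \<le> norm x * exp \<bar>Im z\<bar>" by (simp add: mult.commute mult_left_mono)
      finally show "cmod (f z) \<le> norm x * exp \<bar>Im z\<bar>" .
    qed
    moreover have "deriv f 0 = \<Psi> (H x) * (\<i> / of_real d)"
      using DERIV_imp_deriv[OF deriv[of 0]] by (simp add: exp_operator_0[OF bH])
    ultimately have "cmod (\<Psi> (H x)) / d \<le> norm x" using d0 by (simp add: norm_mult norm_divide)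
    then show ?thesis using d0 by (simp add: field_simps)
  qed
  show "cmod (\<Psi> (H x)) \<le> c * norm x"
  proof (cases "x = 0")
    case True
    then show ?thesis using linear_0[OF bounded_clinear_map_linear[OF bH]] by (simp add: dual_unit_zero[OF \<Psi>])
  next
    case False
    have "cmod (\<Psi> (H x)) / norm x \<le> d" if "c < d" for d using est[OF that] False by (simp add: field_simps)
    then have "cmod (\<Psi> (H x)) / norm x \<le> c" by (rule dense_ge)
    then show ?thesis using False by (simp add: field_simps)
  qed
qed

text \<open>Spectrum in \<open>[0, \<infinity>)\<close> implies a nonnegative numerical range. Let \<open>- c0\<close> be the infimum of the
  numerical range and suppose \<open>c0 > 0\<close>. Then \<open>A = H + c0\<close> generates contractions on the half plane, so
  Cauchy's estimate gives \<open>\<parallel>exp (-s A) A\<parallel> \<le> 1/s\<close>; as \<open>A\<close> is invertible, \<open>exp (-s A)\<close> decays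
  exponentially, and \<open>herm_growth\<close> improves the bound \<open>c0\<close>.\<close>

lemma herm_spectrum_nonneg:
  fixes H :: "'a::complex_banach \<Rightarrow> 'a"
  assumes H: "herm H" and sp: "operator_spectrum H \<subseteq> complex_of_real ` {0..}"
  shows "numbound (\<lambda>x. - H x) 0"
proof (rule ccontr)
  assume neg: "\<not> numbound (\<lambda>x. - H x) 0"
  note bH = herm_bounded[OF H]
  define H' where "H' x = - H x" for x
  have H'_eq: "H' = (\<lambda>x. (- 1) *\<^sub>C H x)" by (simp add: H'_def fun_eq_iff)
  have bH': "bounded_clinear_map H'" unfolding H'_eq by (rule bounded_clinear_map_scaled[OF bH])
  have hH': "herm H'"
    using H bH' by (auto simp: herm_def H'_def dual_unit_minus supports_def)
  define CC where "CC = {c. numbound H' c}"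
  have pos: "0 < c" if "c \<in> CC" for c
    using numbound_mono[of H' c 0] that neg by (force simp: CC_def H'_def[abs_def])
  have bdd: "bdd_below CC" using pos by (intro bdd_belowI[of _ 0]) force
  have "onorm H' \<in> CC"
    unfolding CC_def numbound_def
  proof (intro CollectI allI impI)
    fix x and \<Psi> :: "'a \<Rightarrow> complex" assume "supports \<Psi> x"
    then have "Re (\<Psi> (H' x)) \<le> norm (H' x)" by (simp add: supports_def dual_unit_Re)
    with bounded_clinear_map_norm[OF bH', of x] show "Re (\<Psi> (H' x)) \<le> onorm H' * norm x" by linarith
  qed
  then have ne: "CC \<noteq> {}" by blast
  define c0 where "c0 = Inf CC"
  have nb0: "numbound H' c0"
    unfolding numbound_def
  proof (intro allI impI)
    fix x and \<Psi> :: "'a \<Rightarrow> complex" assume sup: "supports \<Psi> x"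
    show "Re (\<Psi> (H' x)) \<le> c0 * norm x"
    proof (cases "x = 0")
      case True
      then show ?thesis using sup linear_0[OF bounded_clinear_map_linear[OF bH']]
        by (simp add: supports_def dual_unit_zero)
    next
      case False
      have "Re (\<Psi> (H' x)) / norm x \<le> c0"
        unfolding c0_def
      proof (rule cInf_greatest[OF ne])
        fix c assume "c \<in> CC"
        with sup have "Re (\<Psi> (H' x)) \<le> c * norm x" by (simp add: CC_def numbound_def)
        with False show "Re (\<Psi> (H' x)) / norm x \<le> c" by (simp add: field_simps)
      qed
      with False show ?thesis by (simp add: field_simps)
    qed
  qed
  then have c0: "0 < c0" using pos by (simp add: CC_def)
  have "complex_of_real (- c0) \<notin> operator_spectrum H"
    using sp c0 by (force simp del: of_real_minus)
  then obtain S where S: "bounded_clinear_map S" "\<And>x. H (S x) - of_real (- c0) *\<^sub>C S x = x"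
    unfolding operator_spectrum_def by blast
  have HS: "H (S y) + of_real c0 *\<^sub>C S y = y" for y using S(2)[of y] by (simp add: scaleC.minus_left)
  define K where "K = onorm S + 1"
  have K: "0 < K" "norm (S y) \<le> K * norm y" for y
  proof -
    show "0 < K" using onorm_pos_le[OF bounded_clinear_map_bounded_linear[OF S(1)]] by (simp add: K_def)
    have "norm (S y) \<le> onorm S * norm y" by (rule bounded_clinear_map_norm[OF S(1)])
    also have "\<dots> \<le> K * norm y" unfolding K_def by (intro mult_right_mono) auto
    finally show "norm (S y) \<le> K * norm y" .
  qed
  \<comment> \<open>\<open>E s\<close> is \<open>exp (-s A)\<close>\<close>
  define E where "E s x = exp (- c0 * s) *\<^sub>R exp_operator (of_real s) H' x" for s :: real and x :: 'a
  have Edec: "norm (E s y) \<le> K / s * norm y" if s: "0 < s" for s y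
  proof (rule norm_le_dual)
    fix \<Psi> :: "'a \<Rightarrow> complex" assume \<Psi>: "dual_unit \<Psi>"
    define x where "x = S y"
    define g where "g z = exp (- of_real c0 * z) * \<Psi> (exp_operator z H' x)" for z
    have gle: "cmod (g z) \<le> norm x" if "0 \<le> Re z" for z
    proof -
      have "cmod (g z) \<le> exp (- c0 * Re z) * norm (exp_operator (of_real (Re z)) H' x)"
        using dual_unit_norm[OF \<Psi>, of "exp_operator z H' x"] herm_exp_Re[OF hH', of z x]
        by (simp add: g_def norm_mult)
      also have "\<dots> \<le> exp (- c0 * Re z) * (exp (c0 * Re z) * norm x)"
        by (intro mult_left_mono numbound_exp[OF bH' nb0 that]) simp
      finally show ?thesis by (simp add: mult.assoc[symmetric] exp_add[symmetric])
    qed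
    have hol: "g holomorphic_on UNIV"
      unfolding g_def by (intro holomorphic_intros exp_operator_dual_holomorphic[OF bH' \<Psi>])
    have "norm ((deriv ^^ 1) g (of_real s)) \<le> fact 1 * norm x / s ^ 1"
    proof (rule Cauchy_inequality)
      show "g holomorphic_on ball (of_real s) s" "continuous_on (cball (of_real s) s) g"
        using hol holomorphic_on_subset holomorphic_on_imp_continuous_on by blast+
      fix w :: complex assume "norm (of_real s - w) = s"
      with abs_Re_le_cmod[of "of_real s - w"] have "0 \<le> Re w" by auto
      then show "norm (g w) \<le> norm x" by (rule gle)
    qed (use s in simp)
    moreover have "deriv g (of_real s) = - exp (- of_real c0 * of_real s) * \<Psi> (exp_operator (of_real s) H' y)"
    proof (rule DERIV_imp_deriv)
      have lin: "\<Psi> (exp_operator (of_real s) H' (H' x)) - of_real c0 * \<Psi> (exp_operator (of_real s) H' x)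
          = - \<Psi> (exp_operator (of_real s) H' y)"
      proof -
        have "H' x = (- 1) *\<^sub>C (y - of_real c0 *\<^sub>C x)" using HS[of y] by (simp add: H'_def x_def algebra_simps)
        then show ?thesis
          by (simp add: linear_diff[OF exp_operator_linear[OF bH']] linear_neg[OF exp_operator_linear[OF bH']]
              linear_scale[OF exp_operator_linear[OF bH']] scaleC_of_real dual_unit_simps[OF \<Psi>])
      qed
      have "(g has_field_derivative (- of_real c0 * exp (- of_real c0 * of_real s) * \<Psi> (exp_operator (of_real s) H' x)
          + exp (- of_real c0 * of_real s) * \<Psi> (exp_operator (of_real s) H' (H' x)))) (at (of_real s))"
        unfolding g_def by (auto intro!: derivative_eq_intros exp_operator_dual_deriv[OF bH' \<Psi>])
      also have "- of_real c0 * exp (- of_real c0 * of_real s) * \<Psi> (exp_operator (of_real s) H' x)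
          + exp (- of_real c0 * of_real s) * \<Psi> (exp_operator (of_real s) H' (H' x))
          = exp (- of_real c0 * of_real s) * (\<Psi> (exp_operator (of_real s) H' (H' x)) - of_real c0 * \<Psi> (exp_operator (of_real s) H' x))"
        by (simp add: algebra_simps)
      also note lin
      finally show "(g has_field_derivative - exp (- of_real c0 * of_real s) * \<Psi> (exp_operator (of_real s) H' y)) (at (of_real s))"
        by simp
    qed
    moreover have "\<Psi> (E s y) = exp (- of_real c0 * of_real s) * \<Psi> (exp_operator (of_real s) H' y)"
      by (simp add: E_def dual_unit_scaleR[OF \<Psi>] exp_of_real[symmetric])
    ultimately have "cmod (\<Psi> (E s y)) \<le> norm x / s" by simp
    also have "\<dots> \<le> K * norm y / s" using s K by (intro divide_right_mono) (auto simp: x_def)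
    finally show "cmod (\<Psi> (E s y)) \<le> K / s * norm y" by simp
  qed
  have E1: "norm (E s y) \<le> norm y" if "0 \<le> s" for s y
  proof -
    have "norm (E s y) \<le> exp (- c0 * s) * (exp (c0 * s) * norm y)"
      unfolding E_def norm_scaleR by (simp add: numbound_exp[OF bH' nb0 that])
    then show ?thesis by (simp add: mult.assoc[symmetric] exp_add[symmetric])
  qed
  \<comment> \<open>over a time \<open>s0\<close> the operator \<open>E\<close> contracts by the factor \<open>exp (-1)\<close>\<close>
  define s0 where "s0 = exp 1 * K"
  have s0: "0 < s0" using K by (simp add: s0_def)
  have Eadd: "E (s + t) y = E s (E t y)" for s t y
  proof -
    have "exp_operator (of_real s) H' (r *\<^sub>R z) = r *\<^sub>R exp_operator (of_real s) H' z" for r z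
      by (rule linear_scale[OF exp_operator_linear[OF bH']])
    then show ?thesis by (simp add: E_def exp_operator_add[OF bH'] exp_add[symmetric] algebra_simps)
  qed
  have Epow: "norm (E (real n * s0) y) \<le> exp (- real n) * norm y" for n y
  proof (induction n arbitrary: y)
    case 0
    then show ?case using E1[of 0 y] by simp
  next
    case (Suc n)
    have "real (Suc n) * s0 = real n * s0 + s0" by (simp add: algebra_simps)
    then have "norm (E (real (Suc n) * s0) y) = norm (E (real n * s0) (E s0 y))" by (simp only: Eadd)
    also have "\<dots> \<le> exp (- real n) * norm (E s0 y)" by (rule Suc)
    also have "\<dots> \<le> exp (- real n) * (K / s0 * norm y)" by (intro mult_left_mono Edec s0) simp
    also have "K / s0 = exp (- 1)" using K by (simp add: s0_def exp_minus field_simps)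
    also have "exp (- real n) * (exp (- 1) * norm y) = exp (- real (Suc n)) * norm y"
      by (simp add: exp_add[symmetric] mult.assoc[symmetric])
    finally show ?case .
  qed
  have "numbound H' (c0 - 1 / s0)"
  proof (rule herm_growth[OF hH'])
    fix s :: real and x :: 'a assume s: "0 \<le> s"
    define n where "n = nat \<lfloor>s / s0\<rfloor>"
    have q: "0 \<le> s / s0" using s s0 by simp
    have n: "real n \<le> s / s0" "s / s0 < real n + 1" using q by (simp_all add: n_def)
    have "norm (E s x) = norm (E (s - real n * s0) (E (real n * s0) x))" by (simp add: Eadd[symmetric])
    also have "\<dots> \<le> norm (E (real n * s0) x)" using n s0 by (intro E1) (simp add: field_simps)
    also have "\<dots> \<le> exp (- real n) * norm x" by (rule Epow)
    also have "\<dots> \<le> exp (1 - s / s0) * norm x" using n by (intro mult_right_mono) auto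
    finally have "exp (- c0 * s) * norm (exp_operator (of_real s) H' x) \<le> exp (1 - s / s0) * norm x"
      by (simp add: E_def)
    then have "(exp (c0 * s) * exp (- c0 * s)) * norm (exp_operator (of_real s) H' x)
        \<le> (exp (c0 * s) * exp (1 - s / s0)) * norm x"
      by (simp only: mult.assoc) (intro mult_left_mono, auto)
    moreover have "exp (c0 * s) * exp (- c0 * s) = 1" by (simp only: exp_add[symmetric]) simp
    moreover have "exp (c0 * s) * exp (1 - s / s0) = exp 1 * exp ((c0 - 1 / s0) * s)"
      by (simp only: exp_add[symmetric]) (simp add: algebra_simps)
    ultimately show "norm (exp_operator (of_real s) H' x) \<le> exp 1 * exp ((c0 - 1 / s0) * s) * norm x"
      by (simp only: mult_1)
  qed
  then have "c0 \<le> c0 - 1 / s0" unfolding c0_def by (intro cInf_lower bdd) (simp add: CC_def c0_def)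
  with s0 show False by simp
qed

section \<open>Algebra of the triple product\<close>

locale jb_triple =
  fixes tp :: "'z::complex_banach \<Rightarrow> 'z \<Rightarrow> 'z \<Rightarrow> 'z"
  assumes jb: "jb_star_triple tp"
begin

lemma clinear1: "clinear_map (\<lambda>x. tp x y z)"
  and antilinear2: "antilinear_map (\<lambda>y. tp x y z)"
  and clinear3: "clinear_map (tp x y)"
  and tp_commute: "tp x y z = tp z y x"
  and hermitian_square: "hermitian_operator (tp x x)"
  and spectrum_square: "operator_spectrum (tp x x) \<subseteq> complex_of_real ` {0..}"
  and onorm_square: "onorm (tp x x) = (norm x)\<^sup>2"
  and jordan: "tp a b (tp x y z) = tp (tp a b x) y z - tp x (tp b a y) z + tp x y (tp a b z)"
  using jb unfolding jb_star_triple_def by blast+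

lemma linear1: "linear (\<lambda>x. tp x y z)" by (rule clinear_map_linear[OF clinear1])
lemma linear2: "linear (\<lambda>y. tp x y z)" by (rule antilinear_map_linear[OF antilinear2])
lemma linear3: "linear (tp x y)" by (rule clinear_map_linear[OF clinear3])

lemmas tp_real_linear =
  linear_add[OF linear1] linear_add[OF linear2] linear_add[OF linear3]
  linear_diff[OF linear1] linear_diff[OF linear2] linear_diff[OF linear3]
  linear_neg[OF linear1] linear_neg[OF linear2] linear_neg[OF linear3]
  linear_scale[OF linear1] linear_scale[OF linear2] linear_scale[OF linear3]
  linear_0[OF linear1] linear_0[OF linear2] linear_0[OF linear3]

lemma tp_scaleC:
  "tp (c *\<^sub>C x) y z = c *\<^sub>C tp x y z"
  "tp x (c *\<^sub>C y) z = cnj c *\<^sub>C tp x y z"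
  "tp x y (c *\<^sub>C z) = c *\<^sub>C tp x y z"
  using clinear1 antilinear2 clinear3 by (auto simp: clinear_map_def antilinear_map_def)

lemma square_bounded: "bounded_clinear_map (tp x x)"
  using hermitian_square by (simp add: hermitian_operator_def)

lemma square_herm: "herm (tp x x)"
  by (rule hermitian_operator_imp_herm[OF hermitian_square])

lemma square_nonneg: "numbound (\<lambda>z. - tp x x z) 0"
  by (rule herm_spectrum_nonneg[OF square_herm spectrum_square])

lemma square_norm_le: "norm (tp x x z) \<le> (norm x)\<^sup>2 * norm z"
  using bounded_clinear_map_norm[OF square_bounded, of x z] by (simp add: onorm_square)

lemma square_numbound: "numbound (tp x x) ((norm x)\<^sup>2)"
  unfolding numbound_def
proof (intro allI impI)
  fix z \<Psi> assume "supports \<Psi> (z::'z)"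
  then have "Re (\<Psi> (tp x x z)) \<le> norm (tp x x z)" by (simp add: supports_def dual_unit_Re)
  with square_norm_le[of x z] show "Re (\<Psi> (tp x x z)) \<le> (norm x)\<^sup>2 * norm z" by linarith
qed

text \<open>By Sinclair's theorem the norm of \<open>x\<close> can be read off from the numerical range of \<open>tp x x\<close>.\<close>

lemma norm_le_numbound:
  assumes "numbound (tp x x) c" "0 \<le> c"
  shows "(norm x)\<^sup>2 \<le> c"
proof -
  have "norm (tp x x z) \<le> c * norm z" for z
    by (rule sinclair[OF square_herm assms(1) numbound_mono[OF square_nonneg assms(2)] assms(2)])
  then have "onorm (tp x x) \<le> c" by (rule onorm_bound[OF assms(2)])
  then show ?thesis by (simp add: onorm_square)
qed

lemma polarization:
  "4 *\<^sub>R tp x y z = tp (x + y) (x + y) z - tp (x - y) (x - y) z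
     + \<i> *\<^sub>C (tp (x + \<i> *\<^sub>C y) (x + \<i> *\<^sub>C y) z - tp (x - \<i> *\<^sub>C y) (x - \<i> *\<^sub>C y) z)"
proof -
  have "4 *\<^sub>R v = v + v + (v + v)" for v :: 'z
    using scaleR_add_left[of 2 2 v] scaleR_2[of v] by simp
  then show ?thesis
    by (simp add: tp_real_linear tp_scaleC scaleC_add_right scaleC.diff_right scaleC.minus_left
        scaleC.minus_right algebra_simps)
qed

text \<open>The factor 4 is the one that polarization gives for \<open>x, y\<close> of norm one.\<close>

lemma tp_norm_le: "norm (tp x y z) \<le> 4 * norm x * norm y * norm z"
proof -
  have unit: "norm (tp x y z) \<le> 4 * norm z" if "norm x = 1" "norm y = 1" for x y
  proof -
    have b: "norm (tp (x + c *\<^sub>C y) (x + c *\<^sub>C y) z) \<le> 4 * norm z" if "cmod c = 1" for c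
    proof -
      have "norm (x + c *\<^sub>C y) \<le> 2"
        using norm_triangle_ineq[of x "c *\<^sub>C y"] \<open>norm x = 1\<close> \<open>norm y = 1\<close> that by (simp add: norm_scaleC)
      then have "(norm (x + c *\<^sub>C y))\<^sup>2 \<le> 2\<^sup>2" by (intro power_mono) auto
      then have "(norm (x + c *\<^sub>C y))\<^sup>2 * norm z \<le> 4 * norm z" by (intro mult_right_mono) auto
      with square_norm_le[of "x + c *\<^sub>C y" z] show ?thesis by linarith
    qed
    have "norm (4 *\<^sub>R tp x y z) \<le> norm (tp (x + y) (x + y) z) + norm (tp (x - y) (x - y) z)
       + (norm (tp (x + \<i> *\<^sub>C y) (x + \<i> *\<^sub>C y) z) + norm (tp (x - \<i> *\<^sub>C y) (x - \<i> *\<^sub>C y) z))"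
      unfolding polarization
      by (intro norm_triangle_mono norm_triangle_ineq4) (simp add: norm_scaleC norm_triangle_ineq4)
    with b[of 1] b[of "- 1"] b[of \<i>] b[of "- \<i>"] show ?thesis by (simp add: scaleC.minus_left)
  qed
  show ?thesis
  proof (cases "x = 0 \<or> y = 0")
    case True
    then show ?thesis by (auto simp: tp_real_linear)
  next
    case False
    define x' y' where "x' = x /\<^sub>R norm x" and "y' = y /\<^sub>R norm y"
    have "x = norm x *\<^sub>R x'" "y = norm y *\<^sub>R y'" using False by (auto simp: x'_def y'_def)
    then have "tp x y z = (norm x * norm y) *\<^sub>R tp x' y' z" by (metis tp_real_linear(10,11) scaleR_scaleR)
    moreover have "norm (tp x' y' z) \<le> 4 * norm z" using False by (intro unit) (auto simp: x'_def y'_def)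
    ultimately have "norm (tp x y z) \<le> norm x * norm y * (4 * norm z)"
      by (simp add: abs_mult mult_left_mono)
    then show ?thesis by (simp add: algebra_simps)
  qed
qed

text \<open>The odd powers of an element: \<open>pw z n\<close> is the power of exponent \<open>2 n + 1\<close>.\<close>

definition pw :: "'z \<Rightarrow> nat \<Rightarrow> 'z" where "pw z n = (tp z z ^^ n) z"

lemma pw_0 [simp]: "pw z 0 = z" and pw_Suc: "pw z (Suc n) = tp z z (pw z n)"
  by (simp_all add: pw_def)

text \<open>Power associativity. With \<open>D\<close> the commutator of \<open>tp z z\<close> and \<open>tp (pw z (n+1)) z\<close>, the Jordan
  identity writes \<open>D\<close> as each of the \<open>n + 2\<close> successive differences along the operators of total degree
  \<open>n + 2\<close>, and it also writes the negative of their sum as \<open>D\<close>; hence \<open>(n + 3) D = 0\<close>.\<close>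

lemma power_assoc:
  "(\<forall>i j. i + j = n \<longrightarrow> tp (pw z i) (pw z j) = tp (pw z n) z) \<and>
   (\<forall>w. tp z z (tp (pw z n) z w) = tp (pw z n) z (tp z z w))"
proof (induction n)
  case (Suc n)
  define T where "T = tp z z"
  have der: "T (tp (pw z i) (pw z j) w) = tp (pw z (Suc i)) (pw z j) w - tp (pw z i) (pw z (Suc j)) w
      + tp (pw z i) (pw z j) (T w)" for i j w
    unfolding T_def by (subst jordan) (simp add: pw_Suc)
  have shift: "tp (pw z (Suc i)) (pw z j) = tp (pw z i) (pw z (Suc j))" if "i + j = n" for i j
  proof
    fix w
    have "tp (pw z i) (pw z j) = tp (pw z n) z" using Suc that by blast
    with Suc have "T (tp (pw z i) (pw z j) w) = tp (pw z i) (pw z j) (T w)" by (simp add: T_def)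
    with der[of i j w] show "tp (pw z (Suc i)) (pw z j) w = tp (pw z i) (pw z (Suc j)) w" by simp
  qed
  have eq: "tp (pw z i) (pw z j) = tp (pw z (Suc n)) z" if "i + j = Suc n" for i j
    using that
  proof (induction j arbitrary: i)
    case (Suc j)
    then have "tp (pw z i) (pw z (Suc j)) = tp (pw z (Suc i)) (pw z j)" by (intro shift[symmetric]) simp
    also have "\<dots> = tp (pw z (Suc n)) z" using Suc.prems by (intro Suc.IH) simp
    finally show ?case .
  qed simp
  have "T (tp (pw z (Suc n)) z w) = tp (pw z (Suc n)) z (T w)" for w
  proof -
    define p where "p = pw z (Suc n)"
    define D where "D = T (tp p z w) - tp p z (T w)"
    have step: "tp (pw z (Suc i)) (pw z j) w = tp (pw z i) (pw z (Suc j)) w + D" if "i + j = Suc n" for i j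
      using der[of i j w] unfolding D_def p_def eq[OF that] by (simp add: algebra_simps)
    have "tp (pw z i) (pw z j) w = tp z (pw z (Suc (Suc n))) w + real i *\<^sub>R D" if "i + j = Suc (Suc n)" for i j
      using that
    proof (induction i arbitrary: j)
      case (Suc i)
      then have "tp (pw z (Suc i)) (pw z j) w = tp (pw z i) (pw z (Suc j)) w + D" by (intro step) simp
      also have "tp (pw z i) (pw z (Suc j)) w = tp z (pw z (Suc (Suc n))) w + real i *\<^sub>R D"
        using Suc.prems by (intro Suc.IH) simp
      finally show ?case by (simp add: algebra_simps)
    qed simp
    from this[of "Suc (Suc n)" 0]
    have up: "tp (pw z (Suc (Suc n))) z w = tp z (pw z (Suc (Suc n))) w + real (Suc (Suc n)) *\<^sub>R D" by simp
    have "tp p z z = pw z (Suc (Suc n))" using tp_commute[of p z z] by (simp add: p_def pw_Suc)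
    moreover have "tp z p z = pw z (Suc (Suc n))"
    proof -
      have "tp z p = tp p z" using eq[of 0 "Suc n"] by (simp add: p_def)
      with \<open>tp p z z = pw z (Suc (Suc n))\<close> show ?thesis by simp
    qed
    ultimately have "tp p z (T w) = tp (pw z (Suc (Suc n))) z w - tp z (pw z (Suc (Suc n))) w + T (tp p z w)"
      using jordan[of p z z z w] by (simp add: T_def)
    with up have "T (tp p z w) - tp p z (T w) = - (real (Suc (Suc n)) *\<^sub>R D)" by simp
    then have "D = - (real (Suc (Suc n)) *\<^sub>R D)" by (simp only: D_def[symmetric])
    then have "D + real (Suc (Suc n)) *\<^sub>R D = 0" by (metis add.right_inverse add.commute)
    then have "(1 + real (Suc (Suc n))) *\<^sub>R D = 0" by (simp only: scaleR_add_left scaleR_one)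
    then have "D = 0" by simp
    then show ?thesis by (simp add: D_def p_def)
  qed
  with eq show ?case by (auto simp: T_def)
qed simp

lemma tp_pw: "tp (pw z i) (pw z j) = tp (pw z (i + j)) z"
  using power_assoc[of "i + j" z] by blast

lemma tp_pw_left: "tp z (pw z n) = tp (pw z n) z"
  using tp_pw[of z 0 n] by simp

lemma tp_pw_comm: "tp z z (tp (pw z n) z w) = tp (pw z n) z (tp z z w)"
  using power_assoc[of n z] by blast

lemma tp_pw_pw: "tp (pw z n) z (pw z k) = pw z (Suc (n + k))"
proof (induction k)
  case 0
  show ?case using tp_commute[of "pw z n" z z] by (simp add: pw_Suc)
next
  case (Suc k)
  then show ?case by (simp add: pw_Suc[of z k] tp_pw_comm[symmetric] pw_Suc)
qed

text \<open>With \<open>L = tp (pw z n) z\<close> and \<open>Q c = {z, c, z}\<close>, two instances of the Jordan identity give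
  \<open>{pw z (n+1), c, z}\<close> as \<open>(L Q + Q L) c / 2\<close> and as \<open>(2 L Q - Q L) c\<close>; comparing them, \<open>L\<close> and \<open>Q\<close>
  commute.\<close>

lemma
  shows tp_pw_Q_comm: "tp (pw z n) z (tp z c z) = tp z (tp (pw z n) z c) z"
    and tp_pw_Q: "tp (pw z (Suc n)) c z = tp (pw z n) z (tp z c z)"
proof -
  define L Q where "L = tp (pw z n) z" and "Q c = tp z c z" for c
  define X where "X = tp (pw z (Suc n)) c z"
  have Lz: "L z = pw z (Suc n)" using tp_pw_pw[of z n 0] by (simp add: L_def)
  have "tp (pw z n) z (tp z c z) = tp (L z) c z - tp z (tp z (pw z n) c) z + tp z c (L z)"
    unfolding L_def by (rule jordan)
  moreover have "tp z c (L z) = X" "tp (L z) c z = X" using tp_commute[of z c] by (simp_all add: X_def Lz)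
  moreover have "tp z (pw z n) c = L c" by (simp add: tp_pw_left L_def)
  ultimately have 1: "L (Q c) = X - Q (L c) + X" by (simp add: L_def Q_def)
  have "tp z c (tp z (pw z n) z) = tp (tp z c z) (pw z n) z - tp z (tp c z (pw z n)) z + tp z (pw z n) (tp z c z)"
    by (rule jordan)
  moreover have "tp z (pw z n) z = pw z (Suc n)" using Lz by (simp add: tp_pw_left L_def)
  moreover have "tp z c (pw z (Suc n)) = X" using tp_commute[of z c] by (simp add: X_def)
  moreover have "tp (tp z c z) (pw z n) z = L (Q c)" "tp z (pw z n) (tp z c z) = L (Q c)"
    using tp_commute[of "tp z c z" "pw z n" z] by (simp_all add: tp_pw_left L_def Q_def)
  moreover have "tp c z (pw z n) = L c" using tp_commute[of c z] by (simp add: L_def)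
  ultimately have 2: "X = L (Q c) - Q (L c) + L (Q c)" by (simp add: Q_def)
  have "3 *\<^sub>R (L (Q c) - Q (L c)) = 0"
  proof -
    have "3 *\<^sub>R v = v + v + v" for v :: 'z using scaleR_add_left[of 2 1 v] scaleR_2[of v] by simp
    moreover have "L (Q c) = (L (Q c) - Q (L c) + L (Q c)) - Q (L c) + (L (Q c) - Q (L c) + L (Q c))"
      using 1 2 by simp
    ultimately show ?thesis by (simp add: algebra_simps)
  qed
  then have c: "L (Q c) = Q (L c)" by simp
  then show "tp (pw z n) z (tp z c z) = tp z (tp (pw z n) z c) z" by (simp add: L_def Q_def)
  from c 2 show "tp (pw z (Suc n)) c z = tp (pw z n) z (tp z c z)" by (simp add: X_def L_def Q_def)
qed

text \<open>If \<open>z\<close> were to act with two commuting eigenvalues \<open>\<alpha>, \<beta>\<close>, then \<open>mult z n\<close> would be \<open>(\<alpha>\<^sup>n + \<beta>\<^sup>n)/2\<close> and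
  \<open>quad z\<close> would be \<open>\<alpha> \<beta>\<close>; the following recurrences are those of the power sums.\<close>

definition mult :: "'z \<Rightarrow> nat \<Rightarrow> 'z \<Rightarrow> 'z" where
  "mult z n = (case n of 0 \<Rightarrow> (\<lambda>x. x) | Suc k \<Rightarrow> tp (pw z k) z)"

definition quad :: "'z \<Rightarrow> 'z \<Rightarrow> 'z" where "quad z c = tp z (tp z c z) z"

lemma mult_0 [simp]: "mult z 0 = (\<lambda>x. x)" and mult_Suc: "mult z (Suc k) = tp (pw z k) z"
  by (simp_all add: mult_def)

lemma linear_mult: "linear (mult z n)"
  by (cases n) (auto simp: mult_Suc linear3 intro: linearI)

lemma linear_quad: "linear (quad z)"
  by (rule linearI) (simp_all add: quad_def tp_real_linear)

lemma linear_quad_pow: "linear (quad z ^^ k)"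
  by (rule funpow_linear[OF linear_quad])

lemma mult_comm: "tp z z (mult z n x) = mult z n (tp z z x)"
  by (cases n) (simp_all add: mult_Suc tp_pw_comm)

lemma mult_quad: "mult z n (quad z x) = quad z (mult z n x)"
  by (cases n) (simp_all add: mult_Suc quad_def tp_pw_Q_comm)

lemma mult_quad_pow: "mult z n ((quad z ^^ k) x) = (quad z ^^ k) (mult z n x)"
  by (induction k) (simp_all add: mult_quad)

lemma square_quad_pow: "tp z z ((quad z ^^ k) x) = (quad z ^^ k) (tp z z x)"
  using mult_quad_pow[of z "Suc 0" k x] by (simp add: mult_Suc)

lemma mult_recurrence: "2 *\<^sub>R tp z z (mult z (Suc n) c) = mult z (Suc (Suc n)) c + quad z (mult z n c)"
proof -
  have "tp c (pw z n) (tp z z z) = tp (tp c (pw z n) z) z z - tp z (tp (pw z n) c z) z + tp z z (tp c (pw z n) z)"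
    by (rule jordan)
  moreover have 1: "tp c (pw z n) z = tp (pw z n) z c"
    using tp_commute[of c "pw z n" z] by (simp add: tp_pw_left)
  moreover have "tp c (pw z n) (tp z z z) = tp (pw z (Suc n)) z c"
  proof -
    have "tp (pw z (Suc 0)) (pw z n) = tp (pw z (Suc n)) z" using tp_pw[of z "Suc 0" n] by simp
    then show ?thesis using tp_commute[of c "pw z n" "tp z z z"] by (simp add: pw_Suc)
  qed
  moreover have "tp (tp (pw z n) z c) z z = tp z z (tp (pw z n) z c)" by (rule tp_commute)
  moreover have "tp z (tp (pw z n) c z) z = quad z (mult z n c)"
    by (cases n) (simp_all add: quad_def mult_Suc tp_pw_Q tp_pw_Q_comm)
  ultimately show ?thesis by (simp add: mult_Suc scaleR_2 algebra_simps)
qed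

lemma mult_mult: "m \<le> n \<Longrightarrow> 2 *\<^sub>R mult z n (mult z m c) = mult z (n + m) c + (quad z ^^ m) (mult z (n - m) c)"
proof (induction m rule: induct_nat_012)
  case 0
  then show ?case by (simp add: scaleR_2)
next
  case 1
  then obtain k where "n = Suc k" by (cases n) auto
  then show ?case using mult_recurrence[of z k c] mult_comm[of z n c] by (simp add: mult_Suc)
next
  case (ge2 m)
  define k where "k = n - Suc (Suc m)"
  have n: "n = Suc (Suc (k + m))" using ge2.prems by (simp add: k_def)
  let ?T = "tp z z" and ?E = "quad z" and ?M = "mult z"
  have rec: "?M (Suc (Suc m)) c = 2 *\<^sub>R ?T (?M (Suc m) c) - ?E (?M m c)"
    using mult_recurrence[of z m c] by (simp add: algebra_simps)
  have IH1: "2 *\<^sub>R ?M n (?M m c) = ?M (n + m) c + (?E ^^ m) (?M (Suc (Suc k)) c)"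
    using ge2.IH(1) by (simp add: n)
  have IH2: "2 *\<^sub>R ?M n (?M (Suc m) c) = ?M (Suc (n + m)) c + (?E ^^ Suc m) (?M (Suc k) c)"
    using ge2.IH(2) by (simp add: n)
  have "2 *\<^sub>R ?M n (?M (Suc (Suc m)) c) = 2 *\<^sub>R ?T (2 *\<^sub>R ?M n (?M (Suc m) c)) - ?E (2 *\<^sub>R ?M n (?M m c))"
    by (simp add: rec linear_diff[OF linear_mult] linear_scale[OF linear_mult] linear_scale[OF linear_quad]
        mult_comm mult_quad tp_real_linear scaleR_diff_right)
  also have "\<dots> = 2 *\<^sub>R ?T (?M (Suc (n + m)) c) + 2 *\<^sub>R ?T ((?E ^^ Suc m) (?M (Suc k) c))
      - (?E (?M (n + m) c) + ?E ((?E ^^ m) (?M (Suc (Suc k)) c)))"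
    by (simp only: IH1 IH2 tp_real_linear linear_add[OF linear_quad] scaleR_add_right)
  also have "2 *\<^sub>R ?T (?M (Suc (n + m)) c) = ?M (Suc (Suc (n + m))) c + ?E (?M (n + m) c)"
    by (rule mult_recurrence)
  also have "2 *\<^sub>R ?T ((?E ^^ Suc m) (?M (Suc k) c)) = (?E ^^ Suc m) (?M (Suc (Suc k)) c) + (?E ^^ Suc (Suc m)) (?M k c)"
  proof -
    have "2 *\<^sub>R ?T ((?E ^^ Suc m) (?M (Suc k) c)) = (?E ^^ Suc m) (2 *\<^sub>R ?T (?M (Suc k) c))"
      by (simp only: square_quad_pow linear_scale[OF linear_quad_pow])
    also have "\<dots> = (?E ^^ Suc m) (?M (Suc (Suc k)) c) + (?E ^^ Suc m) (?E (?M k c))"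
      by (simp only: mult_recurrence linear_add[OF linear_quad_pow])
    finally show ?thesis by (simp add: funpow_swap1)
  qed
  finally show ?case by (simp add: n)
qed

text \<open>A spectral radius formula: if the powers of \<open>z\<close> stay bounded, then so do the operators
  \<open>mult z n\<close>, hence the powers of \<open>quad z\<close>, hence those of \<open>tp z z\<close>; then the numerical range of
  \<open>tp z z\<close> is at most one, and with it \<open>\<parallel>z\<parallel>\<close>.\<close>

lemma norm_le_1_of_bounded_powers:
  assumes C: "\<And>n. norm (pw z n) \<le> C"
  shows "norm z \<le> 1"
proof -
  define C1 where "C1 = 1 + 4 * C * norm z"
  have C0: "0 \<le> C" by (rule order_trans[OF norm_ge_zero C])
  have C1: "1 \<le> C1" using C0 by (simp add: C1_def)
  have M: "norm (mult z n x) \<le> C1 * norm x" for n x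
  proof (cases n)
    case 0
    then show ?thesis using mult_right_mono[OF C1 norm_ge_zero[of x]] by simp
  next
    case (Suc k)
    have "norm (tp (pw z k) z x) \<le> 4 * norm (pw z k) * norm z * norm x" by (rule tp_norm_le)
    also have "\<dots> \<le> 4 * C * norm z * norm x" using C by (intro mult_right_mono mult_left_mono) auto
    also have "\<dots> \<le> C1 * norm x" unfolding C1_def by (intro mult_right_mono) auto
    finally show ?thesis by (simp add: Suc mult_Suc)
  qed
  define C2 where "C2 = (2 * C1 * C1 + C1) * C1"
  have E: "norm ((quad z ^^ j) x) \<le> (2 * C1 * C1 + C1) * norm x" for j x
  proof -
    have "(quad z ^^ j) x = 2 *\<^sub>R mult z j (mult z j x) - mult z (j + j) x"
      using mult_mult[of j j z x] by (simp add: algebra_simps)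
    then have "norm ((quad z ^^ j) x) \<le> 2 * norm (mult z j (mult z j x)) + norm (mult z (j + j) x)"
      using norm_triangle_ineq4[of "2 *\<^sub>R mult z j (mult z j x)" "mult z (j + j) x"] by simp
    moreover have "norm (mult z j (mult z j x)) \<le> C1 * (C1 * norm x)"
      using M[of j "mult z j x"] mult_left_mono[OF M[of j x], of C1] C1 by linarith
    moreover have "norm (mult z (j + j) x) \<le> C1 * norm x" by (rule M)
    ultimately show ?thesis by (simp add: algebra_simps)
  qed
  have EM: "norm ((quad z ^^ j) (mult z m x)) \<le> C2 * norm x" for j m x
  proof -
    have "(2 * C1 * C1 + C1) * norm (mult z m x) \<le> (2 * C1 * C1 + C1) * (C1 * norm x)"
      using C1 by (intro mult_left_mono M) auto
    with E[of j "mult z m x"] show ?thesis by (simp add: C2_def mult.assoc)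
  qed
  have "norm ((tp z z ^^ n) ((quad z ^^ j) (mult z m x))) \<le> C2 * norm x" for n j m x
  proof (induction n arbitrary: j m)
    case 0
    show ?case using EM by simp
  next
    case (Suc n)
    show ?case
    proof (cases m)
      case 0
      have "tp z z ((quad z ^^ j) x) = (quad z ^^ j) (mult z (Suc 0) x)" by (simp add: square_quad_pow mult_Suc)
      with 0 Suc[of j "Suc 0"] show ?thesis by (simp add: funpow_swap1)
    next
      case (Suc k)
      let ?a = "(quad z ^^ j) (mult z (Suc (Suc k)) x)" and ?b = "(quad z ^^ Suc j) (mult z k x)"
      have "2 *\<^sub>R tp z z ((quad z ^^ j) (mult z m x)) = ?a + ?b"
      proof -
        have "2 *\<^sub>R tp z z ((quad z ^^ j) (mult z m x)) = (quad z ^^ j) (2 *\<^sub>R tp z z (mult z m x))"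
          by (simp only: square_quad_pow linear_scale[OF linear_quad_pow])
        also have "\<dots> = ?a + (quad z ^^ j) (quad z (mult z k x))"
          by (simp only: Suc mult_recurrence linear_add[OF linear_quad_pow])
        finally show ?thesis by (simp add: funpow_swap1)
      qed
      then have "tp z z ((quad z ^^ j) (mult z m x)) = (1/2) *\<^sub>R (?a + ?b)"
        by (metis scaleR_half_double scaleR_2)
      then have "(tp z z ^^ Suc n) ((quad z ^^ j) (mult z m x)) =
          (1/2) *\<^sub>R ((tp z z ^^ n) ?a + (tp z z ^^ n) ?b)"
        by (simp only: funpow_Suc_right o_apply linear_add[OF funpow_linear[OF linear3]]
            linear_scale[OF funpow_linear[OF linear3]])
      then have "norm ((tp z z ^^ Suc n) ((quad z ^^ j) (mult z m x))) \<le>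
          (1/2) * (norm ((tp z z ^^ n) ?a) + norm ((tp z z ^^ n) ?b))"
        using norm_triangle_ineq[of "(tp z z ^^ n) ?a" "(tp z z ^^ n) ?b"] by simp
      moreover have "norm ((tp z z ^^ n) ?a) \<le> C2 * norm x" "norm ((tp z z ^^ n) ?b) \<le> C2 * norm x"
        using Suc.IH by blast+
      moreover have "a \<le> d" if "a \<le> (1/2) * (b + c)" "b \<le> d" "c \<le> d" for a b c d :: real
        using that by (simp add: field_simps)
      ultimately show ?thesis by blast
    qed
  qed
  from this[of _ 0 0] have "norm ((tp z z ^^ n) x) \<le> C2 * norm x" for n x by simp
  then have "numbound (tp z z) 1" by (rule power_bounded_numbound[OF square_herm])
  then have "(norm z)\<^sup>2 \<le> 1" by (rule norm_le_numbound) simp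
  then show ?thesis by (simp add: power2_le_iff_abs_le abs_le_square_iff[of "norm z" 1, simplified, symmetric])
qed

end

section \<open>Symmetric contractions for a positive form\<close>

lemma quadratic_nonneg_discriminant:
  fixes a b c :: real
  assumes "\<And>t. 0 \<le> a + 2 * t * b + t\<^sup>2 * c"
  shows "b\<^sup>2 \<le> a * c"
proof (cases "c = 0")
  case True
  have "b = 0"
  proof (rule ccontr)
    assume "b \<noteq> 0"
    with True assms[of "- (a + 1) / (2 * b)"] show False by (simp add: field_simps)
  qed
  with True show ?thesis by simp
next
  case False
  have "0 < c"
  proof (rule ccontr)
    assume "\<not> 0 < c"
    with False have c: "c < 0" by simp
    define t where "t = (\<bar>a\<bar> + 2 * \<bar>b\<bar> + 1) / (- c) + 1"
    have t1: "1 \<le> t" using c by (simp add: t_def divide_nonneg_neg)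
    have "t * c = - (\<bar>a\<bar> + 2 * \<bar>b\<bar> + 1) + c" using c by (simp add: t_def field_simps)
    then have "t * (t * c) \<le> t * (- (\<bar>a\<bar> + 2 * \<bar>b\<bar> + 1))" using t1 c by (intro mult_left_mono) auto
    then have "t\<^sup>2 * c \<le> - t * \<bar>a\<bar> - 2 * t * \<bar>b\<bar> - t" by (simp add: power2_eq_square algebra_simps)
    moreover have "1 * \<bar>a\<bar> \<le> t * \<bar>a\<bar>" using t1 by (intro mult_right_mono) auto
    moreover have "t * b \<le> t * \<bar>b\<bar>" using t1 by (intro mult_left_mono) auto
    ultimately show False using assms[of t] t1 by (simp add: mult.assoc)
  qed
  have "0 \<le> a + 2 * (- b / c) * b + (- b / c)\<^sup>2 * c" by (rule assms)
  also have "\<dots> = (a * c - b\<^sup>2) / c" using \<open>0 < c\<close> by (simp add: field_simps power2_eq_square)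
  finally show ?thesis using \<open>0 < c\<close> by (simp add: zero_le_divide_iff)
qed

locale psd_form =
  fixes b :: "'a::real_vector \<Rightarrow> 'a \<Rightarrow> real"
  assumes add_left: "b (x + y) z = b x z + b y z"
    and scale_left: "b (r *\<^sub>R x) z = r * b x z"
    and sym: "b x y = b y x"
    and nonneg: "0 \<le> b x x"
begin

lemma add_right: "b z (x + y) = b z x + b z y"
  by (metis add_left sym)

lemma scale_right: "b z (r *\<^sub>R x) = r * b z x"
  by (metis scale_left sym)

lemma diff_left: "b (x - y) z = b x z - b y z"
  using add_left[of "x - y" y z] by simp

lemma diff_right: "b z (x - y) = b z x - b z y"
  by (metis diff_left sym)

lemma cauchy_schwarz: "(b x y)\<^sup>2 \<le> b x x * b y y"
proof (rule quadratic_nonneg_discriminant)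
  fix t
  have "b (x + t *\<^sub>R y) (x + t *\<^sub>R y) = b x x + 2 * t * b x y + t\<^sup>2 * b y y"
    by (simp add: add_left add_right scale_left scale_right sym[of y x] power2_eq_square algebra_simps)
  with nonneg[of "x + t *\<^sub>R y"] show "0 \<le> b x x + 2 * t * b x y + t\<^sup>2 * b y y" by simp
qed

text \<open>For a symmetric operator the numbers \<open>b (U\<^sup>k p) (U\<^sup>k p)\<close> are log-convex in \<open>k\<close>, so they decrease as soon
  as they are bounded. A bound that has nothing to do with \<open>b\<close> thus turns into the sharp one.\<close>

lemma symmetric_contraction:
  assumes W: "\<And>p. p \<in> W \<Longrightarrow> U p \<in> W"
    and U: "\<And>p q. p \<in> W \<Longrightarrow> q \<in> W \<Longrightarrow> b (U p) q = b p (U q)"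
    and bd: "\<And>n. b ((U ^^ n) p) ((U ^^ n) p) \<le> C"
    and p: "p \<in> W"
  shows "b (U p) p \<le> b p p"
proof -
  define m where "m k = b ((U ^^ k) p) ((U ^^ k) p)" for k
  have pW: "(U ^^ k) p \<in> W" for k by (induction k) (auto simp: p W)
  have m0: "0 \<le> m k" for k by (simp add: m_def nonneg)
  have lc: "(m (Suc k))\<^sup>2 \<le> m k * m (Suc (Suc k))" for k
  proof -
    have "m (Suc k) = b ((U ^^ k) p) ((U ^^ Suc (Suc k)) p)"
      using U[OF pW[of k] pW[of "Suc k"]] by (simp add: m_def)
    then show ?thesis using cauchy_schwarz[of "(U ^^ k) p" "(U ^^ Suc (Suc k)) p"] by (simp only: m_def)
  qed
  have "m 1 \<le> m 0"
  proof (rule ccontr)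
    assume "\<not> m 1 \<le> m 0"
    then have gt: "m 0 < m 1" by simp
    then have m1: "0 < m 1" using m0[of 0] by linarith
    have m00: "0 < m 0"
    proof (rule ccontr)
      assume "\<not> 0 < m 0"
      then have "m 0 = 0" using m0[of 0] by simp
      with lc[of 0] m1 show False by simp
    qed
    define r where "r = m 1 / m 0"
    have r: "1 < r" using gt m00 by (simp add: r_def)
    have ratio: "r * m k \<le> m (Suc k) \<and> 0 < m k" for k
    proof (induction k)
      case 0
      show ?case using m00 by (simp add: r_def)
    next
      case (Suc k)
      have pos: "0 < m (Suc k)" using Suc r by (smt (verit) mult_pos_pos)
      have "m (Suc k) * m (Suc k) \<le> m k * m (Suc (Suc k))" using lc[of k] by (simp add: power2_eq_square)
      moreover have "r * m k * m (Suc k) \<le> m (Suc k) * m (Suc k)" using Suc pos by (intro mult_right_mono) auto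
      ultimately have "m k * (r * m (Suc k)) \<le> m k * m (Suc (Suc k))" by (simp add: algebra_simps)
      with Suc have "r * m (Suc k) \<le> m (Suc (Suc k))" by (simp add: mult_le_cancel_left)
      with pos show ?case by simp
    qed
    have gr: "r ^ k * m 0 \<le> m k" for k
    proof (induction k)
      case (Suc k)
      have "r ^ Suc k * m 0 \<le> r * m k" using mult_left_mono[OF Suc, of r] r by (simp add: mult.assoc)
      with ratio[of k] show ?case by linarith
    qed simp
    obtain k where "C / m 0 < r ^ k" using real_arch_pow[OF r] by blast
    then have "C < r ^ k * m 0" using m00 by (simp add: field_simps)
    with gr[of k] bd[of k] show False by (simp add: m_def)
  qed
  then have "(b (U p) p)\<^sup>2 \<le> (b p p)\<^sup>2"
    using cauchy_schwarz[of "U p" p] mult_right_mono[of "m 1" "m 0" "m 0"] m0[of 0]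
    by (simp add: m_def power2_eq_square)
  then show ?thesis using nonneg[of p] by (rule power2_le_imp_le)
qed

end

section \<open>The norm inequality behind the invariance of the ball\<close>

context jb_triple
begin

text \<open>The symmetrized real part of \<open>(x, y) \<mapsto> \<Psi> {x, y, w}\<close>, of interest when \<open>\<Psi>\<close> supports the ball at \<open>w\<close>: it is
  then positive semidefinite, because \<open>tp x x\<close> has a nonnegative numerical range.\<close>

definition form :: "('z \<Rightarrow> complex) \<Rightarrow> 'z \<Rightarrow> 'z \<Rightarrow> 'z \<Rightarrow> real" where
  "form \<Psi> w x y = (Re (\<Psi> (tp x y w)) + Re (\<Psi> (tp y x w))) / 2"

lemma form_square: "form \<Psi> w x x = Re (\<Psi> (tp x x w))"
  by (simp add: form_def)

lemma psd_form_form: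
  assumes "supports \<Psi> w"
  shows "psd_form (form \<Psi> w)"
proof
  have du: "dual_unit \<Psi>" using assms by (simp add: supports_def)
  show "form \<Psi> w (x + y) z = form \<Psi> w x z + form \<Psi> w y z" for x y z
    by (simp add: form_def tp_real_linear dual_unit_add[OF du] field_simps)
  show "form \<Psi> w (r *\<^sub>R x) z = r * form \<Psi> w x z" for r x z
    by (simp add: form_def tp_real_linear dual_unit_scaleR[OF du] field_simps)
  show "form \<Psi> w x y = form \<Psi> w y x" for x y by (simp add: form_def)
  show "0 \<le> form \<Psi> w x x" for x
  proof -
    have "Re (\<Psi> (- tp x x w)) \<le> 0 * norm w"
      using square_nonneg[of x] assms unfolding numbound_def by blast
    then show ?thesis by (simp add: form_square dual_unit_minus[OF du])
  qed
qed

lemma form_le: "supports \<Psi> w \<Longrightarrow> form \<Psi> w x x \<le> (norm x)\<^sup>2 * norm w"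
  using square_numbound[of x] by (simp add: form_square numbound_def)

definition odd_span :: "'z \<Rightarrow> 'z set" where "odd_span z = span (range (pw z))"

lemma pw_in_odd_span: "pw z n \<in> odd_span z"
  by (simp add: odd_span_def span_base)

lemma subspace_odd_span: "subspace (odd_span z)"
  by (simp add: odd_span_def)

lemma linear_in_odd_span:
  assumes "p \<in> odd_span z" "linear L" "\<And>n. L (pw z n) \<in> odd_span z"
  shows "L p \<in> odd_span z"
  using assms(1) unfolding odd_span_def
proof (induction rule: span_induct)
  case base
  have "subspace {x. L x \<in> span (range (pw z))}"
    using linear_subspace_vimage[OF assms(2), of "span (range (pw z))"] by (simp add: vimage_def)
  then show ?case .
qed (use assms(3) in \<open>auto simp: odd_span_def\<close>)

lemma square_in_odd_span: "p \<in> odd_span z \<Longrightarrow> tp z z p \<in> odd_span z"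
  by (rule linear_in_odd_span[OF _ linear3]) (simp_all add: pw_Suc[symmetric] pw_in_odd_span)

lemma odd_span_eq:
  assumes "linear f" "linear g" "\<And>n. f (pw z n) = g (pw z n)" "p \<in> odd_span z"
  shows "f p = g p"
  using linear_eq_on_span[OF assms(1,2), of "range (pw z)"] assms(3,4) by (auto simp: odd_span_def)

lemma tp_odd_span_sym:
  assumes "p \<in> odd_span z" "q \<in> odd_span z"
  shows "tp (tp z z p) q w = tp p (tp z z q) w"
proof (rule odd_span_eq[OF _ _ _ assms(1)])
  show "linear (\<lambda>p. tp (tp z z p) q w)" "linear (\<lambda>p. tp p (tp z z q) w)"
    by (auto intro!: linearI simp: tp_real_linear)
  fix n
  show "tp (tp z z (pw z n)) q w = tp (pw z n) (tp z z q) w"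
  proof (rule odd_span_eq[OF _ _ _ assms(2)])
    show "linear (\<lambda>q. tp (tp z z (pw z n)) q w)" "linear (\<lambda>q. tp (pw z n) (tp z z q) w)"
      by (auto intro!: linearI simp: tp_real_linear)
    fix k
    show "tp (tp z z (pw z n)) (pw z k) w = tp (pw z n) (tp z z (pw z k)) w"
      using tp_pw[of z "Suc n" k] tp_pw[of z n "Suc k"] by (simp add: pw_Suc)
  qed
qed

text \<open>On the span of the odd powers of \<open>z\<close> and for each of the forms above, \<open>tp z z\<close> is symmetric with
  spectrum in \<open>[0, 1]\<close>.\<close>

lemma form_square_sym:
  assumes "p \<in> odd_span z" "q \<in> odd_span z"
  shows "form \<Psi> w (tp z z p) q = form \<Psi> w p (tp z z q)"
  using tp_odd_span_sym[OF assms] tp_odd_span_sym[OF assms(2,1)] by (simp add: form_def)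

lemma form_square_le:
  assumes \<Psi>: "supports \<Psi> w" and z: "norm z \<le> 1" and p: "p \<in> odd_span z"
  shows "form \<Psi> w (tp z z p) p \<le> form \<Psi> w p p"
proof (rule psd_form.symmetric_contraction[OF psd_form_form[OF \<Psi>], where W = "odd_span z"])
  fix n
  have "norm (tp z z x) \<le> 1 * norm x" for x :: 'z
  proof -
    have "(norm z)\<^sup>2 * norm x \<le> 1 * norm x" using z by (intro mult_right_mono) (auto simp: power_le_one)
    with square_norm_le[of z x] show ?thesis by linarith
  qed
  then have "norm ((tp z z ^^ n) p) \<le> 1 ^ n * norm p" by (rule funpow_norm_le) simp
  then have "(norm ((tp z z ^^ n) p))\<^sup>2 * norm w \<le> (norm p)\<^sup>2 * norm w"
    by (intro mult_right_mono power_mono) auto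
  with form_le[OF \<Psi>, of "(tp z z ^^ n) p"]
  show "form \<Psi> w ((tp z z ^^ n) p) ((tp z z ^^ n) p) \<le> (norm p)\<^sup>2 * norm w" by linarith
qed (use p square_in_odd_span form_square_sym in auto)

lemma norm_complement_le:
  assumes z: "norm z \<le> 1"
  shows "norm (x - tp z z x) \<le> 1 * norm x"
proof (rule sinclair)
  have sq: "(norm z)\<^sup>2 \<le> 1" using z by (simp add: power_le_one)
  show "herm (\<lambda>x. x - tp z z x)"
    unfolding herm_def
  proof (intro conjI allI impI)
    show "bounded_clinear_map (\<lambda>x. x - tp z z x)"
    proof (rule bounded_clinear_mapI[where K = 2])
      show "clinear_map (\<lambda>x. x - tp z z x)"
        by (simp add: clinear_map_def tp_real_linear tp_scaleC scaleC.diff_right)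
      fix x :: 'z
      have "(norm z)\<^sup>2 * norm x \<le> 1 * norm x" using sq by (intro mult_right_mono) auto
      then show "norm (x - tp z z x) \<le> 2 * norm x"
        using square_norm_le[of z x] norm_triangle_ineq4[of x "tp z z x"] by linarith
    qed
    fix x \<Psi> assume "supports \<Psi> (x::'z)"
    with square_herm[of z] show "Im (\<Psi> (x - tp z z x)) = 0"
      by (simp add: herm_def supports_def dual_unit_diff)
  qed
  show "numbound (\<lambda>x. x - tp z z x) 1"
    using square_nonneg[of z] unfolding numbound_def
    by (fastforce simp: supports_def dual_unit_diff dual_unit_minus)
  show "numbound (\<lambda>x. - (x - tp z z x)) 1"
    unfolding numbound_def
  proof (intro allI impI)
    fix x \<Psi> assume \<Psi>: "supports \<Psi> (x::'z)"
    have "Re (\<Psi> (tp z z x)) \<le> (norm z)\<^sup>2 * norm x" using square_numbound[of z] \<Psi> by (simp add: numbound_def)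
    also have "\<dots> \<le> 1 * norm x" using sq by (intro mult_right_mono) auto
    finally show "Re (\<Psi> (- (x - tp z z x))) \<le> 1 * norm x"
      using \<Psi> by (simp add: supports_def dual_unit_diff)  (smt (verit) norm_ge_zero)
  qed
qed simp

text \<open>Nonnegativity of \<open>tp z z\<close> is the contraction property of \<open>1 - tp z z\<close>, whose norm is at most one by
  Sinclair's theorem.\<close>

lemma form_square_nonneg:
  assumes \<Psi>: "supports \<Psi> w" and z: "norm z \<le> 1" and p: "p \<in> odd_span z"
  shows "0 \<le> form \<Psi> w (tp z z p) p"
proof -
  interpret psd_form "form \<Psi> w" by (rule psd_form_form[OF \<Psi>])
  define U where "U x = x - tp z z x" for x :: 'z
  have "form \<Psi> w (U p) p \<le> form \<Psi> w p p"
  proof (rule symmetric_contraction[where W = "odd_span z"])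
    fix n
    have "norm (U x) \<le> 1 * norm x" for x unfolding U_def by (rule norm_complement_le[OF z])
    then have "norm ((U ^^ n) p) \<le> 1 ^ n * norm p" by (rule funpow_norm_le) simp
    then have "(norm ((U ^^ n) p))\<^sup>2 * norm w \<le> (norm p)\<^sup>2 * norm w"
      by (intro mult_right_mono power_mono) auto
    with form_le[OF \<Psi>, of "(U ^^ n) p"]
    show "form \<Psi> w ((U ^^ n) p) ((U ^^ n) p) \<le> (norm p)\<^sup>2 * norm w" by linarith
  next
    show "U x \<in> odd_span z" if "x \<in> odd_span z" for x
      using that square_in_odd_span[OF that] subspace_diff[OF subspace_odd_span] by (simp add: U_def)
    show "form \<Psi> w (U x) y = form \<Psi> w x (U y)" if "x \<in> odd_span z" "y \<in> odd_span z" for x y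
      using form_square_sym[OF that] by (simp add: U_def diff_left diff_right)
  qed (rule p)
  then show ?thesis by (simp add: U_def diff_left)
qed

text \<open>One Newton--Schulz step, \<open>\<lambda> \<mapsto> (3\<lambda> - \<lambda>\<^sup>3)/2\<close>, maps \<open>[0, 1]\<close> into itself and the closed unit ball into
  itself. With \<open>P\<close> the result, \<open>tp P P\<close> acts on the odd powers of \<open>z\<close> as \<open>S = T (3 - T)\<^sup>2 / 4\<close>, where
  \<open>1 - S = (3 (1 - T)\<^sup>2 + (1 - T)\<^sup>3) / 4\<close>; so \<open>0 \<le> S \<le> 1\<close> for each form, the powers of \<open>P\<close> stay bounded,
  and the spectral radius formula applies.\<close>

lemma newton_step_norm_le:
  assumes z: "norm z \<le> 1"
  shows "norm ((1/2) *\<^sub>R (3 *\<^sub>R z - tp z z z)) \<le> 1"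
proof -
  define T where "T = tp z z"
  define h where "h x = (1/2) *\<^sub>R (3 *\<^sub>R x - T x)" for x
  define S where "S x = T (h (h x))" for x
  define u where "u x = x - T x" for x
  define P where "P = h z"
  have lT: "linear T" unfolding T_def by (rule linear3)
  have lin: "T (x + y) = T x + T y" "T (x - y) = T x - T y" "T (r *\<^sub>R x) = r *\<^sub>R T x" for x y r
    using lT by (auto simp: linear_add linear_diff linear_scale)
  have lh: "linear h"
    by (rule linearI) (simp_all add: h_def lin algebra_simps)
  have lS: "linear S"
    by (rule linearI) (simp_all add: S_def linear_add[OF lh] linear_scale[OF lh] lin)
  have TW: "T x \<in> odd_span z" if "x \<in> odd_span z" for x using square_in_odd_span[OF that] by (simp add: T_def)
  have hW: "h x \<in> odd_span z" if "x \<in> odd_span z" for x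
    unfolding h_def by (intro subspace_scale subspace_diff subspace_odd_span TW that)
  have SW: "S x \<in> odd_span z" if "x \<in> odd_span z" for x unfolding S_def by (intro TW hW that)
  have uW: "u x \<in> odd_span z" if "x \<in> odd_span z" for x
    unfolding u_def by (intro subspace_diff subspace_odd_span TW that)
  have zW: "z \<in> odd_span z" using pw_in_odd_span[of z 0] by simp
  have Spow: "(S ^^ n) P \<in> odd_span z" for n by (induction n) (auto simp: P_def intro: SW hW zW)
  have PPS: "tp P P q = S q" if "q \<in> odd_span z" for q
  proof (rule odd_span_eq[OF linear3 lS _ that])
    fix k
    have "tp P P (pw z k) = (1/4) *\<^sub>R (9 *\<^sub>R tp z z (pw z k) - 3 *\<^sub>R tp (tp z z z) z (pw z k)
        - 3 *\<^sub>R tp z (tp z z z) (pw z k) + tp (tp z z z) (tp z z z) (pw z k))"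
      by (simp add: P_def h_def T_def tp_real_linear algebra_simps)
    also have "tp (tp z z z) z (pw z k) = pw z (Suc (Suc k))"
      using tp_pw_pw[of z 1 k] by (simp add: pw_Suc)
    also have "tp z (tp z z z) (pw z k) = pw z (Suc (Suc k))"
      using tp_pw_pw[of z 1 k] tp_pw_left[of z 1] by (simp add: pw_Suc)
    also have "tp (tp z z z) (tp z z z) (pw z k) = pw z (Suc (Suc (Suc k)))"
      using tp_pw[of z 1 1] tp_pw_pw[of z 2 k] by (simp add: pw_Suc numeral_2_eq_2)
    finally have 1: "tp P P (pw z k) = (1/4) *\<^sub>R (9 *\<^sub>R pw z (Suc k) - 6 *\<^sub>R pw z (Suc (Suc k)) + pw z (Suc (Suc (Suc k))))"
      using scaleR_add_left[of 3 3 "pw z (Suc (Suc k))"] by (simp add: pw_Suc algebra_simps)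
    have "S (pw z k) = (1/4) *\<^sub>R (9 *\<^sub>R T (pw z k) - 6 *\<^sub>R T (T (pw z k)) + T (T (T (pw z k))))"
      using scaleR_add_left[of "3/4" "3/4" "T (T (pw z k))"] by (simp add: S_def h_def lin algebra_simps)
    with 1 show "tp P P (pw z k) = S (pw z k)" by (simp add: pw_Suc T_def)
  qed
  have pwP: "pw P n = (S ^^ n) P" for n
  proof (induction n)
    case (Suc n)
    then show ?case using PPS[OF Spow[of n]] by (simp add: pw_Suc)
  qed simp
  have "norm (pw P n) \<le> norm P" for n
  proof -
    have "numbound (tp (pw P n) (pw P n)) ((norm P)\<^sup>2)"
      unfolding numbound_def
    proof (intro allI impI)
      fix w \<Psi> assume \<Psi>: "supports \<Psi> (w::'z)"
      interpret psd_form "form \<Psi> w" by (rule psd_form_form[OF \<Psi>])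
      let ?b = "form \<Psi> w"
      have Ts: "?b (T x) y = ?b x (T y)" if "x \<in> odd_span z" "y \<in> odd_span z" for x y
        using form_square_sym[OF that] by (simp add: T_def)
      have hs: "?b (h x) y = ?b x (h y)" if "x \<in> odd_span z" "y \<in> odd_span z" for x y
        using Ts[OF that] by (simp add: h_def scale_left scale_right diff_left diff_right)
      have Ss: "?b (S x) y = ?b x (S y)" if "x \<in> odd_span z" "y \<in> odd_span z" for x y
      proof -
        have Th: "T (h x) = h (T x)" for x by (simp add: h_def lin)
        show ?thesis using that by (simp add: S_def Ts hs hW TW Th)
      qed
      have us: "?b (u x) y = ?b x (u y)" if "x \<in> odd_span z" "y \<in> odd_span z" for x y
        using Ts[OF that] by (simp add: u_def diff_left diff_right)
      have S0: "0 \<le> ?b (S x) x" if "x \<in> odd_span z" for x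
      proof -
        have "?b (S x) x = ?b (T (h x)) (h x)"
        proof -
          have Th: "T (h y) = h (T y)" for y by (simp add: h_def lin)
          show ?thesis using hs[OF TW[OF hW[OF that]] that] by (simp add: S_def Th)
        qed
        also have "0 \<le> \<dots>" using form_square_nonneg[OF \<Psi> z hW[OF that]] by (simp add: T_def)
        finally show ?thesis .
      qed
      have S1: "?b (S x) x \<le> ?b x x" if x: "x \<in> odd_span z" for x
      proof -
        have u0: "0 \<le> ?b (u y) y" if "y \<in> odd_span z" for y
          using form_square_le[OF \<Psi> z that] by (simp add: u_def diff_left T_def)
        have "x - S x = (3/4) *\<^sub>R u (u x) + (1/4) *\<^sub>R u (u (u x))"
        proof -
          have e1: "4 *\<^sub>R S x = 9 *\<^sub>R T x - 6 *\<^sub>R T (T x) + T (T (T x))"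
            using scaleR_add_left[of 3 3 "T (T x)"] by (simp add: S_def h_def lin algebra_simps)
          have e2: "3 *\<^sub>R u (u x) + u (u (u x)) = 4 *\<^sub>R x - (9 *\<^sub>R T x - 6 *\<^sub>R T (T x) + T (T (T x)))"
            using scaleR_add_left[of 3 1 x] scaleR_add_left[of 6 1 "T x"] scaleR_add_left[of 7 1 "T x"]
              scaleR_add_left[of 8 1 "T x"] scaleR_add_left[of 3 1 "T (T x)"] scaleR_add_left[of 4 1 "T (T x)"]
              scaleR_add_left[of 5 1 "T (T x)"] scaleR_add_left[of 3 3 "T x"]
            by (simp add: u_def lin algebra_simps)
          have "4 *\<^sub>R (x - S x) = 3 *\<^sub>R u (u x) + u (u (u x))" by (simp only: e1 e2 scaleR_diff_right)
          then have "(1/4) *\<^sub>R (4 *\<^sub>R (x - S x)) = (1/4) *\<^sub>R (3 *\<^sub>R u (u x) + u (u (u x)))" by simp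
          then show ?thesis by (simp add: scaleR_add_right)
        qed
        then have "?b (x - S x) x = (3/4) * ?b (u (u x)) x + (1/4) * ?b (u (u (u x))) x"
          by (simp add: add_left scale_left)
        also have "?b (u (u x)) x = ?b (u x) (u x)" using us[OF uW[OF x] x] .
        also have "?b (u (u (u x))) x = ?b (u (u x)) (u x)" using us[OF uW[OF uW[OF x]] x] .
        finally have "0 \<le> ?b (x - S x) x" using nonneg[of "u x"] u0[OF uW[OF x]] by simp
        then show ?thesis by (simp add: diff_left)
      qed
      have SS: "?b (S x) (S x) \<le> ?b x x" if x: "x \<in> odd_span z" for x
      proof -
        have "(?b (S x) (S x))\<^sup>2 \<le> ?b (S x) x * ?b (S (S x)) (S x)"
        proof (rule quadratic_nonneg_discriminant)
          fix t
          have "x + t *\<^sub>R S x \<in> odd_span z" by (intro subspace_add subspace_scale subspace_odd_span x SW)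
          from S0[OF this] have "0 \<le> ?b (S x + t *\<^sub>R S (S x)) (x + t *\<^sub>R S x)"
            by (simp add: linear_add[OF lS] linear_scale[OF lS])
          also have "\<dots> = ?b (S x) x + 2 * t * ?b (S x) (S x) + t\<^sup>2 * ?b (S (S x)) (S x)"
            using Ss[OF SW[OF x] x]
            by (simp add: add_left add_right scale_left scale_right power2_eq_square algebra_simps)
          finally show "0 \<le> ?b (S x) x + 2 * t * ?b (S x) (S x) + t\<^sup>2 * ?b (S (S x)) (S x)" .
        qed
        also have "\<dots> \<le> ?b x x * ?b (S x) (S x)"
          using S0[OF x] S1[OF x] S0[OF SW[OF x]] S1[OF SW[OF x]] nonneg[of x] by (intro mult_mono) auto
        finally have "?b (S x) (S x) * ?b (S x) (S x) \<le> ?b x x * ?b (S x) (S x)" by (simp add: power2_eq_square)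
        then show ?thesis using nonneg[of "S x"] nonneg[of x]
          by (cases "?b (S x) (S x) = 0") (auto simp: mult_le_cancel_right)
      qed
      have "?b ((S ^^ n) P) ((S ^^ n) P) \<le> ?b P P"
      proof (induction n)
        case (Suc n)
        then show ?case using SS[OF Spow[of n]] by simp
      qed simp
      also have "\<dots> \<le> (norm P)\<^sup>2 * norm w" by (rule form_le[OF \<Psi>])
      finally show "Re (\<Psi> (tp (pw P n) (pw P n) w)) \<le> (norm P)\<^sup>2 * norm w"
        by (simp add: pwP form_square)
    qed
    then have "(norm (pw P n))\<^sup>2 \<le> (norm P)\<^sup>2" by (rule norm_le_numbound) simp
    then show ?thesis by (rule power2_le_imp_le) simp
  qed
  then have "norm P \<le> 1" by (rule norm_le_1_of_bounded_powers)
  then show ?thesis by (simp add: P_def h_def T_def)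
qed

text \<open>The Newton--Schulz step is \<open>z + y/2\<close> with \<open>y = z - {z, z, z}\<close>; expand the form at this point and note that
  the mixed term is nonnegative.\<close>

lemma form_defect_le:
  assumes \<Psi>: "supports \<Psi> w" and z: "norm z \<le> 1"
  shows "form \<Psi> w (z - tp z z z) (z - tp z z z) \<le> 4 * (norm w - form \<Psi> w z z)"
proof -
  interpret psd_form "form \<Psi> w" by (rule psd_form_form[OF \<Psi>])
  define y where "y = z - tp z z z"
  define P where "P = (1/2) *\<^sub>R (3 *\<^sub>R z - tp z z z)"
  have zW: "z \<in> odd_span z" using pw_in_odd_span[of z 0] by simp
  have "P = z + (1/2) *\<^sub>R y"
    using scaleR_add_left[of "1/2" 1 z] by (simp add: P_def y_def algebra_simps)
  then have "form \<Psi> w P P = form \<Psi> w z z + form \<Psi> w z y + form \<Psi> w y y / 4"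
    by (simp add: add_left add_right scale_left scale_right sym[of y z] field_simps)
  moreover have "(norm P)\<^sup>2 * norm w \<le> 1 * norm w"
    using newton_step_norm_le[OF z] by (intro mult_right_mono) (auto simp: P_def power_le_one)
  then have "form \<Psi> w P P \<le> norm w" using form_le[OF \<Psi>, of P] by linarith
  moreover have "0 \<le> form \<Psi> w z y"
    using form_square_le[OF \<Psi> z zW] by (simp add: y_def diff_right sym[of z "tp z z z"])
  ultimately show ?thesis by (simp add: y_def)
qed

text \<open>Towards the invariance of the ball under \<open>z' = a - {z a z}\<close>. Modulo the infinitesimal isometry
  \<open>2 (tp a z - tp z a)\<close>, the vector \<open>a - {z a z}\<close> may be replaced by \<open>v = a + {z a z} - 2 {z z a}\<close>, for which
  \<open>tp v z + tp z v\<close> only involves \<open>a\<close> and the defect \<open>z - {z z z}\<close>.\<close>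

lemma tangent_identity:
  defines "v \<equiv> \<lambda>a z. a + tp z a z - 2 *\<^sub>R tp z z a"
  shows "tp (v a z) z x + tp z (v a z) x = tp (z - tp z z z) a x + tp a (z - tp z z z) x"
proof -
  have azz: "tp a z z = tp z z a" by (rule tp_commute)
  have A: "tp z z (tp z a x) = tp (tp z z z) a x - tp z (tp z z a) x + tp z a (tp z z x)" by (rule jordan)
  have B: "tp z a (tp z z x) = tp (tp z a z) z x - tp z (tp z z a) x + tp z z (tp z a x)"
    using jordan[of z a z z x] by (simp add: azz)
  have C: "tp z z (tp a z x) = tp (tp z z a) z x - tp a (tp z z z) x + tp a z (tp z z x)" by (rule jordan)
  have D: "tp a z (tp z z x) = tp (tp z z a) z x - tp z (tp z a z) x + tp z z (tp a z x)"
    using jordan[of a z z z x] by (simp add: azz)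
  from A B have 1: "tp (tp z a z) z x = 2 *\<^sub>R tp z (tp z z a) x - tp (tp z z z) a x" by (simp add: scaleR_2 algebra_simps)
  from C D have 2: "tp z (tp z a z) x = 2 *\<^sub>R tp (tp z z a) z x - tp a (tp z z z) x" by (simp add: scaleR_2 algebra_simps)
  show ?thesis by (simp add: v_def tp_real_linear 1 2)
qed

lemma tangent_norm_le:
  fixes a z :: 'z
  assumes z: "norm z \<le> 1"
  defines "v \<equiv> a + tp z a z - 2 *\<^sub>R tp z z a"
  shows "(norm (z + t *\<^sub>R v))\<^sup>2 \<le> 1 + t\<^sup>2 * (4 * (norm a)\<^sup>2 + (norm v)\<^sup>2)"
proof (rule norm_le_numbound)
  show "numbound (tp (z + t *\<^sub>R v) (z + t *\<^sub>R v)) (1 + t\<^sup>2 * (4 * (norm a)\<^sup>2 + (norm v)\<^sup>2))"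
    unfolding numbound_def
  proof (intro allI impI)
    fix w \<Psi> assume \<Psi>: "supports \<Psi> (w::'z)"
    interpret psd_form "form \<Psi> w" by (rule psd_form_form[OF \<Psi>])
    let ?b = "form \<Psi> w"
    define y where "y = z - tp z z z"
    have du: "dual_unit \<Psi>" using \<Psi> by (simp add: supports_def)
    have "?b z v = ?b y a"
      using tangent_identity[of a z w] 
      by (simp add: form_def v_def[symmetric] y_def[symmetric] dual_unit_add[OF du, symmetric]
          plus_complex.simps(1)[symmetric] add.commute del: plus_complex.simps)
    have sq: "?b (z + t *\<^sub>R v) (z + t *\<^sub>R v) = ?b z z + 2 * t * ?b y a + t\<^sup>2 * ?b v v"
      using \<open>?b z v = ?b y a\<close>
      by (simp add: add_left add_right scale_left scale_right sym[of v z] power2_eq_square algebra_simps)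
    have "0 \<le> ?b ((1/2) *\<^sub>R y - (2 * t) *\<^sub>R a) ((1/2) *\<^sub>R y - (2 * t) *\<^sub>R a)" by (rule nonneg)
    then have 1: "2 * t * ?b y a \<le> ?b y y / 4 + 4 * (t\<^sup>2 * ?b a a)"
      by (simp add: diff_left diff_right scale_left scale_right sym[of a y] power2_eq_square algebra_simps)
    have 2: "?b y y \<le> 4 * (norm w - ?b z z)" unfolding y_def by (rule form_defect_le[OF \<Psi> z])
    have 3: "t\<^sup>2 * ?b a a \<le> t\<^sup>2 * ((norm a)\<^sup>2 * norm w)" "t\<^sup>2 * ?b v v \<le> t\<^sup>2 * ((norm v)\<^sup>2 * norm w)"
      by (intro mult_left_mono form_le[OF \<Psi>]; simp)+
    have arith: "Z + D + V \<le> N + 4 * A' + V'"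
      if "D \<le> Y / 4 + 4 * A" "Y \<le> 4 * (N - Z)" "A \<le> A'" "V \<le> V'" for Z D V N A A' V' Y :: real
      using that by argo
    have "?b (z + t *\<^sub>R v) (z + t *\<^sub>R v) \<le> norm w + 4 * (t\<^sup>2 * ((norm a)\<^sup>2 * norm w)) + t\<^sup>2 * ((norm v)\<^sup>2 * norm w)"
      unfolding sq by (rule arith[OF 1 2 3])
    then show "Re (\<Psi> (tp (z + t *\<^sub>R v) (z + t *\<^sub>R v) w)) \<le> (1 + t\<^sup>2 * (4 * (norm a)\<^sup>2 + (norm v)\<^sup>2)) * norm w"
      by (simp add: form_square algebra_simps)
  qed
qed simp

text \<open>\<open>tp a z - tp z a\<close> is \<open>i\<close> times a Hermitian operator, so its numerical range is imaginary and a short step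
  along it changes norms only to second order.\<close>

lemma skew_step_le:
  fixes a z :: 'z
  assumes "0 \<le> t"
  defines "A \<equiv> \<lambda>x. 2 *\<^sub>R (tp a z x - tp z a x)"
  shows "norm (y + t *\<^sub>R A y) \<le> norm y + t\<^sup>2 * norm (A (A y))"
proof -
  have "numbound A 0"
    unfolding numbound_def
  proof (intro allI impI)
    fix w \<Psi> assume \<Psi>: "supports \<Psi> (w::'z)"
    then have du: "dual_unit \<Psi>" by (simp add: supports_def)
    have "Im (\<Psi> (tp x x w)) = 0" for x using square_herm[of x] \<Psi> by (simp add: herm_def)
    from this[of "a + \<i> *\<^sub>C z"] this[of a] this[of z] have "Re (\<Psi> (tp z a w)) = Re (\<Psi> (tp a z w))"
      by (simp add: tp_real_linear tp_scaleC scaleC.minus_left dual_unit_simps[OF du])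
    then show "Re (\<Psi> (A w)) \<le> 0 * norm w" by (simp add: A_def dual_unit_simps[OF du])
  qed
  from numbound_lower[OF this assms(1), of "y + t *\<^sub>R A y"]
  have "norm (y + t *\<^sub>R A y) \<le> norm ((y + t *\<^sub>R A y) - t *\<^sub>R A (y + t *\<^sub>R A y))" by simp
  also have "(y + t *\<^sub>R A y) - t *\<^sub>R A (y + t *\<^sub>R A y) = y - t\<^sup>2 *\<^sub>R A (A y)"
    by (simp add: A_def tp_real_linear power2_eq_square algebra_simps)
  also have "norm \<dots> \<le> norm y + t\<^sup>2 * norm (A (A y))"
    using norm_triangle_ineq4[of y "t\<^sup>2 *\<^sub>R A (A y)"] by simp
  finally show ?thesis .
qed

text \<open>Up to second order, a step along the vector field \<open>a - {z a z}\<close> does not leave the closed ball. The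
  constants are generous; what matters is that they depend on \<open>R\<close> alone.\<close>

lemma field_step_le:
  assumes z: "norm z \<le> 1" and a: "norm a \<le> R" and t: "0 \<le> t" "t \<le> 1"
  shows "norm (z + t *\<^sub>R (a - tp z a z)) \<le> 1 + (1000 * R\<^sup>2 + 100000 * R ^ 4) * t\<^sup>2"
proof -
  define v where "v = a + tp z a z - 2 *\<^sub>R tp z z a"
  define A where "A x = 2 *\<^sub>R (tp a z x - tp z a x)" for x
  have R: "0 \<le> R" using a norm_ge_zero order_trans by blast
  have tri: "norm (tp x y w) \<le> 4 * R * norm w'" if "norm x * norm y * norm w \<le> R * norm w'" for x y w w'
    using tp_norm_le[of x y w] that by linarith
  have zz: "norm z * norm z \<le> 1" using z by (simp add: mult_le_one)
  have b1: "norm (tp z a z) \<le> 4 * R"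
  proof -
    have "norm z * norm a * norm z = norm a * (norm z * norm z)" by simp
    also have "\<dots> \<le> R * 1" using a zz R by (intro mult_mono) auto
    finally show ?thesis using tp_norm_le[of z a z] by linarith
  qed
  have b2: "norm (tp z z a) \<le> 4 * R"
  proof -
    have "norm z * norm z * norm a \<le> 1 * R" using a zz R by (intro mult_mono) auto
    then show ?thesis using tp_norm_le[of z z a] by linarith
  qed
  have v: "norm v \<le> 13 * R"
  proof -
    have "norm v \<le> norm (a + tp z a z) + norm (2 *\<^sub>R tp z z a)" unfolding v_def by (rule norm_triangle_ineq4)
    moreover have "norm (a + tp z a z) \<le> norm a + norm (tp z a z)" by (rule norm_triangle_ineq)
    ultimately show ?thesis using b1 b2 a by simp
  qed
  have Ab: "norm (A x) \<le> 16 * R * norm x" for x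
  proof -
    have "norm a * norm z * norm x \<le> R * norm x"
    proof -
      have "norm a * norm z \<le> R * 1" using a z R by (intro mult_mono) auto
      then show ?thesis by (intro mult_right_mono) auto
    qed
    then have "norm (tp a z x) \<le> 4 * R * norm x" "norm (tp z a x) \<le> 4 * R * norm x"
      using tp_norm_le[of a z x] tp_norm_le[of z a x] by (simp_all add: mult.commute mult.left_commute)
    then show ?thesis using norm_triangle_ineq4[of "tp a z x" "tp z a x"] by (simp add: A_def)
  qed
  define y where "y = z + t *\<^sub>R v"
  have t2: "t\<^sup>2 \<le> 1" using t by (simp add: power_le_one)
  have "(norm y)\<^sup>2 \<le> 1 + t\<^sup>2 * (4 * (norm a)\<^sup>2 + (norm v)\<^sup>2)"
    unfolding y_def v_def by (rule tangent_norm_le[OF z])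
  also have "\<dots> \<le> 1 + t\<^sup>2 * (4 * R\<^sup>2 + (13 * R)\<^sup>2)"
    using a v R by (intro add_left_mono mult_left_mono add_mono power_mono) auto
  also have "\<dots> = 1 + 173 * R\<^sup>2 * t\<^sup>2" by (simp add: power_mult_distrib algebra_simps)
  also have "\<dots> \<le> (1 + 173 * R\<^sup>2 * t\<^sup>2)\<^sup>2"
    by (rule self_le_power) auto
  finally have yn: "norm y \<le> 1 + 173 * R\<^sup>2 * t\<^sup>2" by (rule power2_le_imp_le) simp
  have "z + t *\<^sub>R (a - tp z a z) = (y + t *\<^sub>R A y) - t\<^sup>2 *\<^sub>R A v"
  proof -
    have "v + A z = a - tp z a z"
      using tp_commute[of a z z] by (simp add: v_def A_def scaleR_2 algebra_simps)
    moreover have "A y = A z + t *\<^sub>R A v" by (simp add: A_def y_def tp_real_linear algebra_simps)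
    then have "(y + t *\<^sub>R A y) - t\<^sup>2 *\<^sub>R A v = z + t *\<^sub>R (v + A z)"
      by (simp add: y_def power2_eq_square algebra_simps)
    ultimately show ?thesis by simp
  qed
  then have "norm (z + t *\<^sub>R (a - tp z a z)) \<le> norm (y + t *\<^sub>R A y) + t\<^sup>2 * norm (A v)"
    using norm_triangle_ineq4[of "y + t *\<^sub>R A y" "t\<^sup>2 *\<^sub>R A v"] by simp
  moreover have "norm (y + t *\<^sub>R A y) \<le> norm y + t\<^sup>2 * norm (A (A y))"
    unfolding A_def by (rule skew_step_le[OF t(1)])
  moreover have "norm (A (A y)) \<le> 256 * R\<^sup>2 + 44288 * R ^ 4"
  proof -
    have "norm (A (A y)) \<le> 16 * R * (16 * R * norm y)"
      using Ab[of "A y"] mult_left_mono[OF Ab[of y], of "16 * R"] R by linarith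
    also have "\<dots> = 256 * R\<^sup>2 * norm y" by (simp add: power2_eq_square)
    also have "\<dots> \<le> 256 * R\<^sup>2 * (1 + 173 * R\<^sup>2 * 1)"
      using yn t2 mult_left_mono[OF t2, of "173 * R\<^sup>2"] by (intro mult_left_mono) auto
    also have "\<dots> = 256 * R\<^sup>2 + 44288 * R ^ 4" by (simp add: algebra_simps power_numeral_reduce)
    finally show ?thesis .
  qed
  then have "t\<^sup>2 * norm (A (A y)) \<le> t\<^sup>2 * (256 * R\<^sup>2 + 44288 * R ^ 4)" by (intro mult_left_mono) auto
  moreover have "norm (A v) \<le> 208 * R\<^sup>2"
    using Ab[of v] mult_left_mono[OF v, of "16 * R"] R by (simp add: power2_eq_square)
  then have "t\<^sup>2 * norm (A v) \<le> t\<^sup>2 * (208 * R\<^sup>2)" by (intro mult_left_mono) auto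
  ultimately have "norm (z + t *\<^sub>R (a - tp z a z)) \<le> 1 + 173 * R\<^sup>2 * t\<^sup>2 + t\<^sup>2 * (256 * R\<^sup>2 + 44288 * R ^ 4) + t\<^sup>2 * (208 * R\<^sup>2)"
    using yn by linarith
  also have "\<dots> = 1 + (637 * R\<^sup>2 + 44288 * R ^ 4) * t\<^sup>2" by (simp add: algebra_simps)
  also have "\<dots> \<le> 1 + (1000 * R\<^sup>2 + 100000 * R ^ 4) * t\<^sup>2"
    using R by (intro add_left_mono mult_right_mono add_mono) auto
  finally show ?thesis .
qed

end

section \<open>Lipschitz differential equations in Banach spaces\<close>

lemma vector_derivative_bound:
  fixes e :: "real \<Rightarrow> 'a::real_normed_vector"
  assumes uv: "u \<le> v" "{u..v} \<subseteq> {0..1}"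
    and e: "\<And>s. s \<in> {0..1} \<Longrightarrow> (e has_vector_derivative e' s) (at s within {0..1})"
    and \<phi>: "\<And>s. (\<phi> has_real_derivative \<phi>' s) (at s)"
    and le: "\<And>s. s \<in> {u..v} \<Longrightarrow> norm (e' s) \<le> \<phi>' s"
  shows "norm (e v - e u) \<le> \<phi> v - \<phi> u"
proof (cases "u = v")
  case False
  with uv have "u < v" by simp
  then show ?thesis
  proof (rule differentiable_bound_general)
    show "continuous_on {u..v} e"
      using e has_vector_derivative_continuous continuous_on_eq_continuous_within
      by (metis continuous_on_subset uv(2))
    show "continuous_on {u..v} \<phi>" using \<phi> by (meson DERIV_continuous_on has_field_derivative_at_within)
    fix s assume s: "u < s" "s < v"
    then have "s \<in> {u..v}" by simp
    with uv have "s \<in> {0..1}" "u \<in> {0..1}" "v \<in> {0..1}" by auto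
    with s have "at s within {0..1} = at s" by (intro at_within_Icc_at) auto
    with e[OF \<open>s \<in> {0..1}\<close>] show "(e has_vector_derivative e' s) (at s)" by simp
    show "(\<phi> has_vector_derivative \<phi>' s) (at s)"
      using \<phi> by (simp add: has_real_derivative_iff_has_vector_derivative)
    show "norm (e' s) \<le> \<phi>' s" using s by (intro le) simp
  qed
qed simp

text \<open>Gronwall's inequality, with a constant that is not sharp: with the weight \<open>exp (2 L s)\<close> the linear
  term accounts for at most half of the maximum of the weighted norm.\<close>

lemma gronwall:
  fixes e :: "real \<Rightarrow> 'a::real_normed_vector"
  assumes e: "\<And>s. s \<in> {0..1} \<Longrightarrow> (e has_vector_derivative e' s) (at s within {0..1})"
    and le: "\<And>s. s \<in> {0..1} \<Longrightarrow> norm (e' s) \<le> L * norm (e s) + \<eta>"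
    and L: "0 \<le> L" and \<eta>: "0 \<le> \<eta>" and s: "s \<in> {0..1}"
  shows "norm (e s) \<le> 2 * (norm (e 0) + \<eta>) * exp (2 * L)"
proof -
  define q where "q r = norm (e r) * exp (- 2 * L * r)" for r
  have cont: "continuous_on {0..1} e"
    using e has_vector_derivative_continuous continuous_on_eq_continuous_within by metis
  have "continuous_on {0..1} q" unfolding q_def by (intro continuous_intros cont)
  then obtain m where m: "m \<in> {0..1}" "\<And>r. r \<in> {0..1} \<Longrightarrow> q r \<le> q m"
    using continuous_attains_sup[of "{0..1::real}" q] by auto
  have qe: "norm (e r) = q r * exp (2 * L * r)" for r by (simp add: q_def exp_minus)
  have q0: "0 \<le> q r" for r by (simp add: q_def)
  define \<phi> where "\<phi> r = q m / 2 * exp (2 * L * r) + \<eta> * r" for r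
  have "norm (e m - e 0) \<le> \<phi> m - \<phi> 0"
  proof (rule vector_derivative_bound[OF _ _ e])
    show "(\<phi> has_real_derivative (L * (q m * exp (2 * L * r)) + \<eta>)) (at r)" for r
      unfolding \<phi>_def by (auto intro!: derivative_eq_intros)
    fix r assume "r \<in> {0..m}"
    with m have r: "r \<in> {0..1}" by auto
    have "norm (e r) \<le> q m * exp (2 * L * r)"
      unfolding qe[of r] using m(2)[OF r] by (intro mult_right_mono) auto
    then have "L * norm (e r) \<le> L * (q m * exp (2 * L * r))" using L by (rule mult_left_mono)
    with le[OF r] show "norm (e' r) \<le> L * (q m * exp (2 * L * r)) + \<eta>" by linarith
  qed (use m in auto)
  also have "\<phi> m - \<phi> 0 \<le> q m / 2 * exp (2 * L * m) + \<eta>"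
  proof -
    have "\<eta> * m \<le> \<eta> * 1" using m(1) \<eta> by (intro mult_left_mono) auto
    then show ?thesis using q0[of m] by (simp add: \<phi>_def)
  qed
  finally have d: "norm (e m - e 0) \<le> q m / 2 * exp (2 * L * m) + \<eta>" .
  have "norm (e m) \<le> norm (e 0) + norm (e m - e 0)" using norm_triangle_ineq[of "e 0" "e m - e 0"] by simp
  with d have 1: "q m * exp (2 * L * m) \<le> (norm (e 0) + \<eta>) + q m / 2 * exp (2 * L * m)"
    using qe[of m] by linarith
  have "q m / 2 * exp (2 * L * m) \<le> norm (e 0) + \<eta>" using 1 by (simp add: field_simps)
  moreover have "q m / 2 * 1 \<le> q m / 2 * exp (2 * L * m)" using m(1) L q0[of m] by (intro mult_left_mono) auto
  ultimately have qm: "q m \<le> 2 * (norm (e 0) + \<eta>)" by simp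
  have "norm (e s) \<le> q m * exp (2 * L * s)" unfolding qe[of s] using m(2)[OF s] by (intro mult_right_mono) auto
  also have "\<dots> \<le> 2 * (norm (e 0) + \<eta>) * exp (2 * L)"
    using qm s L \<eta> by (intro mult_mono) (auto simp: mult_left_le)
  finally show ?thesis .
qed

text \<open>Picard iteration. The weight \<open>exp (2 L s)\<close> makes the iteration contract by one half on the whole time
  interval, and the derivatives of the iterates converge uniformly.\<close>

lemma ode_exists:
  fixes G :: "real \<Rightarrow> 'a::banach \<Rightarrow> 'a"
  assumes cont: "\<And>\<phi>. continuous_on {0..1} \<phi> \<Longrightarrow> continuous_on {0..1} (\<lambda>s. G s (\<phi> s))"
    and lip: "\<And>s x y. s \<in> {0..1} \<Longrightarrow> norm (G s x - G s y) \<le> L * norm (x - y)"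
    and L: "0 \<le> L"
  obtains \<phi> where "\<phi> 0 = z" "\<And>s. s \<in> {0..1} \<Longrightarrow> (\<phi> has_vector_derivative G s (\<phi> s)) (at s within {0..1})"
proof -
  define F where "F \<phi> s = z + integral {0..s} (\<lambda>r. G r (\<phi> r))" for \<phi> and s :: real
  define X where "X n = (F ^^ n) (\<lambda>_. z)" for n
  have X_Suc: "X (Suc n) = F (X n)" and X_0: "X 0 = (\<lambda>_. z)" for n by (simp_all add: X_def)
  have F0: "F \<phi> 0 = z" for \<phi> by (simp add: F_def)
  have FD: "(F \<phi> has_vector_derivative G s (\<phi> s)) (at s within {0..1})"
    if "continuous_on {0..1} \<phi>" "s \<in> {0..1}" for \<phi> s
  proof -
    have "((\<lambda>u. integral {0..u} (\<lambda>r. G r (\<phi> r))) has_vector_derivative G s (\<phi> s)) (at s within {0..1})"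
      by (rule integral_has_vector_derivative[OF cont[OF that(1)] that(2)])
    from has_vector_derivative_add[OF has_vector_derivative_const[of z] this]
    show ?thesis by (simp add: F_def[abs_def])
  qed
  have XC: "continuous_on {0..1} (X n)" for n
  proof (induction n)
    case (Suc n)
    then show ?case unfolding X_Suc
      using FD has_vector_derivative_continuous continuous_on_eq_continuous_within by metis
  qed (simp add: X_0)
  have XD: "(X (Suc n) has_vector_derivative G s (X n s)) (at s within {0..1})" if "s \<in> {0..1}" for n s
    unfolding X_Suc by (rule FD[OF XC that])
  have Xz: "X n 0 = z" for n by (cases n) (simp_all add: X_0 X_Suc F0)
  have "compact ((\<lambda>s. X 1 s - X 0 s) ` {0..1})"
    by (intro compact_continuous_image continuous_intros XC) auto
  from compact_imp_bounded[OF this] obtain M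
    where M: "0 < M" "\<And>s. s \<in> {0..1} \<Longrightarrow> norm (X 1 s - X 0 s) \<le> M"
    unfolding bounded_pos by blast
  have diff: "norm (X (Suc n) s - X n s) \<le> M * (1/2) ^ n * exp (2 * L * s)" if "s \<in> {0..1}" for n s
    using that
  proof (induction n arbitrary: s)
    case 0
    have "M * 1 \<le> M * exp (2 * L * s)" using M L 0 by (intro mult_left_mono) auto
    with M(2)[OF 0] show ?case by simp
  next
    case (Suc n)
    define \<phi> where "\<phi> r = M * (1/2) ^ Suc n * exp (2 * L * r)" for r
    have "norm ((X (Suc (Suc n)) s - X (Suc n) s) - (X (Suc (Suc n)) 0 - X (Suc n) 0)) \<le> \<phi> s - \<phi> 0"
    proof (rule vector_derivative_bound)
      show "((\<lambda>s. X (Suc (Suc n)) s - X (Suc n) s) has_vector_derivative (G r (X (Suc n) r) - G r (X n r))) (at r within {0..1})"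
        if "r \<in> {0..1}" for r using that by (intro has_vector_derivative_diff XD)
      show "(\<phi> has_real_derivative (L * (M * (1/2) ^ n * exp (2 * L * r)))) (at r)" for r
        unfolding \<phi>_def by (auto intro!: derivative_eq_intros)
      fix r assume "r \<in> {0..s}"
      with Suc.prems have r: "r \<in> {0..1}" by auto
      show "norm (G r (X (Suc n) r) - G r (X n r)) \<le> L * (M * (1/2) ^ n * exp (2 * L * r))"
        using lip[OF r, of "X (Suc n) r" "X n r"] mult_left_mono[OF Suc.IH[OF r] L] by linarith
    qed (use Suc.prems in auto)
    moreover have "0 \<le> \<phi> 0" using M by (simp add: \<phi>_def)
    ultimately show ?case by (simp add: Xz \<phi>_def)
  qed
  define D where "D s = (\<Sum>i. X (Suc i) s - X i s)" for s
  have "uniform_limit {0..1} (\<lambda>n s. \<Sum>i<n. X (Suc i) s - X i s) D sequentially"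
    unfolding D_def
  proof (rule Weierstrass_m_test)
    show "summable (\<lambda>n. M * exp (2 * L) * (1/2::real) ^ n)" by (intro summable_mult summable_geometric) simp
    fix n and s :: real assume s: "s \<in> {0..1}"
    have "M * (1/2) ^ n * exp (2 * L * s) \<le> M * (1/2) ^ n * exp (2 * L)"
      using s L M by (intro mult_left_mono) (auto simp: mult_left_le)
    with diff[OF s, of n] show "norm (X (Suc n) s - X n s) \<le> M * exp (2 * L) * (1/2) ^ n"
      by (simp add: mult_ac)
  qed
  moreover have "(\<Sum>i<n. X (Suc i) s - X i s) = X n s - z" for n s
    using sum_lessThan_telescope[of "\<lambda>i. X i s" n] by (simp add: X_0)
  ultimately have ul: "uniform_limit {0..1} (\<lambda>n s. X n s - z) D sequentially" by simp
  define \<phi>0 where "\<phi>0 s = z + D s" for s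
  have near: "\<forall>\<^sub>F n in sequentially. \<forall>s\<in>{0..1}. norm (X n s - \<phi>0 s) < e" if "0 < e" for e
  proof -
    have "X n s - z - D s = X n s - \<phi>0 s" for n s by (simp add: \<phi>0_def)
    with ul that show ?thesis by (simp add: uniform_limit_iff dist_norm)
  qed
  have lim: "(\<lambda>n. X n s) \<longlonglongrightarrow> \<phi>0 s" if "s \<in> {0..1}" for s
    unfolding tendsto_iff dist_norm
  proof (intro allI impI)
    fix e :: real assume "0 < e"
    from near[OF this] show "\<forall>\<^sub>F n in sequentially. norm (X n s - \<phi>0 s) < e"
      by (rule eventually_mono) (use that in blast)
  qed
  have "\<exists>g. \<forall>s\<in>{0..1}. (\<lambda>n. X (Suc n) s) \<longlonglongrightarrow> g s \<and> (g has_derivative (\<lambda>h. h *\<^sub>R G s (\<phi>0 s))) (at s within {0..1})"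
  proof (rule has_derivative_sequence)
    show "(X (Suc n) has_derivative (\<lambda>h. h *\<^sub>R G s (X n s))) (at s within {0..1})" if "s \<in> {0..1}" for n s
      using XD[OF that] by (simp add: has_vector_derivative_def)
    show "\<forall>\<^sub>F n in sequentially. \<forall>s\<in>{0..1}. \<forall>h. norm (h *\<^sub>R G s (X n s) - h *\<^sub>R G s (\<phi>0 s)) \<le> e * norm h"
      if e: "0 < e" for e
    proof -
      have "0 < e / (L + 1)" using e L by simp
      from near[OF this] show ?thesis
      proof (rule eventually_mono, intro ballI allI)
        fix n and s h :: real
        assume n: "\<forall>s\<in>{0..1}. norm (X n s - \<phi>0 s) < e / (L + 1)" and s: "s \<in> {0..1}"
        have "norm (G s (X n s) - G s (\<phi>0 s)) \<le> L * norm (X n s - \<phi>0 s)" by (rule lip[OF s])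
        also have "\<dots> \<le> (L + 1) * (e / (L + 1))" using n s L by (intro mult_mono) (auto intro: less_imp_le)
        also have "\<dots> = e" using L by simp
        finally have "\<bar>h\<bar> * norm (G s (X n s) - G s (\<phi>0 s)) \<le> \<bar>h\<bar> * e" by (rule mult_left_mono) simp
        then show "norm (h *\<^sub>R G s (X n s) - h *\<^sub>R G s (\<phi>0 s)) \<le> e * norm h"
          by (simp add: scaleR_diff_right[symmetric] mult.commute)
      qed
    qed
    show "(\<lambda>n. X (Suc n) 0) \<longlonglongrightarrow> z" by (simp add: Xz)
  qed auto
  then obtain g where g: "\<And>s. s \<in> {0..1} \<Longrightarrow> (\<lambda>n. X (Suc n) s) \<longlonglongrightarrow> g s"
    "\<And>s. s \<in> {0..1} \<Longrightarrow> (g has_derivative (\<lambda>h. h *\<^sub>R G s (\<phi>0 s))) (at s within {0..1})" by blast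
  have geq: "g s = \<phi>0 s" if "s \<in> {0..1}" for s
    using LIMSEQ_unique[OF g(1)[OF that] LIMSEQ_Suc[OF lim[OF that]]] .
  show thesis
  proof (rule that[of g])
    show "g 0 = z" using LIMSEQ_unique[OF g(1)[of 0]] by (simp add: Xz)
    show "(g has_vector_derivative G s (g s)) (at s within {0..1})" if "s \<in> {0..1}" for s
      using g(2)[OF that] by (simp add: has_vector_derivative_def geq[OF that])
  qed
qed

section \<open>Flows of the quadratic vector fields on the ball\<close>

context jb_triple
begin

lemma tendsto_tp:
  assumes f: "(f \<longlongrightarrow> x) F" and g: "(g \<longlongrightarrow> y) F" and h: "(h \<longlongrightarrow> w) F"
  shows "((\<lambda>s. tp (f s) (g s) (h s)) \<longlongrightarrow> tp x y w) F"
proof -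
  have "((\<lambda>s. 4 * norm (f s - x) * norm (g s) * norm (h s) + 4 * norm x * norm (g s - y) * norm (h s)
      + 4 * norm x * norm y * norm (h s - w)) \<longlongrightarrow>
      4 * norm (x - x) * norm y * norm w + 4 * norm x * norm (y - y) * norm w + 4 * norm x * norm y * norm (w - w)) F"
    by (intro tendsto_intros f g h)
  then have lim: "((\<lambda>s. 4 * norm (f s - x) * norm (g s) * norm (h s) + 4 * norm x * norm (g s - y) * norm (h s)
      + 4 * norm x * norm y * norm (h s - w)) \<longlongrightarrow> 0) F" by simp
  have "((\<lambda>s. tp (f s) (g s) (h s) - tp x y w) \<longlongrightarrow> 0) F"
  proof (rule Lim_null_comparison[OF always_eventually[OF allI] lim])
    fix s
    have eq: "tp (f s) (g s) (h s) - tp x y w = tp (f s - x) (g s) (h s) + tp x (g s - y) (h s) + tp x y (h s - w)"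
      by (simp add: tp_real_linear)
    show "norm (tp (f s) (g s) (h s) - tp x y w) \<le> 4 * norm (f s - x) * norm (g s) * norm (h s)
        + 4 * norm x * norm (g s - y) * norm (h s) + 4 * norm x * norm y * norm (h s - w)"
      unfolding eq
      using norm_triangle_ineq[of "tp (f s - x) (g s) (h s) + tp x (g s - y) (h s)" "tp x y (h s - w)"]
        norm_triangle_ineq[of "tp (f s - x) (g s) (h s)" "tp x (g s - y) (h s)"]
        tp_norm_le[of "f s - x" "g s" "h s"] tp_norm_le[of x "g s - y" "h s"] tp_norm_le[of x y "h s - w"]
      by linarith
  qed
  then show ?thesis by (simp add: LIM_zero_iff)
qed

lemma continuous_on_tp:
  "continuous_on S f \<Longrightarrow> continuous_on S g \<Longrightarrow> continuous_on S h \<Longrightarrow> continuous_on S (\<lambda>s. tp (f s) (g s) (h s))"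
  unfolding continuous_on_def by (blast intro: tendsto_tp)

definition vf :: "'z \<Rightarrow> 'z \<Rightarrow> 'z" where "vf a z = a - tp z a z"

lemma vf_norm_le: "norm z \<le> 1 \<Longrightarrow> norm (vf a z) \<le> 5 * norm a"
proof -
  assume z: "norm z \<le> 1"
  have "norm z * norm a * norm z = norm a * (norm z * norm z)" by simp
  also have "\<dots> \<le> norm a * 1" using z by (intro mult_left_mono) (auto simp: mult_le_one)
  finally show ?thesis using tp_norm_le[of z a z] norm_triangle_ineq4[of a "tp z a z"] unfolding vf_def by linarith
qed

lemma vf_diff: "vf a z - vf b z = vf (a - b) z"
  by (simp add: vf_def tp_real_linear)

lemma vf_lipschitz:
  assumes "norm x \<le> 1" "norm y \<le> 1"
  shows "norm (vf a x - vf a y) \<le> 8 * norm a * norm (x - y)"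
proof -
  have "vf a x - vf a y = - (tp (x - y) a x + tp y a (x - y))" by (simp add: vf_def tp_real_linear)
  then have "norm (vf a x - vf a y) \<le> norm (tp (x - y) a x) + norm (tp y a (x - y))"
    by (simp only: norm_minus_cancel norm_triangle_ineq)
  moreover have "norm (x - y) * norm a * norm x \<le> norm (x - y) * norm a * 1"
    using assms by (intro mult_left_mono) auto
  moreover have "norm y * norm a * norm (x - y) \<le> 1 * norm a * norm (x - y)"
    using assms by (intro mult_right_mono) auto
  ultimately show ?thesis using tp_norm_le[of "x - y" a x] tp_norm_le[of y a "x - y"] by (simp add: mult_ac)
qed

text \<open>Outside the ball the field is made radially constant, which keeps it globally Lipschitz.\<close>

definition trunc :: "'z \<Rightarrow> 'z" where "trunc z = (1 / max 1 (norm z)) *\<^sub>R z"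

lemma trunc_norm_le: "norm (trunc z) \<le> 1"
  by (simp add: trunc_def divide_le_eq max_def)

lemma trunc_id: "norm z \<le> 1 \<Longrightarrow> trunc z = z"
  by (simp add: trunc_def max_def)

lemma trunc_lipschitz: "norm (trunc x - trunc y) \<le> 2 * norm (x - y)"
proof -
  define p q where "p = max 1 (norm x)" and "q = max 1 (norm y)"
  have pq: "1 \<le> p" "1 \<le> q" "norm y \<le> q" by (simp_all add: p_def q_def)
  have d: "\<bar>q - p\<bar> \<le> norm (x - y)" 
    using norm_triangle_ineq3[of x y] by (simp add: p_def q_def max_def) linarith
  have "trunc x - trunc y = (1 / p) *\<^sub>R (x - y) + (1 / p - 1 / q) *\<^sub>R y"
    by (simp add: trunc_def p_def q_def algebra_simps)
  then have "norm (trunc x - trunc y) \<le> norm ((1 / p) *\<^sub>R (x - y)) + norm ((1 / p - 1 / q) *\<^sub>R y)"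
    by (simp only: norm_triangle_ineq)
  moreover have "norm ((1 / p) *\<^sub>R (x - y)) \<le> norm (x - y)"
    using pq mult_right_mono[of "1 / p" 1 "norm (x - y)"] by simp
  moreover have "norm ((1 / p - 1 / q) *\<^sub>R y) \<le> norm (x - y)"
  proof -
    have "1 / p - 1 / q = (q - p) / (p * q)" using pq by (simp add: field_simps)
    then have "norm ((1 / p - 1 / q) *\<^sub>R y) = \<bar>q - p\<bar> * (norm y / (p * q))" using pq by (simp add: abs_mult)
    also have "norm y / (p * q) \<le> 1"
      using pq mult_mono[of 1 p "norm y" q] by (simp add: divide_le_eq)
    then have "\<bar>q - p\<bar> * (norm y / (p * q)) \<le> \<bar>q - p\<bar> * 1" by (intro mult_left_mono) auto
    finally show ?thesis using d by simp
  qed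
  ultimately show ?thesis by simp
qed

text \<open>Lipschitz continuity of a control makes its trajectories differentiable with a Lipschitz derivative, which
  gives a uniform second-order error for one time step.\<close>

definition control :: "real \<Rightarrow> (real \<Rightarrow> 'z) \<Rightarrow> bool" where
  "control R a \<longleftrightarrow> (\<forall>s\<in>{0..1}. norm (a s) \<le> R) \<and> (\<forall>s\<in>{0..1}. \<forall>t\<in>{0..1}. norm (a s - a t) \<le> R * \<bar>s - t\<bar>)"

lemma control_norm: "control R a \<Longrightarrow> s \<in> {0..1} \<Longrightarrow> norm (a s) \<le> R"
  and control_lipschitz: "control R a \<Longrightarrow> s \<in> {0..1} \<Longrightarrow> t \<in> {0..1} \<Longrightarrow> norm (a s - a t) \<le> R * \<bar>s - t\<bar>"
  by (auto simp: control_def)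

lemma control_nonneg: "control R a \<Longrightarrow> 0 \<le> R"
  using order_trans[OF norm_ge_zero control_norm[of R a 0]] by simp

lemma control_continuous: "control R a \<Longrightarrow> continuous_on {0..1} a"
proof (rule lipschitz_on_continuous_on)
  assume "control R a"
  then show "R-lipschitz_on {0..1} a"
    using control_nonneg control_lipschitz by (auto intro!: lipschitz_onI simp: dist_norm)
qed

text \<open>The bound on the norm is part of the definition because the vector field is Lipschitz on bounded sets only;
  with it, trajectories are unique.\<close>

definition traj :: "(real \<Rightarrow> 'z) \<Rightarrow> 'z \<Rightarrow> (real \<Rightarrow> 'z) \<Rightarrow> bool" where
  "traj a z \<phi> \<longleftrightarrow> \<phi> 0 = z \<and> (\<forall>s\<in>{0..1}. norm (\<phi> s) \<le> 1 \<and>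
     (\<phi> has_vector_derivative vf (a s) (\<phi> s)) (at s within {0..1}))"

text \<open>At \<open>z = \<rho> u\<close> with \<open>\<parallel>u\<parallel> = 1\<close> and \<open>\<rho> < 1\<close> the field is \<open>\<rho>\<^sup>2\<close> times its value at \<open>u\<close>, which changes
  the norm only to second order, plus \<open>(1 - \<rho>\<^sup>2) a\<close>.\<close>

lemma radial_step:
  assumes a: "norm a \<le> R" and t: "0 \<le> t" "t \<le> 1" and K: "K = 1000 * R\<^sup>2 + 100000 * R ^ 4"
  shows "norm (z + t *\<^sub>R vf a (trunc z)) \<le> norm z + 2 * R * t * max 0 (1 - norm z) + K * t\<^sup>2"
proof -
  have R: "0 \<le> R" using a norm_ge_zero order_trans by blast
  have K0: "0 \<le> K" using R by (simp add: K)
  have step: "norm (u + r *\<^sub>R vf a u) \<le> 1 + K * r\<^sup>2" if "norm u \<le> 1" "0 \<le> r" "r \<le> 1" for u r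
    unfolding K vf_def by (rule field_step_le[OF that(1) a that(2,3)])
  define \<rho> where "\<rho> = norm z"
  define u where "u = z /\<^sub>R \<rho>"
  consider "\<rho> = 0" | "0 < \<rho>" "\<rho> < 1" | "1 \<le> \<rho>" using norm_ge_zero[of z] unfolding \<rho>_def by linarith
  then show ?thesis
  proof cases
    case 1
    then have "z = 0" by (simp add: \<rho>_def)
    then have "norm (z + t *\<^sub>R vf a (trunc z)) = t * norm a"
      using t by (simp add: trunc_def vf_def tp_real_linear)
    also have "\<dots> \<le> t * (2 * R)" using a R t by (intro mult_left_mono) auto
    also have "\<dots> = norm z + 2 * R * t * max 0 (1 - norm z)" using \<open>z = 0\<close> by simp
    also have "\<dots> \<le> norm z + 2 * R * t * max 0 (1 - norm z) + K * t\<^sup>2" using K0 by simp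
    finally show ?thesis .
  next
    case 2
    then have zu: "z = \<rho> *\<^sub>R u" and u: "norm u = 1" by (auto simp: u_def \<rho>_def)
    have "trunc z = z" using 2 by (intro trunc_id) (simp add: \<rho>_def)
    then have "z + t *\<^sub>R vf a (trunc z) = \<rho> *\<^sub>R (u + (t * \<rho>) *\<^sub>R vf a u) + (t * (1 - \<rho>\<^sup>2)) *\<^sub>R a"
      by (simp add: zu[symmetric]) (subst (1 2) zu, simp add: vf_def tp_real_linear power2_eq_square algebra_simps)
    then have "norm (z + t *\<^sub>R vf a (trunc z)) \<le> norm (\<rho> *\<^sub>R (u + (t * \<rho>) *\<^sub>R vf a u)) + norm ((t * (1 - \<rho>\<^sup>2)) *\<^sub>R a)"
      by (simp only: norm_triangle_ineq)
    moreover have "norm (\<rho> *\<^sub>R (u + (t * \<rho>) *\<^sub>R vf a u)) \<le> \<rho> + K * t\<^sup>2"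
    proof -
      have "norm (u + (t * \<rho>) *\<^sub>R vf a u) \<le> 1 + K * (t * \<rho>)\<^sup>2"
        using 2 t u by (intro step) (auto simp: mult_le_one)
      then have "\<rho> * norm (u + (t * \<rho>) *\<^sub>R vf a u) \<le> \<rho> * (1 + K * (t * \<rho>)\<^sup>2)" using 2 by (intro mult_left_mono) auto
      also have "\<dots> = \<rho> + \<rho> ^ 3 * (K * t\<^sup>2)" by (simp add: power_mult_distrib algebra_simps power_numeral_reduce)
      also have "\<dots> \<le> \<rho> + 1 * (K * t\<^sup>2)"
        using 2 K0 by (intro add_left_mono mult_right_mono) (auto simp: power_le_one)
      finally show ?thesis using 2 by simp
    qed
    moreover have "norm ((t * (1 - \<rho>\<^sup>2)) *\<^sub>R a) \<le> 2 * R * t * (1 - \<rho>)"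
    proof -
      have r: "1 - \<rho>\<^sup>2 = (1 + \<rho>) * (1 - \<rho>)" by (simp add: power2_eq_square algebra_simps)
      have "1 - \<rho>\<^sup>2 \<le> 2 * (1 - \<rho>)" unfolding r using 2 by (intro mult_right_mono) auto
      moreover have "0 \<le> 1 - \<rho>\<^sup>2" using 2 by (simp add: power_le_one)
      ultimately have le: "t * (1 - \<rho>\<^sup>2) * norm a \<le> t * (2 * (1 - \<rho>)) * R"
        using t a by (intro mult_mono) auto
      have c0: "0 \<le> t * (1 - \<rho>\<^sup>2)" using \<open>0 \<le> 1 - \<rho>\<^sup>2\<close> t by simp
      have "t * (2 * (1 - \<rho>)) * R = 2 * R * t * (1 - \<rho>)" by (simp only: mult_ac)
      with le show ?thesis by (simp only: norm_scaleR abs_of_nonneg[OF c0])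
    qed
    moreover have "max 0 (1 - norm z) = 1 - \<rho>" using 2 by (simp add: \<rho>_def)
    ultimately show ?thesis unfolding \<rho>_def[symmetric] by simp
  next
    case 3
    then have rp: "0 < \<rho>" by linarith
    then have zu: "z = \<rho> *\<^sub>R u" by (simp add: u_def)
    have u: "norm u = 1" using rp by (simp add: u_def \<rho>_def)
    have "trunc z = u" using 3 unfolding trunc_def u_def \<rho>_def[symmetric]
      by (simp add: max_absorb2 inverse_eq_divide)
    then have "z + t *\<^sub>R vf a (trunc z) = (\<rho> - 1) *\<^sub>R u + (u + t *\<^sub>R vf a u)"
      using arg_cong[OF zu, of "\<lambda>x. x + t *\<^sub>R vf a u"] by (simp add: algebra_simps)
    then have "norm (z + t *\<^sub>R vf a (trunc z)) \<le> norm ((\<rho> - 1) *\<^sub>R u) + norm (u + t *\<^sub>R vf a u)"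
      by (simp only: norm_triangle_ineq)
    moreover have "norm ((\<rho> - 1) *\<^sub>R u) = \<rho> - 1" using 3 u by simp
    moreover have "norm (u + t *\<^sub>R vf a u) \<le> 1 + K * t\<^sup>2" using t u by (intro step) auto
    moreover have "0 \<le> 2 * R * t * max 0 (1 - norm z)" using R t by simp
    ultimately show ?thesis using u by (simp add: \<rho>_def[symmetric])
  qed
qed

lemma discrete_decay:
  fixes \<theta> :: "nat \<Rightarrow> real"
  assumes step: "\<And>k. k < n \<Longrightarrow> \<theta> (Suc k) \<ge> \<theta> k - q * max 0 (\<theta> k) - \<delta>"
    and q: "0 \<le> q" "q \<le> 1" and "0 \<le> \<theta> 0" "0 \<le> \<delta>" and "k \<le> n"
  shows "(1 - q) ^ k * \<theta> 0 - real k * \<delta> \<le> \<theta> k"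
  using \<open>k \<le> n\<close>
proof (induction k)
  case (Suc k)
  then have IH: "(1 - q) ^ k * \<theta> 0 - real k * \<delta> \<le> \<theta> k" by simp
  have st: "\<theta> (Suc k) \<ge> \<theta> k - q * max 0 (\<theta> k) - \<delta>" using Suc.prems by (intro step) simp
  have p: "0 \<le> (1 - q) ^ k * \<theta> 0" using assms by simp
  have e: "(1 - q) ^ Suc k * \<theta> 0 = (1 - q) ^ k * \<theta> 0 - q * ((1 - q) ^ k * \<theta> 0)" by (simp add: algebra_simps)
  show ?case
  proof (cases "0 \<le> \<theta> k")
    case True
    have "(1 - q) * ((1 - q) ^ k * \<theta> 0 - real k * \<delta>) \<le> (1 - q) * \<theta> k" using q by (intro mult_left_mono IH) auto
    moreover have "0 \<le> q * (real k * \<delta>)" using assms by simp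
    ultimately show ?thesis using st True by (simp add: e algebra_simps)
  next
    case False
    moreover have "0 \<le> q * ((1 - q) ^ k * \<theta> 0)" using p q by simp
    ultimately show ?thesis using st IH unfolding e by (simp add: algebra_simps)
  qed
qed simp

text \<open>Trajectories starting in the closed ball stay there, and those starting in the open ball keep a
  positive distance from the sphere. Both follow from the one-step estimate by letting the number of
  steps tend to infinity.\<close>

lemma truncated_solution_norm_le:
  assumes a: "control R a" and z: "norm z \<le> 1"
    and \<phi>0: "\<phi> 0 = z"
    and \<phi>: "\<And>s. s \<in> {0..1} \<Longrightarrow> (\<phi> has_vector_derivative vf (a s) (trunc (\<phi> s))) (at s within {0..1})"
    and r: "r \<in> {0..1}"
  shows "exp (- 4 * R) * (1 - norm z) \<le> 1 - norm (\<phi> r)"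
proof -
  have R: "0 \<le> R" by (rule control_nonneg[OF a])
  \<comment> \<open>\<open>K2\<close> is the error of \<open>radial_step\<close>, \<open>K1\<close> a Lipschitz constant for the velocity\<close>
  define K2 where "K2 = 1000 * R\<^sup>2 + 100000 * R ^ 4"
  define K1 where "K1 = 5 * R + 80 * R\<^sup>2"
  define K where "K = K1 + K2"
  have K0: "0 \<le> K1" "0 \<le> K2" using R by (simp_all add: K1_def K2_def)
  have speed: "norm (vf (a s) (trunc x)) \<le> 5 * R" if "s \<in> {0..1}" for s x
    using vf_norm_le[OF trunc_norm_le[of x], of "a s"] control_norm[OF a that] by linarith
  have step: "1 - norm (\<phi> (s + t)) \<ge> (1 - norm (\<phi> s)) - 2 * R * t * max 0 (1 - norm (\<phi> s)) - K * t\<^sup>2"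
    if s: "s \<in> {0..1}" "s + t \<in> {0..1}" "0 \<le> t" for s t
  proof -
    have sub: "{s..s + t} \<subseteq> {0..1}" using s by auto
    define w where "w = vf (a s) (trunc (\<phi> s))"
    have close: "norm (\<phi> u - \<phi> s) \<le> 5 * R * (u - s)" if u: "u \<in> {s..s + t}" for u
    proof -
      have "norm (\<phi> u - \<phi> s) \<le> (\<lambda>r. 5 * R * r) u - (\<lambda>r. 5 * R * r) s"
        by (rule vector_derivative_bound[OF _ _ \<phi>, where \<phi>' = "\<lambda>_. 5 * R"])
          (use u sub speed in \<open>auto intro!: derivative_eq_intros\<close>)
      then show ?thesis by (simp add: algebra_simps)
    qed
    have "norm ((\<phi> (s + t) - (s + t) *\<^sub>R w) - (\<phi> s - s *\<^sub>R w)) \<le> (\<lambda>r. K1 * t * r) (s + t) - (\<lambda>r. K1 * t * r) s"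
    proof (rule vector_derivative_bound[OF _ sub, where \<phi>' = "\<lambda>_. K1 * t"])
      show "((\<lambda>r. \<phi> r - r *\<^sub>R w) has_vector_derivative (vf (a u) (trunc (\<phi> u)) - w)) (at u within {0..1})"
        if "u \<in> {0..1}" for u
        by (rule has_vector_derivative_diff[OF \<phi>[OF that]]) (auto intro!: derivative_eq_intros)
      show "((\<lambda>r. K1 * t * r) has_real_derivative K1 * t) (at u)" for u
        by (auto intro!: derivative_eq_intros)
      fix u assume u: "u \<in> {s..s + t}"
      then have u1: "u \<in> {0..1}" using sub by auto
      have "vf (a u) (trunc (\<phi> u)) - w = vf (a u - a s) (trunc (\<phi> u)) + (vf (a s) (trunc (\<phi> u)) - vf (a s) (trunc (\<phi> s)))"
        by (simp add: w_def vf_diff[symmetric])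
      then have "norm (vf (a u) (trunc (\<phi> u)) - w) \<le> norm (vf (a u - a s) (trunc (\<phi> u)))
          + norm (vf (a s) (trunc (\<phi> u)) - vf (a s) (trunc (\<phi> s)))"
        by (simp only: norm_triangle_ineq)
      moreover have "norm (vf (a u - a s) (trunc (\<phi> u))) \<le> 5 * (R * t)"
      proof -
        have "norm (a u - a s) \<le> R * \<bar>u - s\<bar>" by (rule control_lipschitz[OF a u1 s(1)])
        also have "\<dots> \<le> R * t" using u R by (intro mult_left_mono) auto
        finally show ?thesis using vf_norm_le[OF trunc_norm_le[of "\<phi> u"], of "a u - a s"] by linarith
      qed
      moreover have "norm (vf (a s) (trunc (\<phi> u)) - vf (a s) (trunc (\<phi> s))) \<le> 8 * R * (2 * (5 * R * t))"
      proof -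
        have "norm (vf (a s) (trunc (\<phi> u)) - vf (a s) (trunc (\<phi> s))) \<le> 8 * norm (a s) * norm (trunc (\<phi> u) - trunc (\<phi> s))"
          by (rule vf_lipschitz[OF trunc_norm_le trunc_norm_le])
        also have "\<dots> \<le> 8 * R * (2 * (5 * R * t))"
        proof (rule mult_mono)
          show "8 * norm (a s) \<le> 8 * R" using control_norm[OF a s(1)] by simp
          have "5 * R * (u - s) \<le> 5 * R * t" using u R by (intro mult_left_mono) auto
          then show "norm (trunc (\<phi> u) - trunc (\<phi> s)) \<le> 2 * (5 * R * t)"
            using trunc_lipschitz[of "\<phi> u" "\<phi> s"] close[OF u] by linarith
        qed (use R in auto)
        finally show ?thesis .
      qed
      moreover have "5 * (R * t) + 8 * R * (2 * (5 * R * t)) = K1 * t"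
        by (simp add: K1_def power2_eq_square algebra_simps)
      ultimately show "norm (vf (a u) (trunc (\<phi> u)) - w) \<le> K1 * t" by linarith
    qed (use s in auto)
    moreover have "(\<phi> (s + t) - (s + t) *\<^sub>R w) - (\<phi> s - s *\<^sub>R w) = \<phi> (s + t) - (\<phi> s + t *\<^sub>R w)"
      by (simp add: algebra_simps)
    ultimately have "norm (\<phi> (s + t) - (\<phi> s + t *\<^sub>R w)) \<le> K1 * t\<^sup>2" by (simp add: power2_eq_square algebra_simps)
    moreover have "norm (\<phi> s + t *\<^sub>R w) \<le> norm (\<phi> s) + 2 * R * t * max 0 (1 - norm (\<phi> s)) + K2 * t\<^sup>2"
      unfolding w_def by (rule radial_step[OF control_norm[OF a s(1)] _ _ K2_def]) (use s in auto)
    moreover have "norm (\<phi> (s + t)) \<le> norm (\<phi> s + t *\<^sub>R w) + norm (\<phi> (s + t) - (\<phi> s + t *\<^sub>R w))"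
      using norm_triangle_ineq[of "\<phi> s + t *\<^sub>R w" "\<phi> (s + t) - (\<phi> s + t *\<^sub>R w)"] by simp
    ultimately show ?thesis by (simp add: K_def algebra_simps)
  qed
  obtain n0 :: nat where n0: "4 * R + 1 \<le> real n0" using real_arch_simple by blast
  have main: "exp (- 4 * R) * (1 - norm z) - K * inverse (real n) \<le> 1 - norm (\<phi> r)" if "n0 \<le> n" for n
  proof -
    have n: "4 * R \<le> real n" "1 \<le> real n" using n0 that R by linarith+
    then have npos: "0 < real n" by simp
    define t where "t = r / real n"
    have t: "0 \<le> t" "t * real n = r" using r npos by (auto simp: t_def)
    define \<theta> where "\<theta> k = 1 - norm (\<phi> (real k * t))" for k
    define q where "q = 2 * R * t"
    have tn: "t \<le> inverse (real n)" using r npos by (simp add: t_def divide_inverse mult_right_le_one_le)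
    have q0: "0 \<le> q" using R t by (simp add: q_def)
    have "q * real n = 2 * R * r" using t by (simp add: q_def)
    also have "\<dots> \<le> 2 * R * 1" using r R by (intro mult_left_mono) auto
    finally have qn: "q * real n \<le> 2 * R" by simp
    have "real n / 2 = (1/2) * real n" by (rule divide_inverse[THEN trans]) simp
    then have "q * real n \<le> (1/2) * real n" using qn n(1) by linarith
    then have q2: "q \<le> 1/2" using npos by (rule mult_right_le_imp_le)
    have "(1 - q) ^ n * \<theta> 0 - real n * (K * t\<^sup>2) \<le> \<theta> n"
    proof (rule discrete_decay)
      fix k assume "k < n"
      then have k: "real k + 1 \<le> real n" by simp
      have "(real k + 1) * t \<le> real n * t" using k t by (intro mult_right_mono) auto
      then have kt: "real k * t + t \<le> r" using t by (simp add: algebra_simps)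
      have "0 \<le> real k * t" using t by simp
      with kt t r have "real k * t \<in> {0..1}" "real k * t + t \<in> {0..1}" by auto
      from step[OF this t(1)] show "\<theta> (Suc k) \<ge> \<theta> k - q * max 0 (\<theta> k) - K * t\<^sup>2"
        by (simp add: \<theta>_def q_def algebra_simps)
    qed (use q0 q2 z \<phi>0 K0 in \<open>auto simp: \<theta>_def K_def\<close>)
    moreover have "exp (- 4 * R) * \<theta> 0 \<le> (1 - q) ^ n * \<theta> 0"
    proof (rule mult_right_mono)
      have "- q - 2 * q\<^sup>2 \<le> ln (1 - q)" using q0 q2 by (rule ln_one_minus_pos_lower_bound)
      moreover have "q * q \<le> q * (1/2)" using q0 q2 by (rule mult_left_mono[rotated])
      ultimately have "- 2 * q \<le> ln (1 - q)" by (simp add: power2_eq_square)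
      then have "exp (- 2 * q) \<le> 1 - q" using q2 by (simp add: ln_ge_iff)
      then have "exp (- 2 * q) ^ n \<le> (1 - q) ^ n" by (intro power_mono) auto
      moreover have "exp (- 4 * R) \<le> exp (- 2 * q) ^ n"
        using qn by (simp add: exp_of_nat_mult[symmetric] mult.commute)
      ultimately show "exp (- 4 * R) \<le> (1 - q) ^ n" by simp
      show "0 \<le> \<theta> 0" using z \<phi>0 by (simp add: \<theta>_def)
    qed
    moreover have "real n * (K * t\<^sup>2) \<le> K * inverse (real n)"
    proof -
      have "t\<^sup>2 \<le> (inverse (real n))\<^sup>2" using tn t by (intro power_mono) auto
      then have "real n * (K * t\<^sup>2) \<le> real n * (K * (inverse (real n))\<^sup>2)"
        using K0 by (intro mult_left_mono) (auto simp: K_def)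
      also have "\<dots> = K * inverse (real n)" using npos by (simp add: power2_eq_square field_simps)
      finally show ?thesis .
    qed
    moreover have "\<theta> 0 = 1 - norm z" "\<theta> n = 1 - norm (\<phi> r)" using t \<phi>0 by (simp_all add: \<theta>_def mult.commute)
    ultimately show ?thesis by simp
  qed
  have lim: "(\<lambda>n. exp (- 4 * R) * (1 - norm z) - K * inverse (real n)) \<longlonglongrightarrow> exp (- 4 * R) * (1 - norm z) - K * 0"
    by (intro tendsto_intros lim_inverse_n)
  have "\<forall>\<^sub>F n in sequentially. exp (- 4 * R) * (1 - norm z) - K * inverse (real n) \<le> 1 - norm (\<phi> r)"
    by (rule eventually_sequentiallyI[of n0]) (rule main)
  from tendsto_upperbound[OF lim this] have "exp (- 4 * R) * (1 - norm z) - K * 0 \<le> 1 - norm (\<phi> r)"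
    by simp
  then show ?thesis by simp
qed


lemma traj_exists:
  assumes a: "control R a" and z: "norm z \<le> 1"
  obtains \<phi> where "traj a z \<phi>" "exp (- 4 * R) * (1 - norm z) \<le> 1 - norm (\<phi> 1)"
proof -
  have R: "0 \<le> R" by (rule control_nonneg[OF a])
  have tc: "continuous_on S trunc" for S
    by (rule lipschitz_on_continuous_on[of 2], rule lipschitz_onI) (auto simp: dist_norm trunc_lipschitz)
  obtain \<phi> where \<phi>: "\<phi> 0 = z"
    "\<And>s. s \<in> {0..1} \<Longrightarrow> (\<phi> has_vector_derivative vf (a s) (trunc (\<phi> s))) (at s within {0..1})"
  proof (rule ode_exists[of "\<lambda>s x. vf (a s) (trunc x)" "8 * R * 2" z])
    show "continuous_on {0..1} (\<lambda>s. vf (a s) (trunc (\<phi> s)))" if "continuous_on {0..1} \<phi>" for \<phi>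
      unfolding vf_def
      by (intro continuous_intros continuous_on_tp control_continuous[OF a] continuous_on_compose2[OF tc that]) auto
    fix s x y assume s: "s \<in> {0..1::real}"
    have "norm (vf (a s) (trunc x) - vf (a s) (trunc y)) \<le> 8 * norm (a s) * norm (trunc x - trunc y)"
      by (rule vf_lipschitz[OF trunc_norm_le trunc_norm_le])
    also have "\<dots> \<le> 8 * R * (2 * norm (x - y))"
      using control_norm[OF a s] R by (intro mult_mono trunc_lipschitz) auto
    finally show "norm (vf (a s) (trunc x) - vf (a s) (trunc y)) \<le> 8 * R * 2 * norm (x - y)" by simp
  qed (use R in auto)
  have b: "exp (- 4 * R) * (1 - norm z) \<le> 1 - norm (\<phi> r)" if "r \<in> {0..1}" for r
    by (rule truncated_solution_norm_le[OF a z \<phi> that])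
  have "norm (\<phi> r) \<le> 1" if "r \<in> {0..1}" for r
  proof -
    have "0 \<le> exp (- 4 * R) * (1 - norm z)" using z by simp
    with b[OF that] show ?thesis by simp
  qed
  with \<phi> have "traj a z \<phi>" by (simp add: traj_def trunc_id)
  with b[of 1] that show thesis by simp
qed

lemma traj_diff_le:
  assumes a: "control R a" and \<phi>: "traj a x \<phi>" and \<psi>: "traj a y \<psi>" and s: "s \<in> {0..1}"
  shows "norm (\<phi> s - \<psi> s) \<le> 2 * exp (16 * R) * norm (x - y)"
proof -
  have R: "0 \<le> R" by (rule control_nonneg[OF a])
  have "norm (\<phi> s - \<psi> s) \<le> 2 * (norm (\<phi> 0 - \<psi> 0) + 0) * exp (2 * (8 * R))"
  proof (rule gronwall[OF _ _ _ _ s])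
    show "((\<lambda>s. \<phi> s - \<psi> s) has_vector_derivative (vf (a r) (\<phi> r) - vf (a r) (\<psi> r))) (at r within {0..1})"
      if "r \<in> {0..1}" for r
      using \<phi> \<psi> that by (intro has_vector_derivative_diff) (auto simp: traj_def)
    fix r :: real assume r: "r \<in> {0..1}"
    have "norm (vf (a r) (\<phi> r) - vf (a r) (\<psi> r)) \<le> 8 * norm (a r) * norm (\<phi> r - \<psi> r)"
      using \<phi> \<psi> r by (intro vf_lipschitz) (auto simp: traj_def)
    also have "\<dots> \<le> 8 * R * norm (\<phi> r - \<psi> r)" using control_norm[OF a r] by (intro mult_right_mono) auto
    finally show "norm (vf (a r) (\<phi> r) - vf (a r) (\<psi> r)) \<le> 8 * R * norm (\<phi> r - \<psi> r) + 0" by simp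
  qed (use R in auto)
  then show ?thesis using \<phi> \<psi> by (simp add: traj_def mult_ac)
qed

text \<open>Meaningful for a control and a point of the closed ball, where exactly one trajectory exists.\<close>

definition flow :: "(real \<Rightarrow> 'z) \<Rightarrow> 'z \<Rightarrow> 'z" where "flow a z = (SOME \<phi>. traj a z \<phi>) 1"

lemma flow_eq:
  assumes a: "control R a" and \<phi>: "traj a z \<phi>"
  shows "flow a z = \<phi> 1"
proof -
  have "traj a z (SOME \<phi>. traj a z \<phi>)" by (rule someI[of "traj a z", OF \<phi>])
  from traj_diff_le[OF a this \<phi>, of 1] show ?thesis by (simp add: flow_def)
qed

lemma
  assumes a: "control R a" and z: "norm z \<le> 1"
  shows flow_norm_le: "norm (flow a z) \<le> 1" and flow_norm_less: "norm z < 1 \<Longrightarrow> norm (flow a z) < 1"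
proof -
  obtain \<phi> where \<phi>: "traj a z \<phi>" "exp (- 4 * R) * (1 - norm z) \<le> 1 - norm (\<phi> 1)"
    by (rule traj_exists[OF a z])
  have e: "flow a z = \<phi> 1" by (rule flow_eq[OF a \<phi>(1)])
  show "norm (flow a z) \<le> 1" using \<phi>(1) by (simp add: e traj_def)
  assume "norm z < 1"
  then have "0 < exp (- 4 * R) * (1 - norm z)" by simp
  with \<phi>(2) show "norm (flow a z) < 1" unfolding e by linarith
qed

lemma flow_lipschitz:
  assumes a: "control R a" and "norm x \<le> 1" "norm y \<le> 1"
  shows "norm (flow a x - flow a y) \<le> 2 * exp (16 * R) * norm (x - y)"
proof -
  obtain \<phi> \<psi> where "traj a x \<phi>" "traj a y \<psi>" using traj_exists[OF a] assms by metis
  with traj_diff_le[OF a this, of 1] show ?thesis by (simp add: flow_eq[OF a])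
qed

text \<open>Affine changes of time; they cover both time reversal and the flows up to intermediate times.\<close>

lemma traj_rescale:
  assumes \<phi>: "traj a z \<phi>" and lin: "\<And>s. l s = c + m * s" "\<And>s. s \<in> {0..1} \<Longrightarrow> l s \<in> {0..1}"
  shows "traj (\<lambda>s. m *\<^sub>R a (l s)) (\<phi> c) (\<lambda>s. \<phi> (l s))"
  unfolding traj_def
proof (intro conjI ballI)
  show "\<phi> (l 0) = \<phi> c" by (simp add: lin)
  fix s :: real assume s: "s \<in> {0..1}"
  then have ls: "l s \<in> {0..1}" by (rule lin)
  then show "norm (\<phi> (l s)) \<le> 1" using \<phi> by (simp add: traj_def)
  have "(\<phi> has_vector_derivative vf (a (l s)) (\<phi> (l s))) (at (l s) within l ` {0..1})"
    by (rule has_vector_derivative_within_subset[of _ _ _ "{0..1}"]) (use \<phi> ls lin(2) in \<open>auto simp: traj_def\<close>)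
  moreover have "(l has_vector_derivative m) (at s within {0..1})"
    unfolding lin(1)[abs_def] by (auto intro!: derivative_eq_intros)
  ultimately have "((\<phi> \<circ> l) has_vector_derivative m *\<^sub>R vf (a (l s)) (\<phi> (l s))) (at s within {0..1})"
    by (intro vector_diff_chain_within)
  then show "((\<lambda>s. \<phi> (l s)) has_vector_derivative vf (m *\<^sub>R a (l s)) (\<phi> (l s))) (at s within {0..1})"
    by (simp add: o_def vf_def tp_real_linear scaleR_diff_right)
qed

definition reversed :: "(real \<Rightarrow> 'z) \<Rightarrow> real \<Rightarrow> 'z" where "reversed a s = - a (1 - s)"

lemma control_reversed: "control R a \<Longrightarrow> control R (reversed a)"
  unfolding control_def
proof (elim conjE, intro conjI ballI)
  fix s t :: real
  assume n: "\<forall>s\<in>{0..1}. norm (a s) \<le> R" and l: "\<forall>s\<in>{0..1}. \<forall>t\<in>{0..1}. norm (a s - a t) \<le> R * \<bar>s - t\<bar>"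
  assume s: "s \<in> {0..1}"
  then have s': "1 - s \<in> {0..1}" by auto
  with n show "norm (reversed a s) \<le> R" by (simp add: reversed_def)
  assume t: "t \<in> {0..1}"
  then have "1 - t \<in> {0..1}" by auto
  with s' l have "norm (a (1 - t) - a (1 - s)) \<le> R * \<bar>(1 - t) - (1 - s)\<bar>" by blast
  then show "norm (reversed a s - reversed a t) \<le> R * \<bar>s - t\<bar>" by (simp add: reversed_def)
qed

lemma reversed_reversed: "reversed (reversed a) = a"
  by (simp add: reversed_def fun_eq_iff)

lemma flow_reversed:
  assumes a: "control R a" and z: "norm z \<le> 1"
  shows "flow (reversed a) (flow a z) = z"
proof -
  obtain \<phi> where \<phi>: "traj a z \<phi>" by (rule traj_exists[OF a z])
  have "traj (\<lambda>s. (- 1) *\<^sub>R a (1 - s)) (\<phi> 1) (\<lambda>s. \<phi> (1 - s))"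
    by (rule traj_rescale[OF \<phi>, where m = "- 1" and c = 1]) auto
  then have "traj (reversed a) (\<phi> 1) (\<lambda>s. \<phi> (1 - s))" by (simp add: reversed_def[abs_def])
  from flow_eq[OF control_reversed[OF a] this] \<phi> show ?thesis by (simp add: flow_eq[OF a \<phi>] traj_def)
qed

definition scaled :: "(real \<Rightarrow> 'z) \<Rightarrow> real \<Rightarrow> real \<Rightarrow> 'z" where "scaled a r s = r *\<^sub>R a (r * s)"

lemma control_scaled:
  assumes a: "control R a" and r: "r \<in> {0..1}"
  shows "control R (scaled a r)"
  unfolding control_def
proof (intro conjI ballI)
  have R: "0 \<le> R" by (rule control_nonneg[OF a])
  have rs: "r * s \<in> {0..1}" if "s \<in> {0..1}" for s using r that by (auto simp: mult_le_one)
  show "norm (scaled a r s) \<le> R" if s: "s \<in> {0..1}" for s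
  proof -
    have "r * norm (a (r * s)) \<le> 1 * R" using r control_norm[OF a rs[OF s]] by (intro mult_mono) auto
    then show ?thesis using r by (simp add: scaled_def)
  qed
  show "norm (scaled a r s - scaled a r t) \<le> R * \<bar>s - t\<bar>" if s: "s \<in> {0..1}" and t: "t \<in> {0..1}" for s t
  proof -
    have "norm (scaled a r s - scaled a r t) = r * norm (a (r * s) - a (r * t))"
      using r by (simp add: scaled_def scaleR_diff_right[symmetric])
    also have "\<dots> \<le> 1 * (R * \<bar>r * s - r * t\<bar>)"
      using r control_lipschitz[OF a rs[OF s] rs[OF t]] by (intro mult_mono) auto
    also have "\<bar>r * s - r * t\<bar> = r * \<bar>s - t\<bar>" using r by (simp add: right_diff_distrib[symmetric] abs_mult)
    also have "1 * (R * (r * \<bar>s - t\<bar>)) \<le> R * \<bar>s - t\<bar>"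
      using r R by (simp add: mult_left_mono mult_left_le_one_le)
    finally show ?thesis .
  qed
qed

lemma flow_scaled:
  assumes a: "control R a" and \<phi>: "traj a z \<phi>" and r: "r \<in> {0..1}"
  shows "flow (scaled a r) z = \<phi> r"
proof -
  have "traj (\<lambda>s. r *\<^sub>R a (r * s)) (\<phi> 0) (\<lambda>s. \<phi> (r * s))"
    by (rule traj_rescale[OF \<phi>, where c = 0]) (use r in \<open>auto simp: mult_le_one\<close>)
  then have "traj (scaled a r) z (\<lambda>s. \<phi> (r * s))" using \<phi> by (simp add: scaled_def[abs_def] traj_def)
  from flow_eq[OF control_scaled[OF a r] this] show ?thesis by simp
qed

lemma flow_scaled_dist:
  assumes a: "control R a" and z: "norm z \<le> 1" and r: "r \<in> {0..1}" "q \<in> {0..1}"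
  shows "norm (flow (scaled a r) z - flow (scaled a q) z) \<le> 5 * R * \<bar>r - q\<bar>"
proof -
  obtain \<phi> where \<phi>: "traj a z \<phi>" by (rule traj_exists[OF a z])
  have le: "norm (\<phi> v - \<phi> u) \<le> 5 * R * (v - u)" if "u \<in> {0..1}" "v \<in> {0..1}" "u \<le> v" for u v
  proof -
    have "norm (\<phi> v - \<phi> u) \<le> (\<lambda>r. 5 * R * r) v - (\<lambda>r. 5 * R * r) u"
    proof (rule vector_derivative_bound[where \<phi>' = "\<lambda>_. 5 * R"])
      show "(\<phi> has_vector_derivative vf (a s) (\<phi> s)) (at s within {0..1})" if "s \<in> {0..1}" for s
        using \<phi> that by (simp add: traj_def)
      fix s assume "s \<in> {u..v}"
      then have s: "s \<in> {0..1}" using that by auto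
      then have "norm (vf (a s) (\<phi> s)) \<le> 5 * norm (a s)" using \<phi> by (intro vf_norm_le) (simp add: traj_def)
      with control_norm[OF a s] show "norm (vf (a s) (\<phi> s)) \<le> 5 * R" by linarith
    qed (use that in \<open>auto intro!: derivative_eq_intros\<close>)
    then show ?thesis by (simp add: algebra_simps)
  qed
  have "norm (\<phi> r - \<phi> q) \<le> 5 * R * \<bar>r - q\<bar>"
    using le[of q r] le[of r q] r by (cases "q \<le> r") (auto simp: norm_minus_commute)
  then show ?thesis by (simp only: flow_scaled[OF a \<phi> r(1)] flow_scaled[OF a \<phi> r(2)])
qed

text \<open>The derivative of the flow in the initial value is the solution of the linearized equation; the
  error term satisfies a Gronwall inequality with a quadratic inhomogeneity.\<close>

lemma flow_holomorphic:
  assumes a: "control R a"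
  shows "holomorphic_map_on (flow a) (ball 0 1)"
  unfolding holomorphic_map_on_def
proof
  fix z :: 'z assume "z \<in> ball 0 1"
  then have z: "norm z < 1" by simp
  have R: "0 \<le> R" by (rule control_nonneg[OF a])
  obtain \<phi> where \<phi>: "traj a z \<phi>" using traj_exists[OF a] z by (metis less_imp_le)
  have \<phi>1: "norm (\<phi> s) \<le> 1" if "s \<in> {0..1}" for s using \<phi> that by (simp add: traj_def)
  have \<phi>D: "(\<phi> has_vector_derivative vf (a s) (\<phi> s)) (at s within {0..1})" if "s \<in> {0..1}" for s
    using \<phi> that by (simp add: traj_def)
  have \<phi>C: "continuous_on {0..1} \<phi>"
    using \<phi>D has_vector_derivative_continuous continuous_on_eq_continuous_within by metis
  define G where "G s x = - (2 *\<^sub>R tp (\<phi> s) (a s) x)" for s x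
  have Gle: "norm (G s x) \<le> 8 * R * norm x" if s: "s \<in> {0..1}" for s x
  proof -
    have "norm (\<phi> s) * norm (a s) * norm x \<le> 1 * R * norm x"
      using \<phi>1[OF s] control_norm[OF a s] R by (intro mult_right_mono mult_mono) auto
    then show ?thesis using tp_norm_le[of "\<phi> s" "a s" x] by (simp add: G_def)
  qed
  have Glin: "G s (x + y) = G s x + G s y" "G s (x - y) = G s x - G s y" "G s (c *\<^sub>C x) = c *\<^sub>C G s x" for s x y c
    by (simp_all add: G_def tp_real_linear tp_scaleC scaleC.minus_right scaleC.scaleR_right algebra_simps)
  define lin where "lin h W \<longleftrightarrow> W 0 = h \<and> (\<forall>s\<in>{0..1}. (W has_vector_derivative G s (W s)) (at s within {0..1}))" for h W
  have lin_ex: "\<exists>W. lin h W" for h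
  proof -
    obtain W where "W 0 = h" "\<And>s. s \<in> {0..1} \<Longrightarrow> (W has_vector_derivative G s (W s)) (at s within {0..1})"
    proof (rule ode_exists[of G "8 * R" h])
      show "continuous_on {0..1} (\<lambda>s. G s (\<psi> s))" if "continuous_on {0..1} \<psi>" for \<psi>
        unfolding G_def by (intro continuous_intros continuous_on_tp \<phi>C control_continuous[OF a] that)
      show "norm (G s x - G s y) \<le> 8 * R * norm (x - y)" if "s \<in> {0..1}" for s x y
        using Gle[OF that, of "x - y"] by (simp add: Glin)
    qed (use R in auto)
    then show ?thesis by (auto simp: lin_def)
  qed
  have lin_le: "norm (W s) \<le> 2 * exp (16 * R) * norm h" if "lin h W" "s \<in> {0..1}" for h W s
  proof -
    have "norm (W s) \<le> 2 * (norm (W 0) + 0) * exp (2 * (8 * R))"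
      by (rule gronwall[where e' = "\<lambda>s. G s (W s)"]) (use that Gle R in \<open>auto simp: lin_def\<close>)
    with that show ?thesis by (simp add: lin_def mult_ac)
  qed
  define V where "V h = (SOME W. lin h W) 1" for h
  have lin_some: "lin h (SOME W. lin h W)" for h using lin_ex by (rule someI_ex)
  have V_eq: "V h = W 1" if "lin h W" for h W
  proof -
    have "lin 0 (\<lambda>s. (SOME W. lin h W) s - W s)"
      using lin_some[of h] that by (auto simp: lin_def Glin intro!: has_vector_derivative_diff)
    from lin_le[OF this, of 1] show ?thesis by (simp add: V_def)
  qed
  have Vadd: "V (x + y) = V x + V y" for x y
  proof -
    have "lin (x + y) (\<lambda>s. (SOME W. lin x W) s + (SOME W. lin y W) s)"
      using lin_some[of x] lin_some[of y] by (auto simp: lin_def Glin intro!: has_vector_derivative_add)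
    from V_eq[OF this] show ?thesis by (simp add: V_def)
  qed
  have Vscale: "V (c *\<^sub>C x) = c *\<^sub>C V x" for c x
  proof -
    have "lin (c *\<^sub>C x) (\<lambda>s. c *\<^sub>C (SOME W. lin x W) s)"
      using lin_some[of x] bounded_linear.has_vector_derivative[OF scaleC.bounded_linear_right[of c]]
      by (auto simp: lin_def Glin)
    from V_eq[OF this] show ?thesis by (simp add: V_def)
  qed
  have bV: "bounded_clinear_map V"
    by (rule bounded_clinear_mapI[where K = "2 * exp (16 * R)"])
      (use Vadd Vscale lin_le[OF lin_some, of 1] in \<open>auto simp: clinear_map_def V_def\<close>)
  define C where "C = 2 * exp (16 * R)"
  define K where "K = 2 * (4 * R * C\<^sup>2) * exp (16 * R)"
  have C0: "0 \<le> C" by (simp add: C_def)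
  have K0: "0 \<le> K" using R by (simp add: K_def)
  have err: "norm (flow a (z + h) - flow a z - V h) \<le> K * (norm h)\<^sup>2" if h: "norm (z + h) \<le> 1" for h
  proof -
    obtain \<psi> where \<psi>: "traj a (z + h) \<psi>" by (rule traj_exists[OF a h])
    obtain W where W: "lin h W" using lin_ex by blast
    define e where "e s = \<psi> s - \<phi> s - W s" for s
    have dle: "norm (\<psi> s - \<phi> s) \<le> C * norm h" if "s \<in> {0..1}" for s
      using traj_diff_le[OF a \<psi> \<phi> that] by (simp add: C_def)
    have "norm (e 1) \<le> 2 * (norm (e 0) + 4 * R * C\<^sup>2 * (norm h)\<^sup>2) * exp (2 * (8 * R))"
    proof (rule gronwall)
      show "(e has_vector_derivative (vf (a s) (\<psi> s) - vf (a s) (\<phi> s) - G s (W s))) (at s within {0..1})"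
        if "s \<in> {0..1}" for s
        unfolding e_def using \<psi> W that \<phi>D[OF that]
        by (intro has_vector_derivative_diff) (auto simp: traj_def lin_def)
      fix s :: real assume s: "s \<in> {0..1}"
      define d where "d = \<psi> s - \<phi> s"
      have "tp d (a s) (\<phi> s) = tp (\<phi> s) (a s) d" by (rule tp_commute)
      moreover have "\<psi> s = \<phi> s + d" by (simp add: d_def)
      ultimately have "vf (a s) (\<psi> s) - vf (a s) (\<phi> s) - G s (W s) = G s (e s) - tp d (a s) d"
        by (simp add: vf_def G_def e_def tp_real_linear scaleR_2 algebra_simps)
      then have "norm (vf (a s) (\<psi> s) - vf (a s) (\<phi> s) - G s (W s)) \<le> norm (G s (e s)) + norm (tp d (a s) d)"
        by (simp only: norm_triangle_ineq4)
      moreover have "norm (tp d (a s) d) \<le> 4 * R * C\<^sup>2 * (norm h)\<^sup>2"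
      proof -
        have "norm d * norm (a s) * norm d \<le> (C * norm h) * R * (C * norm h)"
          using dle[OF s] control_norm[OF a s] R C0 unfolding d_def by (intro mult_mono) auto
        then show ?thesis using tp_norm_le[of d "a s" d] by (simp add: power2_eq_square mult_ac)
      qed
      ultimately show "norm (vf (a s) (\<psi> s) - vf (a s) (\<phi> s) - G s (W s)) \<le> 8 * R * norm (e s) + 4 * R * C\<^sup>2 * (norm h)\<^sup>2"
        using Gle[OF s, of "e s"] by linarith
    qed (use R in auto)
    moreover have "e 0 = 0" using \<psi> \<phi> W by (simp add: e_def traj_def lin_def)
    moreover have "e 1 = flow a (z + h) - flow a z - V h"
      by (simp add: e_def flow_eq[OF a \<psi>] flow_eq[OF a \<phi>] V_eq[OF W])
    ultimately show ?thesis by (simp add: K_def mult_ac)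
  qed
  have "(flow a has_derivative V) (at z)"
    unfolding has_derivative_at_alt
  proof (intro conjI allI impI)
    show "bounded_linear V" by (rule bounded_clinear_map_bounded_linear[OF bV])
    fix e :: real assume e: "0 < e"
    define \<delta> where "\<delta> = min (1 - norm z) (e / (K + 1))"
    have "0 < \<delta>" using z e K0 by (simp add: \<delta>_def)
    moreover have "norm (flow a y - flow a z - V (y - z)) \<le> e * norm (y - z)" if "norm (y - z) < \<delta>" for y
    proof -
      have "norm y \<le> 1" using that norm_triangle_ineq[of z "y - z"] by (simp add: \<delta>_def)
      then have "norm (flow a y - flow a z - V (y - z)) \<le> K * norm (y - z) * norm (y - z)"
        using err[of "y - z"] by (simp add: power2_eq_square)
      also have "K * norm (y - z) \<le> (K + 1) * (e / (K + 1))"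
        using that K0 by (intro mult_mono) (auto simp: \<delta>_def)
      then have "K * norm (y - z) * norm (y - z) \<le> e * norm (y - z)" using K0 by (intro mult_right_mono) auto
      finally show ?thesis .
    qed
    ultimately show "\<exists>d>0. \<forall>y. norm (y - z) < d \<longrightarrow> norm (flow a y - flow a z - V (y - z)) \<le> e * norm (y - z)"
      by blast
  qed
  with bV show "\<exists>D. (flow a has_derivative D) (at z) \<and> bounded_clinear_map D" by blast
qed

text \<open>Every point \<open>b\<close> of the open ball is reached from the origin: the segment \<open>s \<mapsto> s b\<close> is the
  trajectory of the control \<open>a s = \<Sum>n. s\<^sup>2\<^sup>n b\<^sup>2\<^sup>n\<^sup>+\<^sup>1\<close>, which solves \<open>a - {s b, a, s b} = b\<close>.\<close>

lemma flow_reaches: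
  assumes b: "norm b < 1"
  obtains R a where "control R a" "flow a 0 = b"
proof -
  define \<rho> where "\<rho> = (norm b)\<^sup>2"
  have \<rho>: "0 \<le> \<rho>" "\<rho> < 1" using b by (auto simp: \<rho>_def power_less_one_iff)
  have pw_le: "norm (pw b n) \<le> \<rho> ^ n * norm b" for n
    unfolding pw_def \<rho>_def by (rule funpow_norm_le[OF square_norm_le]) simp
  define a where "a s = (\<Sum>n. (s\<^sup>2) ^ n *\<^sub>R pw b n)" for s :: real
  have s2: "\<bar>s\<^sup>2\<bar> \<le> 1" if "s \<in> {0..1}" for s :: real using that by (simp add: power_le_one)
  have summ: "summable (\<lambda>n. (s\<^sup>2) ^ n *\<^sub>R pw b n)" if s: "s \<in> {0..1}" for s :: real
  proof (rule summable_comparison_test')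
    show "summable (\<lambda>n. \<rho> ^ n * norm b)" using \<rho> by (intro summable_mult2 summable_geometric) auto
    fix n
    have "\<bar>s\<^sup>2\<bar> ^ n * norm (pw b n) \<le> 1 * (\<rho> ^ n * norm b)"
      using s2[OF s] by (intro mult_mono pw_le power_le_one) auto
    then show "norm ((s\<^sup>2) ^ n *\<^sub>R pw b n) \<le> \<rho> ^ n * norm b" by (simp add: power_abs)
  qed
  have shift: "a s = b + s\<^sup>2 *\<^sub>R L (a s)"
    if s: "s \<in> {0..1}" and L: "bounded_linear L" "\<And>n. L (pw b n) = pw b (Suc n)" for s L
  proof -
    have "(\<lambda>n. s\<^sup>2 *\<^sub>R L ((s\<^sup>2) ^ n *\<^sub>R pw b n)) sums (s\<^sup>2 *\<^sub>R L (a s))"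
      unfolding a_def by (intro sums_scaleR_right bounded_linear.sums[OF L(1)] summable_sums summ[OF s])
    then have "(\<lambda>n. (s\<^sup>2) ^ Suc n *\<^sub>R pw b (Suc n)) sums (s\<^sup>2 *\<^sub>R L (a s))"
      by (simp add: linear_scale[OF bounded_linear.linear[OF L(1)]] L(2))
    from sums_Suc[OF this] have "(\<lambda>n. (s\<^sup>2) ^ n *\<^sub>R pw b n) sums (s\<^sup>2 *\<^sub>R L (a s) + b)" by simp
    then show ?thesis unfolding a_def by (simp add: sums_iff add.commute)
  qed
  have T: "a s = b + s\<^sup>2 *\<^sub>R tp b b (a s)" if "s \<in> {0..1}" for s
    by (rule shift[OF that]) (use bounded_clinear_map_bounded_linear[OF square_bounded] in \<open>auto simp: pw_Suc\<close>)
  have Q: "a s = b + s\<^sup>2 *\<^sub>R tp b (a s) b" if "s \<in> {0..1}" for s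
  proof (rule shift[OF that])
    show "bounded_linear (\<lambda>c. tp b c b)"
      by (rule bounded_linear_intro[of _ "4 * norm b * norm b"])
        (use tp_norm_le[of b _ b] in \<open>auto simp: tp_real_linear mult_ac\<close>)
    show "tp b (pw b n) b = pw b (Suc n)" for n using tp_pw_pw[of b n 0] by (simp add: tp_pw_left)
  qed
  define R0 where "R0 = norm b / (1 - \<rho>)"
  have R0: "0 \<le> R0" using \<rho> by (simp add: R0_def)
  have anorm: "norm (a s) \<le> R0" if s: "s \<in> {0..1}" for s
  proof -
    have "s\<^sup>2 * norm (tp b b (a s)) \<le> 1 * (\<rho> * norm (a s))"
      using s2[OF s] square_norm_le[of b "a s"] by (intro mult_mono) (auto simp: \<rho>_def)
    then have "norm (a s) \<le> norm b + \<rho> * norm (a s)"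
      using norm_triangle_ineq[of b "s\<^sup>2 *\<^sub>R tp b b (a s)"] T[OF s] by simp
    then show ?thesis using \<rho> by (simp add: R0_def field_simps)
  qed
  define R where "R = R0 + 2 * R0 / (1 - \<rho>)"
  have R: "R0 \<le> R" "2 * R0 / (1 - \<rho>) \<le> R" using R0 \<rho> by (simp_all add: R_def)
  have alip: "norm (a s - a t) \<le> R * \<bar>s - t\<bar>" if s: "s \<in> {0..1}" and t: "t \<in> {0..1}" for s t
  proof -
    have "a s - a t = s\<^sup>2 *\<^sub>R tp b b (a s) - t\<^sup>2 *\<^sub>R tp b b (a t)" using T[OF s] T[OF t] by (metis add_diff_cancel_left)
    also have "\<dots> = s\<^sup>2 *\<^sub>R tp b b (a s - a t) + (s\<^sup>2 - t\<^sup>2) *\<^sub>R tp b b (a t)"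
      by (simp add: tp_real_linear algebra_simps)
    finally have "norm (a s - a t) \<le> s\<^sup>2 * norm (tp b b (a s - a t)) + \<bar>s\<^sup>2 - t\<^sup>2\<bar> * norm (tp b b (a t))"
      using norm_triangle_ineq[of "s\<^sup>2 *\<^sub>R tp b b (a s - a t)" "(s\<^sup>2 - t\<^sup>2) *\<^sub>R tp b b (a t)"] by simp
    moreover have "s\<^sup>2 * norm (tp b b (a s - a t)) \<le> 1 * (\<rho> * norm (a s - a t))"
      using s2[OF s] square_norm_le[of b "a s - a t"] by (intro mult_mono) (auto simp: \<rho>_def)
    moreover have "\<bar>s\<^sup>2 - t\<^sup>2\<bar> * norm (tp b b (a t)) \<le> (2 * \<bar>s - t\<bar>) * R0"
    proof (rule mult_mono)
      have "s\<^sup>2 - t\<^sup>2 = (s + t) * (s - t)" by (simp add: power2_eq_square algebra_simps)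
      then show "\<bar>s\<^sup>2 - t\<^sup>2\<bar> \<le> 2 * \<bar>s - t\<bar>" using s t by (simp add: abs_mult mult_right_mono)
      have "norm (tp b b (a t)) \<le> \<rho> * norm (a t)" using square_norm_le[of b "a t"] by (simp add: \<rho>_def)
      also have "\<dots> \<le> 1 * R0" using \<rho> anorm[OF t] by (intro mult_mono) auto
      finally show "norm (tp b b (a t)) \<le> R0" by simp
    qed auto
    ultimately have "(1 - \<rho>) * norm (a s - a t) \<le> 2 * R0 * \<bar>s - t\<bar>" by (simp add: algebra_simps)
    then have "norm (a s - a t) \<le> 2 * R0 / (1 - \<rho>) * \<bar>s - t\<bar>" using \<rho> by (simp add: field_simps)
    also have "\<dots> \<le> R * \<bar>s - t\<bar>" using R by (intro mult_right_mono) auto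
    finally show ?thesis .
  qed
  have c: "control R a" unfolding control_def using anorm alip R by force
  have "traj a 0 (\<lambda>s. s *\<^sub>R b)"
    unfolding traj_def
  proof (intro conjI ballI)
    fix s :: real assume s: "s \<in> {0..1}"
    show "norm (s *\<^sub>R b) \<le> 1" using s b by (simp add: mult_le_one)
    have "vf (a s) (s *\<^sub>R b) = a s - s\<^sup>2 *\<^sub>R tp b (a s) b"
      by (simp add: vf_def tp_real_linear power2_eq_square)
    also have "\<dots> = b" using Q[OF s] by (metis add_diff_cancel_right')
    finally show "((\<lambda>s. s *\<^sub>R b) has_vector_derivative vf (a s) (s *\<^sub>R b)) (at s within {0..1})"
      by (auto intro!: derivative_eq_intros)
  qed simp
  from flow_eq[OF c this] have "flow a 0 = b" by simp
  with c that show thesis by blast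
qed

end

section \<open>Holomorphic self-maps of the ball and Cartan's uniqueness theorem\<close>

lemma bounded_clinear_map_compose:
  assumes "bounded_clinear_map S" "bounded_clinear_map T"
  shows "bounded_clinear_map (\<lambda>x. S (T x))"
  using assms bounded_linear_compose[of S T] by (auto simp: bounded_clinear_map_def clinear_map_def)

lemma holomorphic_map_on_compose:
  assumes "holomorphic_map_on f S" "holomorphic_map_on g U" "\<And>x. x \<in> S \<Longrightarrow> f x \<in> U"
  shows "holomorphic_map_on (\<lambda>x. g (f x)) S"
  unfolding holomorphic_map_on_def
proof
  fix x assume x: "x \<in> S"
  obtain D where D: "(f has_derivative D) (at x)" "bounded_clinear_map D"
    using assms(1) x unfolding holomorphic_map_on_def by blast
  obtain E where E: "(g has_derivative E) (at (f x))" "bounded_clinear_map E"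
    using assms(2) assms(3)[OF x] unfolding holomorphic_map_on_def by blast
  show "\<exists>D. ((\<lambda>x. g (f x)) has_derivative D) (at x) \<and> bounded_clinear_map D"
    using has_derivative_compose[OF D(1) E(1)] bounded_clinear_map_compose[OF E(2) D(2)] by blast
qed

lemma holomorphic_map_on_transform:
  assumes f: "holomorphic_map_on f S" and S: "open S" and eq: "\<And>x. x \<in> S \<Longrightarrow> f x = g x"
  shows "holomorphic_map_on g S"
  unfolding holomorphic_map_on_def
proof
  fix x assume x: "x \<in> S"
  obtain D where D: "(f has_derivative D) (at x)" "bounded_clinear_map D"
    using f x unfolding holomorphic_map_on_def by blast
  have "(g has_derivative D) (at x)"
    by (rule has_derivative_transform_within_open[OF D(1) S x eq])
  with D(2) show "\<exists>D. (g has_derivative D) (at x) \<and> bounded_clinear_map D" by blast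
qed

lemma bounded_clinear_map_holomorphic: "bounded_clinear_map T \<Longrightarrow> holomorphic_map_on T S"
  using bounded_linear_imp_has_derivative unfolding holomorphic_map_on_def bounded_clinear_map_def by blast

lemma bounded_clinear_map_scaleC_left: "bounded_clinear_map (\<lambda>x. c *\<^sub>C (x::'a::complex_banach))"
  by (rule bounded_clinear_mapI[where K = "cmod c"])
    (auto simp: clinear_map_def scaleC_add_right scaleC_scaleC mult.commute norm_scaleC)

lemma holomorphic_map_on_diff:
  assumes "holomorphic_map_on f S" "holomorphic_map_on g S"
  shows "holomorphic_map_on (\<lambda>x. f x - g x) S"
  unfolding holomorphic_map_on_def
proof
  fix x assume x: "x \<in> S"
  obtain D E where D: "(f has_derivative D) (at x)" "bounded_clinear_map D"
    and E: "(g has_derivative E) (at x)" "bounded_clinear_map E"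
    using assms x unfolding holomorphic_map_on_def by blast
  have "bounded_clinear_map (\<lambda>x. D x - E x)"
    using D(2) E(2) bounded_linear_sub[of D E]
    by (auto simp: bounded_clinear_map_def clinear_map_def scaleC.diff_right)
  with has_derivative_diff[OF D(1) E(1)]
  show "\<exists>D. ((\<lambda>x. f x - g x) has_derivative D) (at x) \<and> bounded_clinear_map D" by blast
qed

lemma slice_has_field_derivative:
  assumes D: "(f has_derivative D) (at (p + l *\<^sub>C q))" "bounded_clinear_map D" and \<Psi>: "dual_unit \<Psi>"
  shows "((\<lambda>c. \<Psi> (f (p + c *\<^sub>C q))) has_field_derivative \<Psi> (D q)) (at l)"
proof -
  have "((\<lambda>c. p + c *\<^sub>C q) has_derivative (\<lambda>c. 0 + c *\<^sub>C q)) (at l)"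
    by (intro has_derivative_add has_derivative_const bounded_linear_imp_has_derivative scaleC.bounded_linear_left)
  then have "((\<lambda>c. p + c *\<^sub>C q) has_derivative (\<lambda>c. c *\<^sub>C q)) (at l)" by simp
  from has_derivative_compose[OF this D(1)]
  have "((\<lambda>c. f (p + c *\<^sub>C q)) has_derivative (\<lambda>c. D (c *\<^sub>C q))) (at l)" .
  from bounded_linear.has_derivative[OF dual_unit_bounded_linear[OF \<Psi>] this]
  have "((\<lambda>c. \<Psi> (f (p + c *\<^sub>C q))) has_derivative (\<lambda>c. \<Psi> (D (c *\<^sub>C q)))) (at l)" .
  moreover have "(\<lambda>c. \<Psi> (D (c *\<^sub>C q))) = (*) (\<Psi> (D q))"
    by (simp add: fun_eq_iff bounded_clinear_map_scaleC[OF D(2)] dual_unit_scaleC[OF \<Psi>] mult.commute)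
  ultimately show ?thesis by (simp add: has_field_derivative_def)
qed

lemma slice_holomorphic:
  assumes f: "holomorphic_map_on f S" and \<Psi>: "dual_unit \<Psi>" and A: "\<And>c. c \<in> A \<Longrightarrow> p + c *\<^sub>C q \<in> S"
  shows "(\<lambda>c. \<Psi> (f (p + c *\<^sub>C q))) holomorphic_on A"
  unfolding holomorphic_on_def
proof
  fix c assume "c \<in> A"
  then obtain D where "(f has_derivative D) (at (p + c *\<^sub>C q))" "bounded_clinear_map D"
    using f A unfolding holomorphic_map_on_def by blast
  from has_field_derivative_at_within[OF slice_has_field_derivative[OF this \<Psi>]]
  show "(\<lambda>c. \<Psi> (f (p + c *\<^sub>C q))) field_differentiable at c within A"
    unfolding field_differentiable_def by (rule exI)
qed

lemma divide_out_zero: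
  fixes h :: "complex \<Rightarrow> complex"
  assumes hol: "h holomorphic_on ball 0 1" and M: "\<And>w. cmod w < 1 \<Longrightarrow> cmod (h w) \<le> M" and h0: "h 0 = 0"
  obtains h1 where "h1 holomorphic_on ball 0 1" "\<And>w. h w = w * h1 w" "\<And>w. cmod w < 1 \<Longrightarrow> cmod (h1 w) \<le> M"
proof -
  define h1 where "h1 w = (if w = 0 then deriv h 0 else (h w - h 0) / (w - 0))" for w
  have h1: "h1 holomorphic_on ball 0 1"
    using pole_lemma_open[OF hol open_ball, of 0] by (simp only: h1_def[abs_def])
  have hw: "h w = w * h1 w" for w by (simp add: h1_def h0)
  have "cmod (h1 w) \<le> M" if w: "cmod w < 1" for w
  proof (rule field_le_mult_one_interval)
    fix \<rho> :: real assume \<rho>: "0 < \<rho>" "\<rho> < 1"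
    define q where "q = max \<rho> ((1 + cmod w) / 2)"
    have \<rho>q: "\<rho> \<le> q" "(1 + cmod w) / 2 \<le> q" unfolding q_def by (rule max.cobounded1, rule max.cobounded2)
    have q1: "q < 1" unfolding q_def using \<rho> w by (intro max_less_iff_conj[THEN iffD2] conjI) auto
    have w2: "cmod w < (1 + cmod w) / 2" using w by (simp add: less_divide_eq)
    have q: "0 < q" "q < 1" "cmod w < q" "\<rho> \<le> q"
      using \<rho>q \<rho>(1) q1 order_less_le_trans[OF w2 \<rho>q(2)] by (blast intro: order_less_le_trans)+
    have "norm (h1 w) \<le> M / q"
    proof (rule maximum_modulus_frontier[where f = h1 and S = "ball 0 q"])
      have sub: "ball 0 q \<subseteq> ball (0::complex) 1" "cball 0 q \<subseteq> ball (0::complex) 1"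
        using q(2) by (simp_all add: subset_ball cball_subset_ball_iff less_imp_le)
      show "h1 holomorphic_on interior (ball 0 q)"
        by (simp only: interior_open[OF open_ball]) (rule holomorphic_on_subset[OF h1 sub(1)])
      show "continuous_on (closure (ball 0 q)) h1"
        by (simp only: closure_ball[OF q(1)])
          (rule continuous_on_subset[OF holomorphic_on_imp_continuous_on[OF h1] sub(2)])
      fix z :: complex assume "z \<in> frontier (ball 0 q)"
      then have z: "cmod z = q" by (simp only: frontier_ball[OF q(1)] sphere_def mem_Collect_eq dist_0_norm)
      then have "cmod (h z) \<le> M" using q(2) by (intro M) simp
      then have "q * cmod (h1 z) \<le> M" by (simp only: hw[of z] norm_mult z)
      then show "norm (h1 z) \<le> M / q" using q(1) by (simp only: pos_le_divide_eq mult.commute)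
    qed (use q in auto)
    then have "q * cmod (h1 w) \<le> M" using q(1) by (simp only: pos_le_divide_eq mult.commute)
    moreover have "\<rho> * cmod (h1 w) \<le> q * cmod (h1 w)" using q by (intro mult_right_mono) auto
    ultimately show "\<rho> * cmod (h1 w) \<le> M" by linarith
  qed
  with h1 hw that show thesis by blast
qed

lemma zero_of_little_o:
  fixes h :: "complex \<Rightarrow> complex"
  assumes "\<And>e. 0 < e \<Longrightarrow> \<exists>r>0. \<forall>w. cmod w < r \<longrightarrow> cmod (h w) \<le> e * cmod w ^ m"
  shows "h 0 = 0"
proof -
  have "cmod (h 0) \<le> 0 + e" if e: "0 < e" for e
  proof -
    obtain r where "r > 0" "\<forall>w. cmod w < r \<longrightarrow> cmod (h w) \<le> e * cmod w ^ m" using assms[OF e] by blast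
    then have "cmod (h 0) \<le> e * cmod 0 ^ m" by (metis norm_zero)
    also have "\<dots> \<le> e * 1" using e by (intro mult_left_mono power_le_one) auto
    finally show ?thesis by simp
  qed
  then have "cmod (h 0) \<le> 0" by (rule field_le_epsilon)
  then show ?thesis by simp
qed

text \<open>Schwarz' lemma for a zero of higher order, by dividing out one zero at a time.\<close>

lemma schwarz_order_scalar:
  fixes h :: "complex \<Rightarrow> complex"
  assumes "h holomorphic_on ball 0 1" and "\<forall>w. cmod w < 1 \<longrightarrow> cmod (h w) \<le> M"
    and "\<forall>e>0. \<exists>r>0. \<forall>w. cmod w < r \<longrightarrow> cmod (h w) \<le> e * cmod w ^ m"
    and "cmod w < 1"
  shows "cmod (h w) \<le> M * cmod w ^ Suc m"
  using assms
proof (induction m arbitrary: h w)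
  case 0
  have "h 0 = 0" by (rule zero_of_little_o[where m = 0]) (use 0(3) in blast)
  with 0(1,2) obtain h1 where "\<And>w. h w = w * h1 w" "\<And>w. cmod w < 1 \<Longrightarrow> cmod (h1 w) \<le> M"
    using divide_out_zero[of h M] by blast
  then show ?case using mult_right_mono[of "cmod (h1 w)" M "cmod w"] 0(4) by (simp add: norm_mult mult.commute)
next
  case (Suc m)
  have "h 0 = 0" by (rule zero_of_little_o[where m = "Suc m"]) (use Suc.prems(3) in blast)
  with Suc.prems(1,2) obtain h1 where h1: "h1 holomorphic_on ball 0 1"
    "\<And>w. h w = w * h1 w" "\<And>w. cmod w < 1 \<Longrightarrow> cmod (h1 w) \<le> M"
    using divide_out_zero[of h M] by blast
  have "cmod (h1 w) \<le> M * cmod w ^ Suc m"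
  proof (rule Suc.IH[OF h1(1) _ _ Suc.prems(4)])
    show "\<forall>w. cmod w < 1 \<longrightarrow> cmod (h1 w) \<le> M" using h1(3) by blast
    show "\<forall>e>0. \<exists>r>0. \<forall>w. cmod w < r \<longrightarrow> cmod (h1 w) \<le> e * cmod w ^ m"
    proof (intro allI impI)
      fix e :: real assume "0 < e"
      then obtain r where r: "r > 0" "\<And>w. cmod w < r \<Longrightarrow> cmod (h w) \<le> e * cmod w ^ Suc m"
        using Suc.prems(3) by blast
      have off: "cmod (h1 w) \<le> e * cmod w ^ m" if "cmod w < r" "w \<noteq> 0" for w
      proof -
        have "cmod w * cmod (h1 w) \<le> cmod w * (e * cmod w ^ m)"
          using r(2)[OF that(1)] unfolding h1(2)[of w] by (simp add: norm_mult mult_ac)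
        moreover have "0 < cmod w" using that by simp
        ultimately show ?thesis by (rule mult_left_le_imp_le)
      qed
      have "cmod (h1 0) \<le> e * cmod 0 ^ m"
      proof (rule tendsto_le[of "at 0"])
        have "continuous (at 0) h1"
          using holomorphic_on_imp_continuous_on[OF h1(1)] by (simp add: continuous_on_eq_continuous_at)
        then show "((\<lambda>w. cmod (h1 w)) \<longlongrightarrow> cmod (h1 0)) (at 0)"
          by (intro tendsto_norm) (simp add: isCont_def)
        show "((\<lambda>w::complex. e * cmod w ^ m) \<longlongrightarrow> e * cmod 0 ^ m) (at 0)" by (intro tendsto_intros)
        show "\<forall>\<^sub>F w in at 0. cmod (h1 w) \<le> e * cmod w ^ m"
          unfolding eventually_at by (rule exI[of _ r]) (use off r(1) in \<open>auto simp: dist_norm\<close>)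
      qed simp
      with off have "\<forall>w. cmod w < r \<longrightarrow> cmod (h1 w) \<le> e * cmod w ^ m" by metis
      with r(1) show "\<exists>r>0. \<forall>w. cmod w < r \<longrightarrow> cmod (h1 w) \<le> e * cmod w ^ m" by blast
    qed
  qed
  then have "cmod w * cmod (h1 w) \<le> cmod w * (M * cmod w ^ Suc m)" by (intro mult_left_mono) auto
  then show ?case unfolding h1(2)[of w] by (simp add: norm_mult mult_ac)
qed

text \<open>Restricted to complex lines through the origin and composed with functionals, this is the scalar statement.
  The hypothesis \<open>o(\<parallel>z\<parallel>\<^sup>m)\<close> is what both differentiability and a bound by the next power provide.\<close>

lemma schwarz_order:
  fixes g :: "'a::complex_banach \<Rightarrow> 'b::complex_banach"
  assumes hol: "holomorphic_map_on g (ball 0 1)" and M: "\<And>z. norm z < 1 \<Longrightarrow> norm (g z) \<le> M"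
    and small: "\<And>e. 0 < e \<Longrightarrow> \<exists>r>0. \<forall>z. norm z < r \<longrightarrow> norm (g z) \<le> e * norm z ^ m"
    and z: "norm z < 1"
  shows "norm (g z) \<le> M * norm z ^ Suc m"
proof (rule norm_le_dual)
  fix \<Psi> :: "'b \<Rightarrow> complex" assume \<Psi>: "dual_unit \<Psi>"
  have "\<exists>u::'a. norm u \<le> 1 \<and> norm z *\<^sub>R u = z"
  proof (cases "z = 0")
    case False
    then show ?thesis by (intro exI[of _ "z /\<^sub>R norm z"]) simp
  qed (auto intro: exI[of _ 0])
  then obtain u :: 'a where u: "norm u \<le> 1" "norm z *\<^sub>R u = z" by blast
  have nu: "norm (c *\<^sub>C u) \<le> cmod c" for c
    using mult_left_mono[OF u(1), of "cmod c"] by (simp add: norm_scaleC)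
  define h where "h c = \<Psi> (g (0 + c *\<^sub>C u))" for c
  have "cmod (h (of_real (norm z))) \<le> M * cmod (of_real (norm z)) ^ Suc m"
  proof (rule schwarz_order_scalar)
    show "h holomorphic_on ball 0 1"
      unfolding h_def
    proof (rule slice_holomorphic[OF hol \<Psi>])
      fix c :: complex assume "c \<in> ball 0 1"
      then have "cmod c < 1" by simp
      with nu[of c] show "0 + c *\<^sub>C u \<in> ball 0 1" by simp
    qed
    show "\<forall>w. cmod w < 1 \<longrightarrow> cmod (h w) \<le> M"
    proof (intro allI impI)
      fix w :: complex assume "cmod w < 1"
      with nu[of w] have "norm (g (w *\<^sub>C u)) \<le> M" by (intro M) simp
      with dual_unit_norm[OF \<Psi>, of "g (w *\<^sub>C u)"] show "cmod (h w) \<le> M" by (simp add: h_def)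
    qed
    show "\<forall>e>0. \<exists>r>0. \<forall>w. cmod w < r \<longrightarrow> cmod (h w) \<le> e * cmod w ^ m"
    proof (intro allI impI)
      fix e :: real assume e: "0 < e"
      then obtain r where r: "r > 0" "\<And>z. norm z < r \<Longrightarrow> norm (g z) \<le> e * norm z ^ m" using small by blast
      have "cmod (h w) \<le> e * cmod w ^ m" if "cmod w < r" for w
      proof -
        have "cmod (h w) \<le> norm (g (w *\<^sub>C u))" using dual_unit_norm[OF \<Psi>] by (simp add: h_def)
        also have "\<dots> \<le> e * norm (w *\<^sub>C u) ^ m" using nu[of w] that by (intro r) simp
        also have "\<dots> \<le> e * cmod w ^ m" using nu[of w] e by (intro mult_left_mono power_mono) auto
        finally show ?thesis .
      qed
      with r(1) show "\<exists>r>0. \<forall>w. cmod w < r \<longrightarrow> cmod (h w) \<le> e * cmod w ^ m" by blast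
    qed
  qed (use z in simp)
  then show "cmod (\<Psi> (g z)) \<le> M * norm z ^ Suc m" by (simp add: h_def scaleC_of_real u)
qed

lemma little_o_of_power:
  fixes g :: "'a::real_normed_vector \<Rightarrow> 'b::real_normed_vector"
  assumes r: "0 < r" and C: "\<And>z. norm z < r \<Longrightarrow> norm (g z) \<le> C * norm z ^ Suc m" and e: "0 < e"
  shows "\<exists>r>0. \<forall>z. norm z < r \<longrightarrow> norm (g z) \<le> e * norm z ^ m"
proof (intro exI conjI allI impI)
  show "0 < min r (e / (\<bar>C\<bar> + 1))" using r e by simp
  fix z :: 'a assume z: "norm z < min r (e / (\<bar>C\<bar> + 1))"
  have "norm (g z) \<le> C * norm z ^ Suc m" using z by (intro C) simp
  also have "\<dots> \<le> (\<bar>C\<bar> + 1) * norm z ^ Suc m" by (intro mult_right_mono) auto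
  also have "\<dots> = ((\<bar>C\<bar> + 1) * norm z) * norm z ^ m" by simp
  also have "\<dots> \<le> e * norm z ^ m"
  proof (rule mult_right_mono)
    have "norm z \<le> e / (\<bar>C\<bar> + 1)" using z by simp
    moreover have "0 < \<bar>C\<bar> + 1" by simp
    ultimately show "(\<bar>C\<bar> + 1) * norm z \<le> e" by (simp only: pos_le_divide_eq mult.commute)
  qed simp
  finally show "norm (g z) \<le> e * norm z ^ m" .
qed

lemma schwarz_ball:
  assumes hol: "holomorphic_map_on g (ball 0 1)" and g: "\<And>z. norm z < 1 \<Longrightarrow> norm (g z) < 1"
    and g0: "g 0 = 0" and z: "norm z < 1"
  shows "norm (g z) \<le> norm z"
proof -
  have "norm (g z) \<le> 1 * norm z ^ Suc 0"
  proof (rule schwarz_order[OF hol _ _ z])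
    show "norm (g z) \<le> 1" if "norm z < 1" for z using g[OF that] by simp
    fix e :: real assume e: "0 < e"
    obtain D where "(g has_derivative D) (at 0)" using hol by (force simp: holomorphic_map_on_def)
    then have "isCont g 0" by (rule has_derivative_continuous)
    then obtain r where "r > 0" "\<And>z. dist z 0 < r \<Longrightarrow> dist (g z) (g 0) < e"
      using e unfolding continuous_at_eps_delta by blast
    then have "\<forall>z. norm z < r \<longrightarrow> norm (g z) \<le> e * norm z ^ 0"
      by (simp add: dist_norm g0 less_imp_le)
    with \<open>r > 0\<close> show "\<exists>r>0. \<forall>z. norm z < r \<longrightarrow> norm (g z) \<le> e * norm z ^ 0" by blast
  qed
  then show ?thesis by simp
qed

text \<open>Cauchy's estimate for the first derivative, integrated along segments.\<close>

lemma holomorphic_lipschitz: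
  fixes K :: "'a::complex_banach \<Rightarrow> 'b::complex_banach"
  assumes hol: "holomorphic_map_on K (ball 0 1)" and r: "0 < r" "2 * r < 1"
    and B: "\<And>z. norm z \<le> 2 * r \<Longrightarrow> norm (K z) \<le> B"
    and z: "norm z \<le> r" and w: "norm w \<le> r"
  shows "norm (K z - K w) \<le> B / r * norm (z - w)"
proof -
  define D where "D p = (SOME D. (K has_derivative D) (at p) \<and> bounded_clinear_map D)" for p
  have D: "(K has_derivative D p) (at p) \<and> bounded_clinear_map (D p)" if "norm p \<le> r" for p
  proof -
    have "p \<in> ball 0 1" using that r by simp
    with hol have "\<exists>D. (K has_derivative D) (at p) \<and> bounded_clinear_map D"
      unfolding holomorphic_map_on_def by blast
    then show ?thesis unfolding D_def by (rule someI_ex)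
  qed
  have B0: "0 \<le> B" using order_trans[OF norm_ge_zero B[of 0]] r by simp
  show ?thesis
  proof (rule differentiable_bound[where S = "cball 0 r" and f' = D])
    fix p :: 'a assume "p \<in> cball 0 r"
    then have p: "norm p \<le> r" by simp
    from D[OF p] show "(K has_derivative D p) (at p within cball 0 r)" by (simp add: has_derivative_at_withinI)
    have unit: "norm (D p q) \<le> B / r" if q: "norm q = 1" for q
    proof (rule norm_le_dual)
      fix \<Psi> :: "'b \<Rightarrow> complex" assume \<Psi>: "dual_unit \<Psi>"
      define h where "h c = \<Psi> (K (p + c *\<^sub>C q))" for c
      have np: "norm (p + c *\<^sub>C q) \<le> 2 * r" if "cmod c \<le> r" for c
        using norm_triangle_ineq[of p "c *\<^sub>C q"] p q that by (simp add: norm_scaleC)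
      have hh: "h holomorphic_on cball 0 r"
        unfolding h_def
      proof (rule slice_holomorphic[OF hol \<Psi>])
        fix c :: complex assume "c \<in> cball 0 r"
        with np[of c] r show "p + c *\<^sub>C q \<in> ball 0 1" by simp
      qed
      have "norm ((deriv ^^ 1) h 0) \<le> fact 1 * B / r ^ 1"
      proof (rule Cauchy_inequality)
        show "h holomorphic_on ball 0 r" using hh by (rule holomorphic_on_subset) auto
        show "continuous_on (cball 0 r) h" using hh by (rule holomorphic_on_imp_continuous_on)
        fix c :: complex assume "norm (0 - c) = r"
        then have "norm (K (p + c *\<^sub>C q)) \<le> B" by (intro B np) simp
        then show "norm (h c) \<le> B" using dual_unit_norm[OF \<Psi>, of "K (p + c *\<^sub>C q)"] by (simp add: h_def)
      qed (rule r)
      moreover have "(K has_derivative D p) (at (p + 0 *\<^sub>C q))" using D[OF p] by (simp add: scaleC.zero_left)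
      then have "(h has_field_derivative \<Psi> (D p q)) (at 0)"
        unfolding h_def by (rule slice_has_field_derivative[OF _ conjunct2[OF D[OF p]] \<Psi>])
      then have "deriv h 0 = \<Psi> (D p q)" by (rule DERIV_imp_deriv)
      ultimately show "cmod (\<Psi> (D p q)) \<le> B / r" by simp
    qed
    show "onorm (D p) \<le> B / r"
    proof (rule onorm_bound)
      show "norm (D p x) \<le> B / r * norm x" for x
      proof (cases "x = 0")
        case True
        then show ?thesis using D[OF p] linear_0[OF bounded_clinear_map_linear] by auto
      next
        case False
        have "D p x = norm x *\<^sub>R D p (x /\<^sub>R norm x)"
          using False linear_scale[OF bounded_clinear_map_linear, of "D p"] D[OF p]
          by (metis norm_eq_zero right_inverse scaleR_one scaleR_scaleR)
        then have "norm (D p x) = norm x * norm (D p (x /\<^sub>R norm x))" by (metis norm_scaleR abs_norm_cancel)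
        also have "\<dots> \<le> norm x * (B / r)" using False by (intro mult_left_mono unit) auto
        finally show ?thesis by (simp only: mult.commute)
      qed
    qed (use B0 r in simp)
  qed (use z w in auto)
qed

text \<open>Cartan's uniqueness theorem. If \<open>K = k - id\<close> vanishes to order \<open>m\<close>, then so does \<open>k\<^sup>n - id\<close>, with the
  constant two of Schwarz' lemma independently of \<open>n\<close>. But \<open>k\<^sup>n - id\<close> is the sum of the \<open>K \<circ> k\<^sup>j\<close>, which is
  \<open>n K\<close> up to terms of higher order; so \<open>K\<close> vanishes to order \<open>m + 1\<close>.\<close>

lemma cartan_uniqueness:
  fixes k :: "'a::complex_banach \<Rightarrow> 'a"
  assumes hol: "holomorphic_map_on k (ball 0 1)" and kb: "\<And>z. norm z < 1 \<Longrightarrow> norm (k z) < 1"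
    and k0: "k 0 = 0" and kD: "(k has_derivative (\<lambda>x. x)) (at 0)" and z: "norm z < 1"
  shows "k z = z"
proof -
  have id: "holomorphic_map_on (\<lambda>x::'a. x) (ball 0 1)"
    using bounded_clinear_map_holomorphic[OF bounded_clinear_map_scaleC_left[of 1]] by simp
  have it: "holomorphic_map_on (k ^^ n) (ball 0 1) \<and> (\<forall>z. norm z < 1 \<longrightarrow> norm ((k ^^ n) z) < 1)
      \<and> (k ^^ n) 0 = 0 \<and> ((k ^^ n) has_derivative (\<lambda>x. x)) (at 0)" for n
  proof (induction n)
    case 0
    show ?case using id by (simp add: id_def)
  next
    case (Suc n)
    have "holomorphic_map_on (\<lambda>x. k ((k ^^ n) x)) (ball 0 1)"
      by (rule holomorphic_map_on_compose[OF _ hol]) (use Suc in auto)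
    moreover have "((\<lambda>x. k ((k ^^ n) x)) has_derivative (\<lambda>x. x)) (at 0)"
      using has_derivative_compose[of "k ^^ n" "\<lambda>x. x" 0 UNIV k "\<lambda>x. x"] Suc kD by simp
    ultimately show ?case using Suc kb by (auto simp: k0 o_def)
  qed
  have itn: "norm ((k ^^ n) z - z) \<le> 2" if "norm z < 1" for n z
    using it[of n] that norm_triangle_ineq4[of "(k ^^ n) z" z] by force
  have ith: "holomorphic_map_on (\<lambda>z. (k ^^ n) z - z) (ball 0 1)" for n
    using it[of n] id by (intro holomorphic_map_on_diff) auto
  have it_le: "norm ((k ^^ n) z) \<le> norm z" if "norm z < 1" for n z
    by (rule schwarz_ball) (use it[of n] that in auto)
  have it2: "norm ((k ^^ n) z - z) \<le> 2 * norm z ^ Suc 1" if "norm z < 1" for n z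
  proof (rule schwarz_order[OF ith _ _ that])
    show "norm ((k ^^ n) z - z) \<le> 2" if "norm z < 1" for z by (rule itn[OF that])
    fix e :: real assume "0 < e"
    then obtain d where "d > 0" "\<And>y. norm (y - 0) < d \<Longrightarrow> norm ((k ^^ n) y - (k ^^ n) 0 - (y - 0)) \<le> e * norm (y - 0)"
      using it[of n] unfolding has_derivative_at_alt by blast
    then show "\<exists>r>0. \<forall>z. norm z < r \<longrightarrow> norm ((k ^^ n) z - z) \<le> e * norm z ^ 1"
      using it[of n] by auto
  qed
  define K where "K z = k z - z" for z
  have Kh: "holomorphic_map_on K (ball 0 1)" using ith[of 1] by (simp add: K_def[abs_def])
  have K2: "norm (K z) \<le> 2" if "norm z < 1" for z using itn[OF that, of 1] by (simp add: K_def)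
  have tele: "(k ^^ n) z - z = (\<Sum>j<n. K ((k ^^ j) z))" for n z
  proof -
    have "(\<Sum>j<n. (k ^^ Suc j) z - (k ^^ j) z) = (k ^^ n) z - (k ^^ 0) z" by (rule sum_lessThan_telescope)
    then show ?thesis by (simp only: K_def funpow.simps o_apply id_apply)
  qed
  have order: "norm (K z) \<le> 2 * norm z ^ Suc (Suc m)" if "norm z < 1" for z m
    using that
  proof (induction m arbitrary: z)
    case 0
    then show ?case using it2[of z 1] by (simp add: K_def)
  next
    case (Suc m)
    have itm: "norm ((k ^^ n) z - z) \<le> 2 * norm z ^ Suc (Suc m)" if z: "norm z < 1" for n z
    proof (rule schwarz_order[OF ith _ _ z])
      show "norm ((k ^^ n) z - z) \<le> 2" if "norm z < 1" for z by (rule itn[OF that])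
      fix e :: real assume e: "0 < e"
      show "\<exists>r>0. \<forall>z. norm z < r \<longrightarrow> norm ((k ^^ n) z - z) \<le> e * norm z ^ Suc m"
      proof (rule little_o_of_power[OF zero_less_one _ e])
        fix z :: 'a assume z: "norm z < 1"
        have "norm ((k ^^ n) z - z) \<le> (\<Sum>j<n. 2 * norm z ^ Suc (Suc m))"
          unfolding tele
        proof (rule sum_norm_le)
          fix j
          have "norm (K ((k ^^ j) z)) \<le> 2 * norm ((k ^^ j) z) ^ Suc (Suc m)"
            using it[of j] z by (intro Suc.IH) blast
          also have "\<dots> \<le> 2 * norm z ^ Suc (Suc m)"
            using it_le[OF z, of j] by (intro mult_left_mono power_mono) auto
          finally show "norm (K ((k ^^ j) z)) \<le> 2 * norm z ^ Suc (Suc m)" .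
        qed
        then show "norm ((k ^^ n) z - z) \<le> (real n * 2) * norm z ^ Suc (Suc m)" by simp
      qed
    qed
    define C where "C = 2 * 2 ^ Suc (Suc m) * (2::real)"
    have small: "norm (K z) \<le> C * norm z ^ Suc (Suc (Suc m))" if "norm z < 1 / 4" for z
    proof (cases "z = 0")
      case True
      then show ?thesis by (simp add: K_def k0)
    next
      case False
      define r where "r = norm z"
      have r: "0 < r" "2 * r < 1" "r < 1" using False that by (auto simp: r_def)
      have lip: "norm (K ((k ^^ j) z) - K z) \<le> C * r ^ Suc (Suc (Suc m))" for j
      proof -
        have "norm (K ((k ^^ j) z) - K z) \<le> 2 * (2 * r) ^ Suc (Suc m) / r * norm ((k ^^ j) z - z)"
        proof (rule holomorphic_lipschitz[OF Kh r(1,2)])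
          fix w :: 'a assume w: "norm w \<le> 2 * r"
          then have "norm (K w) \<le> 2 * norm w ^ Suc (Suc m)" using r by (intro Suc.IH) simp
          also have "\<dots> \<le> 2 * (2 * r) ^ Suc (Suc m)" using w by (intro mult_left_mono power_mono) auto
          finally show "norm (K w) \<le> 2 * (2 * r) ^ Suc (Suc m)" .
        qed (use it_le[of z j] r in \<open>auto simp: r_def\<close>)
        also have "\<dots> \<le> 2 * (2 * r) ^ Suc (Suc m) / r * (2 * r ^ Suc 1)"
          using it2[of z j] r by (intro mult_left_mono) (auto simp: r_def)
        also have "\<dots> = C * r ^ Suc (Suc (Suc m))"
          using r by (simp add: C_def power_mult_distrib)
        finally show ?thesis .
      qed
      have "norm (K z) \<le> 2 * r ^ Suc (Suc m) * inverse (real n) + C * r ^ Suc (Suc (Suc m))" if n: "0 < n" for n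
      proof -
        have "real n *\<^sub>R K z = ((k ^^ n) z - z) - (\<Sum>j<n. K ((k ^^ j) z) - K z)"
          by (simp add: tele sum_subtractf scaleR_conv_of_real sum_constant_scaleR)
        then have "norm (real n *\<^sub>R K z) \<le> norm ((k ^^ n) z - z) + norm (\<Sum>j<n. K ((k ^^ j) z) - K z)"
          by (simp only: norm_triangle_ineq4)
        also have "norm ((k ^^ n) z - z) \<le> 2 * r ^ Suc (Suc m)" using itm[of z n] r by (simp add: r_def)
        also have "norm (\<Sum>j<n. K ((k ^^ j) z) - K z) \<le> (\<Sum>j<n. C * r ^ Suc (Suc (Suc m)))"
          by (intro sum_norm_le lip)
        finally have "real n * norm (K z) \<le> 2 * r ^ Suc (Suc m) + real n * (C * r ^ Suc (Suc (Suc m)))" by simp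
        then have "inverse (real n) * (real n * norm (K z)) \<le>
            inverse (real n) * (2 * r ^ Suc (Suc m) + real n * (C * r ^ Suc (Suc (Suc m))))"
          by (intro mult_left_mono) auto
        moreover have "inverse (real n) * (real n * x) = x" for x using n by simp
        ultimately show ?thesis by (simp only: distrib_left mult.commute[of "inverse (real n)" "2 * _"])
      qed
      then have ev: "\<forall>\<^sub>F n in sequentially. norm (K z) \<le> 2 * r ^ Suc (Suc m) * inverse (real n) + C * r ^ Suc (Suc (Suc m))"
        by (intro eventually_sequentiallyI[of 1]) simp
      have lim: "(\<lambda>n. 2 * r ^ Suc (Suc m) * inverse (real n) + C * r ^ Suc (Suc (Suc m)))
          \<longlonglongrightarrow> 2 * r ^ Suc (Suc m) * 0 + C * r ^ Suc (Suc (Suc m))"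
        by (intro tendsto_intros lim_inverse_n)
      have "norm (K z) \<le> 2 * r ^ Suc (Suc m) * 0 + C * r ^ Suc (Suc (Suc m))"
        by (rule tendsto_lowerbound[OF lim ev]) simp
      then show ?thesis by (simp add: r_def)
    qed
    show ?case
    proof (rule schwarz_order[OF Kh _ _ Suc.prems])
      show "norm (K z) \<le> 2" if "norm z < 1" for z by (rule K2[OF that])
      show "\<exists>r>0. \<forall>z. norm z < r \<longrightarrow> norm (K z) \<le> e * norm z ^ Suc (Suc m)" if "0 < e" for e
        by (rule little_o_of_power[of "1/4" K C "Suc (Suc m)" e, OF _ small that]) simp_all
    qed
  qed
  have "(\<lambda>m. 2 * (norm z ^ 2 * norm z ^ m)) \<longlonglongrightarrow> 2 * (norm z ^ 2 * 0)"
    using z by (intro tendsto_intros LIMSEQ_power_zero) simp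
  moreover have "\<forall>\<^sub>F m in sequentially. norm (K z) \<le> 2 * (norm z ^ 2 * norm z ^ m)"
    using order[OF z] by (intro always_eventually allI) (simp add: power2_eq_square mult_ac)
  ultimately have "norm (K z) \<le> 2 * (norm z ^ 2 * 0)" by (rule tendsto_lowerbound) simp
  then show ?thesis by (simp add: K_def)
qed

lemma derivative_contraction:
  fixes g :: "'a::real_normed_vector \<Rightarrow> 'b::real_normed_vector"
  assumes D: "(g has_derivative D) (at 0)" and g0: "g 0 = 0" and le: "\<And>z. norm z < 1 \<Longrightarrow> norm (g z) \<le> norm z"
  shows "norm (D x) \<le> norm x"
proof (rule field_le_epsilon)
  fix e :: real assume e: "0 < e"
  have lin: "linear D" using D by (auto simp: has_derivative_def bounded_linear.linear)
  define \<eta> where "\<eta> = e / (norm x + 1)"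
  have \<eta>: "0 < \<eta>" using e by (simp add: \<eta>_def add_nonneg_pos)
  then obtain d where d: "d > 0" "\<And>y. norm y < d \<Longrightarrow> norm (g y - D y) \<le> \<eta> * norm y"
    using D unfolding has_derivative_at_alt by (auto simp: g0)
  define t where "t = min 1 d / (2 * (norm x + 1))"
  have nx: "0 < norm x + 1" by (simp add: add_nonneg_pos)
  have t: "0 < t" using d(1) nx by (simp add: t_def)
  have "t * norm x < min 1 d"
  proof -
    have "t * norm x \<le> t * (norm x + 1)" using t by (intro mult_left_mono) auto
    also have "\<dots> = min 1 d / 2"
    proof -
      have "m / (2 * N) * N = m / 2" if "0 < N" for m N :: real using that by simp
      from this[OF nx] show ?thesis by (simp only: t_def)
    qed
    also have "\<dots> < min 1 d"
    proof -
      have "0 < min 1 d" using d(1) by simp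
      then show ?thesis by linarith
    qed
    finally show ?thesis .
  qed
  then have ty: "norm (t *\<^sub>R x) < 1" "norm (t *\<^sub>R x) < d" using t by simp_all
  have "norm (D (t *\<^sub>R x)) \<le> norm (g (t *\<^sub>R x)) + norm (g (t *\<^sub>R x) - D (t *\<^sub>R x))"
    using norm_triangle_ineq4[of "g (t *\<^sub>R x)" "g (t *\<^sub>R x) - D (t *\<^sub>R x)"] by simp
  with le[OF ty(1)] d(2)[OF ty(2)] have "norm (D (t *\<^sub>R x)) \<le> norm (t *\<^sub>R x) + \<eta> * norm (t *\<^sub>R x)" by linarith
  then have "t * norm (D x) \<le> t * (norm x + \<eta> * norm x)"
    using t by (simp add: linear_scale[OF lin] algebra_simps)
  then have "norm (D x) \<le> norm x + \<eta> * norm x" using t by (simp add: mult_le_cancel_left)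
  also have "\<eta> * norm x \<le> \<eta> * (norm x + 1)" using \<eta> by (intro mult_left_mono) auto
  also have "\<eta> * (norm x + 1) = e"
  proof -
    have "e / N * N = e" if "0 < N" for N :: real using that by simp
    from this[OF nx] show ?thesis by (simp only: \<eta>_def)
  qed
  finally show "norm (D x) \<le> norm x + e" by simp
qed

lemma ball_automorphism_fixing_0_linear:
  fixes h :: "'a::complex_banach \<Rightarrow> 'a"
  assumes h: "holomorphic_map_on h (ball 0 1)" "\<And>z. norm z < 1 \<Longrightarrow> norm (h z) < 1" "h 0 = 0"
    and k: "holomorphic_map_on k (ball 0 1)" "\<And>z. norm z < 1 \<Longrightarrow> norm (k z) < 1" "k 0 = 0"
    and hk: "\<And>z. norm z < 1 \<Longrightarrow> h (k z) = z" and kh: "\<And>z. norm z < 1 \<Longrightarrow> k (h z) = z"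
  obtains D where "bounded_clinear_map D" "\<And>x. norm (D x) \<le> norm x" "\<And>z. norm z < 1 \<Longrightarrow> h z = D z"
proof -
  obtain D where D: "(h has_derivative D) (at 0)" "bounded_clinear_map D"
    using h(1) by (force simp: holomorphic_map_on_def)
  obtain E where E: "(k has_derivative E) (at 0)" "bounded_clinear_map E"
    using k(1) by (force simp: holomorphic_map_on_def)
  have inv: "(\<lambda>x. F' (F x)) = (\<lambda>x. x)"
    if "(f has_derivative F) (at 0)" "(g has_derivative F') (at 0)" "f 0 = 0" "\<And>z. norm z < 1 \<Longrightarrow> g (f z) = z"
    for f g :: "'a \<Rightarrow> 'a" and F F'
  proof (rule has_derivative_unique)
    have "((\<lambda>x. g (f x)) has_derivative (\<lambda>x. F' (F x))) (at 0)"
      using has_derivative_compose[OF that(1)] that(2,3) by simp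
    then show "((\<lambda>x. x) has_derivative (\<lambda>x. F' (F x))) (at 0)"
      by (rule has_derivative_transform_within_open[OF _ open_ball[of 0 1]]) (use that(4) in auto)
  qed (rule has_derivative_ident)
  have "(\<lambda>x. E (D x)) = (\<lambda>x. x)" by (rule inv[OF D(1) E(1) h(3)]) (rule kh)
  then have ED: "E (D x) = x" for x by (rule fun_cong)
  have "(\<lambda>x. D (E x)) = (\<lambda>x. x)" by (rule inv[OF E(1) D(1) k(3)]) (rule hk)
  then have DE: "D (E x) = x" for x by (rule fun_cong)
  have nD: "norm (D x) \<le> norm x" for x
    by (rule derivative_contraction[OF D(1) h(3)]) (rule schwarz_ball[OF h])
  have nE: "norm (E x) \<le> norm x" for x
    by (rule derivative_contraction[OF E(1) k(3)]) (rule schwarz_ball[OF k])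
  have "E (h z) = z" if z: "norm z < 1" for z
  proof (rule cartan_uniqueness[OF _ _ _ _ z])
    show "holomorphic_map_on (\<lambda>z. E (h z)) (ball 0 1)"
      by (rule holomorphic_map_on_compose[OF h(1) bounded_clinear_map_holomorphic[OF E(2)], of UNIV]) simp
    show "norm (E (h z)) < 1" if "norm z < 1" for z using nE[of "h z"] h(2)[OF that] by simp
    show "E (h 0) = 0" using linear_0[OF bounded_clinear_map_linear[OF E(2)]] by (simp add: h(3))
    have "((\<lambda>z. E (h z)) has_derivative (\<lambda>x. E (D x))) (at 0)"
      by (rule bounded_linear.has_derivative[OF bounded_clinear_map_bounded_linear[OF E(2)] D(1)])
    then show "((\<lambda>z. E (h z)) has_derivative (\<lambda>x. x)) (at 0)" by (simp add: ED)
  qed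
  then have "h z = D z" if "norm z < 1" for z using DE that by metis
  with D(2) nD that show thesis by blast
qed

section \<open>Automorphisms of the ball and their boundary values\<close>

lemma unit_ball_autI:
  fixes g :: "'a::complex_banach \<Rightarrow> 'a"
  assumes g: "holomorphic_map_on g (ball 0 1)" "\<And>z. norm z < 1 \<Longrightarrow> norm (g z) < 1"
    and k: "holomorphic_map_on k (ball 0 1)" "\<And>z. norm z < 1 \<Longrightarrow> norm (k z) < 1"
    and gk: "\<And>z. norm z < 1 \<Longrightarrow> g (k z) = z" and kg: "\<And>z. norm z < 1 \<Longrightarrow> k (g z) = z"
  shows "restrict g (ball 0 1) \<in> unit_ball_aut"
proof -
  let ?g = "restrict g (ball 0 1)"
  have bij: "bij_betw ?g (ball 0 1) (ball 0 1)"
    by (rule bij_betw_byWitness[where f' = k]) (use g k gk kg in auto)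
  have inv: "inv_into (ball 0 1) ?g z = k z" if "z \<in> ball 0 1" for z
    by (rule inv_into_f_eq) (use bij that k gk in \<open>auto simp: bij_betw_def\<close>)
  have "holomorphic_map_on ?g (ball 0 1)"
    by (rule holomorphic_map_on_transform[OF g(1) open_ball]) simp
  moreover have "holomorphic_map_on (inv_into (ball 0 1) ?g) (ball 0 1)"
    by (rule holomorphic_map_on_transform[OF k(1) open_ball]) (simp only: inv)
  ultimately show ?thesis using bij by (simp add: unit_ball_aut_def)
qed

lemma unit_ball_aut0_subset: "unit_ball_aut0 \<subseteq> unit_ball_aut"
proof -
  have "openin unit_ball_aut_topology (topspace unit_ball_aut_topology)" by (rule openin_topspace)
  then have "topspace unit_ball_aut_topology \<subseteq> unit_ball_aut"
    unfolding openin_unit_ball_aut_topology unit_ball_aut_open_def by blast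
  then show ?thesis
    unfolding unit_ball_aut0_def by (rule order_trans[OF connected_component_of_subset_topspace])
qed

text \<open>A path of automorphisms that is continuous for the supremum norm on the ball is continuous for
  locally uniform convergence.\<close>

lemma uniform_path_in_unit_ball_aut0:
  fixes h :: "real \<Rightarrow> 'a::complex_banach \<Rightarrow> 'a"
  assumes aut: "\<And>s. s \<in> {0..1} \<Longrightarrow> h s \<in> unit_ball_aut"
    and uni: "\<And>s e. s \<in> {0..1} \<Longrightarrow> 0 < e \<Longrightarrow>
      \<forall>\<^sub>F t in at s within {0..1}. \<forall>z\<in>ball 0 1. dist (h t z) (h s z) < e"
    and h0: "h 0 = restrict (\<lambda>x. x) (ball 0 1)"
  shows "h 1 \<in> unit_ball_aut0"
proof -
  have op: "unit_ball_aut_open (unit_ball_aut :: ('a \<Rightarrow> 'a) set)"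
    unfolding unit_ball_aut_open_def by (auto simp: le_principal)
  then have top: "topspace unit_ball_aut_topology = (unit_ball_aut :: ('a \<Rightarrow> 'a) set)"
    using openin_subset[of unit_ball_aut_topology unit_ball_aut] openin_topspace[of unit_ball_aut_topology]
    unfolding openin_unit_ball_aut_topology unit_ball_aut_open_def by blast
  have "continuous_map (top_of_set {0..1}) unit_ball_aut_topology h"
    unfolding continuous_map_def
  proof (intro conjI allI impI)
    show "h \<in> topspace (top_of_set {0..1}) \<rightarrow> topspace unit_ball_aut_topology"
      using aut by (auto simp: top)
    fix U :: "('a \<Rightarrow> 'a) set" assume "openin unit_ball_aut_topology U"
    then have U: "unit_ball_aut_open U" by (simp add: openin_unit_ball_aut_topology)
    show "openin (top_of_set {0..1}) {s \<in> topspace (top_of_set {0..1}). h s \<in> U}"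
      unfolding openin_euclidean_subtopology_iff
    proof (intro conjI ballI)
      fix s :: real assume "s \<in> {s \<in> topspace (top_of_set {0..1}). h s \<in> U}"
      then have s: "s \<in> {0..1}" "h s \<in> U" by auto
      define F where "F = filtermap h (at s within {0..1})"
      have "F \<le> principal unit_ball_aut"
        using aut by (auto simp: F_def le_principal eventually_filtermap eventually_at_filter)
      moreover have "locally_uniform_limit (ball 0 1) (\<lambda>h. h) (h s) F"
        unfolding locally_uniform_limit_def
      proof (intro ballI exI[of _ 1] conjI)
        fix x :: 'a
        show "uniform_limit (ball 0 1 \<inter> ball x 1) (\<lambda>h. h) (h s) F"
          unfolding uniform_limit_iff F_def eventually_filtermap
        proof (intro allI impI)
          fix e :: real assume "0 < e"
          from uni[OF s(1) this]
          show "\<forall>\<^sub>F t in at s within {0..1}. \<forall>z\<in>ball 0 1 \<inter> ball x 1. dist (h t z) (h s z) < e"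
            by (rule eventually_mono) blast
        qed
      qed simp
      ultimately have "eventually (\<lambda>g. g \<in> U) F" using U s(2) unfolding unit_ball_aut_open_def by blast
      then obtain d where d: "d > 0" "\<And>t. t \<in> {0..1} \<Longrightarrow> t \<noteq> s \<Longrightarrow> dist t s < d \<Longrightarrow> h t \<in> U"
        unfolding F_def eventually_filtermap eventually_at by blast
      show "\<exists>e>0. \<forall>t\<in>{0..1}. dist t s < e \<longrightarrow> t \<in> {s \<in> topspace (top_of_set {0..1}). h s \<in> U}"
      proof (intro exI[of _ d] conjI ballI impI)
        fix t :: real assume "t \<in> {0..1}" "dist t s < d"
        then show "t \<in> {s \<in> topspace (top_of_set {0..1}). h s \<in> U}"
          using d(2)[of t] s by (cases "t = s") auto
      qed (rule d(1))
    qed auto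
  qed
  moreover have "connectedin (top_of_set {0..1::real}) {0..1}"
    by (simp add: connectedin_subtopology)
  ultimately have "connectedin unit_ball_aut_topology (h ` {0..1})"
    by (rule connectedin_continuous_map_image)
  moreover have "h 0 \<in> h ` {0..1}" "h 1 \<in> h ` {0..1}" by auto
  ultimately show ?thesis
    unfolding unit_ball_aut0_def h0[symmetric] mem_Collect_eq connected_component_of_def by blast
qed

context jb_triple
begin

lemma flow_rotation_aut:
  assumes a: "control R a" and c: "cmod c = 1"
  shows "restrict (\<lambda>z. flow a (c *\<^sub>C z)) (ball 0 1) \<in> unit_ball_aut"
proof (rule unit_ball_autI)
  note ar = control_reversed[OF a]
  have cc: "cnj c * c = 1" "c * cnj c = 1" using c complex_norm_square[of c] by (simp_all add: mult.commute)
  have nc: "norm (c *\<^sub>C z) = norm z" "norm (cnj c *\<^sub>C z) = norm z" for z :: 'z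
    using c by (simp_all add: norm_scaleC)
  show "holomorphic_map_on (\<lambda>z. flow a (c *\<^sub>C z)) (ball 0 1)"
    by (rule holomorphic_map_on_compose[OF bounded_clinear_map_holomorphic[OF bounded_clinear_map_scaleC_left]
          flow_holomorphic[OF a]]) (simp add: nc)
  show "holomorphic_map_on (\<lambda>z. cnj c *\<^sub>C flow (reversed a) z) (ball 0 1)"
    by (rule holomorphic_map_on_compose[OF flow_holomorphic[OF ar]
          bounded_clinear_map_holomorphic[OF bounded_clinear_map_scaleC_left], where U = UNIV]) simp
  fix z :: 'z assume z: "norm z < 1"
  show "norm (flow a (c *\<^sub>C z)) < 1" using flow_norm_less[OF a, of "c *\<^sub>C z"] z by (simp add: nc)
  show "norm (cnj c *\<^sub>C flow (reversed a) z) < 1" using flow_norm_less[OF ar, of z] z by (simp add: nc)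
  show "flow a (c *\<^sub>C (cnj c *\<^sub>C flow (reversed a) z)) = z"
    using flow_reversed[OF ar, of z] z by (simp add: scaleC_scaleC cc reversed_reversed)
  show "cnj c *\<^sub>C flow (reversed a) (flow a (c *\<^sub>C z)) = z"
    using flow_reversed[OF a, of "c *\<^sub>C z"] z by (simp add: nc scaleC_scaleC cc)
qed

text \<open>The path runs the flow up to time \<open>s\<close> after a rotation by the angle \<open>s \<theta>\<close>.\<close>

lemma flow_rotation_aut0:
  assumes a: "control R a"
  shows "restrict (\<lambda>z. flow a (cis \<theta> *\<^sub>C z)) (ball 0 1) \<in> unit_ball_aut0"
proof -
  define h where "h s = restrict (\<lambda>z. flow (scaled a s) (cis (s * \<theta>) *\<^sub>C z)) (ball 0 1)" for s :: real
  have "h 1 \<in> unit_ball_aut0"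
  proof (rule uniform_path_in_unit_ball_aut0)
    show "h s \<in> unit_ball_aut" if "s \<in> {0..1}" for s
      unfolding h_def by (rule flow_rotation_aut[OF control_scaled[OF a that]]) simp
    show "h 0 = restrict (\<lambda>x. x) (ball 0 1)"
      unfolding h_def
    proof (rule restrict_ext)
      fix z :: 'z assume "z \<in> ball 0 1"
      then have z: "norm z \<le> 1" by simp
      obtain \<phi> where \<phi>: "traj a z \<phi>" by (rule traj_exists[OF a z])
      with flow_scaled[OF a \<phi>, of 0] show "flow (scaled a 0) (cis (0 * \<theta>) *\<^sub>C z) = z" by (simp add: traj_def)
    qed
    fix s e :: real assume s: "s \<in> {0..1}" and e: "0 < e"
    define C where "C = 2 * exp (16 * R)"
    have C0: "0 \<le> C" by (simp add: C_def)
    have dist_le: "dist (h t z) (h s z) \<le> 5 * R * \<bar>t - s\<bar> + C * cmod (cis (t * \<theta>) - cis (s * \<theta>))"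
      if t: "t \<in> {0..1}" and z: "z \<in> ball 0 1" for t z
    proof -
      let ?x = "cis (t * \<theta>) *\<^sub>C z" and ?y = "cis (s * \<theta>) *\<^sub>C z"
      have n: "norm ?x \<le> 1" "norm ?y \<le> 1" using z by (simp_all add: norm_scaleC)
      have "norm (flow (scaled a t) ?x - flow (scaled a s) ?x) \<le> 5 * R * \<bar>t - s\<bar>"
        by (rule flow_scaled_dist[OF a n(1) t s])
      moreover have "norm (flow (scaled a s) ?x - flow (scaled a s) ?y) \<le> C * norm (?x - ?y)"
        unfolding C_def by (rule flow_lipschitz[OF control_scaled[OF a s] n])
      moreover have "norm (?x - ?y) \<le> cmod (cis (t * \<theta>) - cis (s * \<theta>))"
      proof -
        have "?x - ?y = (cis (t * \<theta>) - cis (s * \<theta>)) *\<^sub>C z" by (simp add: scaleC.diff_left)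
        then have "norm (?x - ?y) = cmod (cis (t * \<theta>) - cis (s * \<theta>)) * norm z" by (simp only: norm_scaleC)
        also have "\<dots> \<le> cmod (cis (t * \<theta>) - cis (s * \<theta>)) * 1" using z by (intro mult_left_mono) auto
        finally show ?thesis by simp
      qed
      then have "C * norm (?x - ?y) \<le> C * cmod (cis (t * \<theta>) - cis (s * \<theta>))" using C0 by (rule mult_left_mono)
      moreover have "norm (flow (scaled a t) ?x - flow (scaled a s) ?y) \<le>
          norm (flow (scaled a t) ?x - flow (scaled a s) ?x) + norm (flow (scaled a s) ?x - flow (scaled a s) ?y)"
        by (rule norm_diff_triangle_ineq[of "flow (scaled a t) ?x" "flow (scaled a s) ?x"
              "flow (scaled a s) ?x" "flow (scaled a s) ?y", simplified])
      ultimately show ?thesis using z by (simp add: h_def dist_norm)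
    qed
    have "((\<lambda>t. 5 * R * \<bar>t - s\<bar> + C * cmod (cis (t * \<theta>) - cis (s * \<theta>))) \<longlongrightarrow>
        5 * R * \<bar>s - s\<bar> + C * cmod (cis (s * \<theta>) - cis (s * \<theta>))) (at s within {0..1})"
      unfolding cis_conv_exp by (intro tendsto_intros)
    then have "((\<lambda>t. 5 * R * \<bar>t - s\<bar> + C * cmod (cis (t * \<theta>) - cis (s * \<theta>))) \<longlongrightarrow> 0) (at s within {0..1})" by simp
    from order_tendstoD(2)[OF this e]
    have "\<forall>\<^sub>F t in at s within {0..1}. 5 * R * \<bar>t - s\<bar> + C * cmod (cis (t * \<theta>) - cis (s * \<theta>)) < e" .
    moreover have "\<forall>\<^sub>F t in at s within {0..1}. t \<in> {0..1}" by (simp add: eventually_at_filter)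
    ultimately show "\<forall>\<^sub>F t in at s within {0..1}. \<forall>z\<in>ball 0 1. dist (h t z) (h s z) < e"
      by eventually_elim (use dist_le in \<open>blast intro: order_le_less_trans\<close>)
  qed
  then show ?thesis by (simp add: h_def scaled_def[abs_def])
qed

lemma boundary_value_eq:
  assumes a: "control R a" and D: "linear D" "\<And>x. norm (D x) \<le> norm x"
    and g: "\<And>z. norm z < 1 \<Longrightarrow> g z = flow a (D z)" and v: "norm v = 1"
  shows "boundary_value g v = flow a (D v)"
  unfolding boundary_value_def
proof (rule tendsto_Lim)
  have "v \<in> closure (ball 0 1)" using v by simp
  moreover have "ball 0 1 - {v} = ball 0 1" using v by auto
  ultimately show "\<not> trivial_limit (at v within ball 0 1)"
    by (simp add: trivial_limit_within islimpt_in_closure)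
  define C where "C = 2 * exp (16 * R)"
  have lim: "((\<lambda>z. C * norm (z - v)) \<longlongrightarrow> 0) (at v within ball 0 1)"
  proof -
    have "((\<lambda>z. C * norm (z - v)) \<longlongrightarrow> C * norm (v - v)) (at v within ball 0 1)" by (intro tendsto_intros)
    then show ?thesis by simp
  qed
  have "((\<lambda>z. g z - flow a (D v)) \<longlongrightarrow> 0) (at v within ball 0 1)"
  proof (rule Lim_null_comparison[OF _ lim])
    show "\<forall>\<^sub>F z in at v within ball 0 1. norm (g z - flow a (D v)) \<le> C * norm (z - v)"
      unfolding eventually_at_filter
    proof (intro always_eventually allI impI)
      fix z :: 'z assume "z \<in> ball 0 1"
      then have z: "norm z < 1" by simp
      have "norm (D z) \<le> 1" "norm (D v) \<le> 1" using D(2)[of z] D(2)[of v] z v by linarith+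
      then have "norm (flow a (D z) - flow a (D v)) \<le> C * norm (D z - D v)"
        unfolding C_def by (rule flow_lipschitz[OF a])
      also have "\<dots> \<le> C * norm (z - v)"
        using D(2)[of "z - v"] by (intro mult_left_mono) (simp_all add: linear_diff[OF D(1)] C_def)
      finally show "norm (g z - flow a (D v)) \<le> C * norm (z - v)" by (simp only: g[OF z])
    qed
  qed
  then show "(g \<longlongrightarrow> flow a (D v)) (at v within ball 0 1)" by (simp add: LIM_zero_iff)
qed

text \<open>Every automorphism has boundary values, in the closed ball: composed with a flow moving its
  value at the origin back to the origin it is linear, by Cartan's theorem.\<close>

lemma unit_ball_aut_boundary_value:
  fixes g :: "'z \<Rightarrow> 'z"
  assumes g: "g \<in> unit_ball_aut" and v: "norm v = 1"
  shows "norm (boundary_value g v) \<le> 1"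
proof -
  define k where "k = inv_into (ball 0 1) g"
  have bij: "bij_betw g (ball 0 1) (ball 0 1)" and gh: "holomorphic_map_on g (ball 0 1)"
    and kh: "holomorphic_map_on k (ball 0 1)"
    using g by (auto simp: unit_ball_aut_def k_def)
  have gb: "norm (g z) < 1" if "norm z < 1" for z using bij_betwE[OF bij] that by simp
  have kb: "norm (k z) < 1" if "norm z < 1" for z
    using bij_betwE[OF bij_betw_inv_into[OF bij]] that by (simp add: k_def)
  have gk: "g (k z) = z" if "norm z < 1" for z
    using bij_betw_inv_into_right[OF bij, of z] that by (simp add: k_def)
  have kg: "k (g z) = z" if "norm z < 1" for z
    using bij_betw_inv_into_left[OF bij, of z] that by (simp add: k_def)
  have "norm (g 0) < 1" by (rule gb) simp
  then obtain R a where a: "control R a" "flow a 0 = g 0" by (rule flow_reaches)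
  note ar = control_reversed[OF a(1)]
  have fr: "flow (reversed a) (flow a z) = z" "flow a (flow (reversed a) z) = z" if "norm z < 1" for z
    using flow_reversed[OF a(1) less_imp_le[OF that]]
      flow_reversed[OF ar less_imp_le[OF that], unfolded reversed_reversed] .
  have fb: "norm (flow a z) < 1" "norm (flow (reversed a) z) < 1" if "norm z < 1" for z
    using flow_norm_less[OF a(1) less_imp_le[OF that] that] flow_norm_less[OF ar less_imp_le[OF that] that] .
  have r0: "flow (reversed a) (g 0) = 0" using fr(1)[of 0] by (simp add: a(2))
  obtain D where D: "bounded_clinear_map D" "\<And>x. norm (D x) \<le> norm x"
    "\<And>z. norm z < 1 \<Longrightarrow> flow (reversed a) (g z) = D z"
  proof (rule ball_automorphism_fixing_0_linear[of "\<lambda>z. flow (reversed a) (g z)" "\<lambda>z. k (flow a z)"])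
    show "holomorphic_map_on (\<lambda>z. flow (reversed a) (g z)) (ball 0 1)"
      by (rule holomorphic_map_on_compose[OF gh flow_holomorphic[OF ar]]) (use gb in simp)
    show "holomorphic_map_on (\<lambda>z. k (flow a z)) (ball 0 1)"
      by (rule holomorphic_map_on_compose[OF flow_holomorphic[OF a(1)] kh]) (use fb in simp)
    show "k (flow a 0) = 0" using kg[of 0] by (simp add: a(2))
  qed (use gb kb fb gk kg fr r0 in auto)
  have "g z = flow a (D z)" if "norm z < 1" for z using fr(2)[OF gb[OF that]] D(3)[OF that] by simp
  then have "boundary_value g v = flow a (D v)"
    by (intro boundary_value_eq[OF a(1) bounded_clinear_map_linear[OF D(1)] D(2) _ v])
  moreover have "norm (D v) \<le> 1" using D(2)[of v] v by simp
  ultimately show ?thesis using flow_norm_le[OF a(1)] by simp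
qed

section \<open>The values of a holomorphic map\<close>

text \<open>The flow maps the circle through \<open>v\<close> into the orbit, and its centre to \<open>b\<close>. If
  \<open>f b\<close> were not in the closed convex hull, a functional separating it would violate the maximum
  principle on the disc.\<close>

lemma value_in_hull_orbit:
  fixes f :: "'z \<Rightarrow> 'x::complex_banach"
  assumes f: "holomorphic_map_on f (ball 0 1)" and fc: "continuous_on (cball 0 1) f"
    and v: "norm v = 1" and b: "norm b < 1"
  shows "f b \<in> closure (convex hull (f ` orbit0 v))"
proof (rule ccontr)
  define C where "C = closure (convex hull (f ` orbit0 v))"
  assume "f b \<notin> closure (convex hull (f ` orbit0 v))"
  then have "f b \<in> - C" "open (- C)" by (auto simp: C_def)
  then obtain d where d: "d > 0" "ball (f b) d \<subseteq> - C" by (meson open_contains_ball)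
  have dC: "d \<le> norm (c - f b)" if "c \<in> C" for c
    using d(2) that by (force simp: dist_norm norm_minus_commute)
  obtain R a where a: "control R a" "flow a 0 = b" using flow_reaches[OF b] by blast
  have orb: "f (flow a (cis \<theta> *\<^sub>C v)) \<in> C" for \<theta>
  proof -
    have "boundary_value (restrict (\<lambda>z. flow a (cis \<theta> *\<^sub>C z)) (ball 0 1)) v = flow a (cis \<theta> *\<^sub>C v)"
      by (rule boundary_value_eq[OF a(1) _ _ _ v])
        (auto simp: norm_scaleC intro: bounded_linear.linear scaleC.bounded_linear_right)
    with flow_rotation_aut0[OF a(1), of \<theta>] have "flow a (cis \<theta> *\<^sub>C v) \<in> orbit0 v"
      unfolding orbit0_def by (metis imageI)
    then show ?thesis
      unfolding C_def using hull_subset[of "f ` orbit0 v" convex] closure_subset by blast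
  qed
  have "convex C" unfolding C_def by (intro convex_closure convex_convex_hull)
  moreover have "C \<noteq> {}" using orb[of 0] by blast
  ultimately obtain \<Psi> where \<Psi>: "dual_unit \<Psi>" "\<And>c. c \<in> C \<Longrightarrow> Re (\<Psi> c) \<le> Re (\<Psi> (f b)) - d"
    using complex_separation[OF _ _ dC] by blast
  define F where "F w = \<Psi> (f (flow a (0 + w *\<^sub>C v)))" for w
  have nv: "norm (w *\<^sub>C v) = cmod w" for w by (simp add: norm_scaleC v)
  have "Re (F 0) \<le> Re (\<Psi> (f b)) - d"
  proof (rule maximum_real_frontier[where f = F and S = "ball 0 1"])
    have "holomorphic_map_on (\<lambda>z. f (flow a z)) (ball 0 1)"
      by (rule holomorphic_map_on_compose[OF flow_holomorphic[OF a(1)] f])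
        (use flow_norm_less[OF a(1)] in \<open>simp add: less_imp_le\<close>)
    from slice_holomorphic[OF this \<Psi>(1), of "ball 0 1" 0 v]
    show "F holomorphic_on interior (ball 0 1)" by (simp add: F_def[abs_def] nv)
    have fl: "continuous_on (cball 0 1) (flow a)"
      by (rule lipschitz_on_continuous_on[of "2 * exp (16 * R)"], rule lipschitz_onI)
        (auto simp: dist_norm intro: flow_lipschitz[OF a(1)])
    have "continuous_on (cball 0 1) (\<lambda>w. w *\<^sub>C v)"
      by (intro linear_continuous_on scaleC.bounded_linear_left)
    then have "continuous_on (cball 0 1) (\<lambda>w. flow a (w *\<^sub>C v))"
      by (rule continuous_on_compose2[OF fl]) (auto simp: nv)
    then have "continuous_on (cball 0 1) (\<lambda>w. f (flow a (w *\<^sub>C v)))"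
      by (rule continuous_on_compose2[OF fc]) (use flow_norm_le[OF a(1)] nv in auto)
    then show "continuous_on (closure (ball 0 1)) F"
      unfolding F_def
      by (intro continuous_on_compose2[OF linear_continuous_on[OF dual_unit_bounded_linear[OF \<Psi>(1)], of UNIV]]) auto
    fix w :: complex assume "w \<in> frontier (ball 0 1)"
    then have "cmod w = 1" by simp
    then obtain \<theta> where "w = cis \<theta>" using rcis_cmod_Arg[of w] by (metis mult_1 of_real_1 rcis_def)
    then show "Re (F w) \<le> Re (\<Psi> (f b)) - d" using \<Psi>(2)[OF orb] by (simp add: F_def)
  qed auto
  then show False using d(1) by (simp add: F_def a(2) scaleC.zero_left)
qed

end

theorem proposition4p3:
  fixes tp :: "'z::complex_banach \<Rightarrow> 'z \<Rightarrow> 'z \<Rightarrow> 'z"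
    and f :: "'z \<Rightarrow> 'x::complex_banach"
    and v :: 'z
  assumes "jb_star_triple tp"
    and "holomorphic_map_on f (ball 0 1)"
    and "continuous_on (closure (ball 0 1)) f"
    and "v \<in> frontier (ball 0 1)"
  shows "f ` closure (ball 0 1) \<subseteq> closure (convex hull (f ` orbit0 v))
    \<and> (SUP z\<in>closure (ball 0 1). ennreal (norm (f z))) = (SUP z\<in>orbit0 v. ennreal (norm (f z)))
    \<and> (\<not> bounded (f ` closure (ball 0 1)) \<longrightarrow>
         (SUP z\<in>closure (ball 0 1). ennreal (norm (f z))) = \<infinity> \<and>
         (SUP z\<in>orbit0 v. ennreal (norm (f z))) = \<infinity>)"
proof -
  interpret jb_triple tp by standard (rule assms(1))
  have v: "norm v = 1" using assms(4) by simp
  let ?B = "closure (ball 0 1) :: 'z set" and ?C = "closure (convex hull (f ` orbit0 v))"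
  let ?S = "SUP z\<in>?B. ennreal (norm (f z))" and ?T = "SUP z\<in>orbit0 v. ennreal (norm (f z))"
  have fc: "continuous_on (cball 0 1) f" using assms(3) by simp
  have "f ` ball 0 1 \<subseteq> ?C" using value_in_hull_orbit[OF assms(2) fc v] by auto
  then have hull: "f ` ?B \<subseteq> ?C" by (intro image_closure_subset assms(3)) auto
  have "orbit0 v \<subseteq> ?B"
    using unit_ball_aut_boundary_value[OF _ v] unit_ball_aut0_subset by (auto simp: orbit0_def)
  then have "?T \<le> ?S" by (intro SUP_subset_mono) auto
  moreover have "?S \<le> ?T"
  proof (cases "?T = \<infinity>")
    case False
    then obtain \<beta> where \<beta>: "0 \<le> \<beta>" "?T = ennreal \<beta>" by (cases ?T) auto
    have "f ` orbit0 v \<subseteq> cball 0 \<beta>"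
    proof
      fix y assume "y \<in> f ` orbit0 v"
      then have "ennreal (norm y) \<le> ?T" by (auto intro: SUP_upper)
      with \<beta> show "y \<in> cball 0 \<beta>" by (simp add: ennreal_le_iff)
    qed
    then have "?C \<subseteq> cball 0 \<beta>" by (intro closure_minimal hull_minimal) auto
    with hull have "norm (f z) \<le> \<beta>" if "z \<in> ?B" for z using that by force
    then show ?thesis unfolding \<beta>(2) by (intro SUP_least ennreal_leI)
  next
    case True
    show ?thesis unfolding True by simp
  qed
  ultimately have eq: "?S = ?T" by simp
  have "?S = \<infinity>" if "\<not> bounded (f ` ?B)"
  proof (rule ccontr)
    assume "?S \<noteq> \<infinity>"
    then obtain \<beta> where \<beta>: "0 \<le> \<beta>" "?S = ennreal \<beta>" by (cases ?S) auto
    have "norm y \<le> \<beta>" if "y \<in> f ` ?B" for y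
    proof -
      have "ennreal (norm y) \<le> ?S" using that by (auto intro: SUP_upper)
      with \<beta> show ?thesis by (simp add: ennreal_le_iff)
    qed
    then have "bounded (f ` ?B)" by (auto simp: bounded_iff)
    with that show False by simp
  qed
  with hull eq show ?thesis by auto
qed

end
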